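(* Let $u$ be a positive integer. There is an algorithm that, given a set $S \subseteq [u]$ of $n$ elements, computes in $O\bigl(\sqrt{n \log n}\, u \log u\bigr)$ time the set $\mathcal{S}_u(S) = \{\, \sum_{y \in Y} y \mid Y \subseteq S \,\} \cap [u]$ of all subset sums of $S$ up to $u$.
   Context: For a real number $u \ge 0$, $[u]$ denotes the set of integers $\{0, 1, \ldots, \lceil u \rceil\}$. For a finite set $X \subset \mathbb{N}$, $\Sigma X = \sum_{x \in X} x$ (with $\Sigma \emptyset = 0$), and $\mathcal{S}_u(X) = \{\Sigma Y \mid Y \subseteq X\} \cap [u]$ is the set of all subset sums of $X$ that are at most $u$. Running times are measured in the standard RAM model of computation with arithmetic on integers of the relevant size in constant time. *)

theory Defs
  imports Complex_Main
begin

definition upto_set :: "real \<Rightarrow> nat set" where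
  "upto_set u = {0..nat \<lceil>u\<rceil>}"

definition subset_sums :: "real \<Rightarrow> nat set \<Rightarrow> nat set" where
  "subset_sums u X = {\<Sum>Y | Y. Y \<subseteq> X} \<inter> upto_set u"

datatype instr =
    Const nat int
  | Add nat nat nat
  | Sub nat nat nat
  | Mul nat nat nat
  | Div nat nat nat
  | Mod nat nat nat
  | Load nat nat
  | Store nat nat
  | Jz nat nat
  | Jneg nat nat
  | Jmp nat

type_synonym prog = "instr list"
type_synonym config = "nat \<times> (nat \<Rightarrow> int)"

fun exec :: "instr \<Rightarrow> config \<Rightarrow> config" where
  "exec (Const r c) (pc, m) = (Suc pc, m(r := c))"
| "exec (Add r a b) (pc, m) = (Suc pc, m(r := m a + m b))"
| "exec (Sub r a b) (pc, m) = (Suc pc, m(r := m a - m b))"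
| "exec (Mul r a b) (pc, m) = (Suc pc, m(r := m a * m b))"
| "exec (Div r a b) (pc, m) = (Suc pc, m(r := m a div m b))"
| "exec (Mod r a b) (pc, m) = (Suc pc, m(r := m a mod m b))"
| "exec (Load r a) (pc, m) = (Suc pc, m(r := m (nat (m a))))"
| "exec (Store r a) (pc, m) = (Suc pc, m(nat (m a) := m r))"
| "exec (Jz r l) (pc, m) = ((if m r = 0 then l else Suc pc), m)"
| "exec (Jneg r l) (pc, m) = ((if m r < 0 then l else Suc pc), m)"
| "exec (Jmp l) (pc, m) = (l, m)"

definition halted :: "prog \<Rightarrow> config \<Rightarrow> bool" where
  "halted P c \<longleftrightarrow> length P \<le> fst c"

definition step :: "prog \<Rightarrow> config \<Rightarrow> config" where
  "step P c = (if halted P c then c else exec (P ! fst c) c)"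

definition run :: "prog \<Rightarrow> nat \<Rightarrow> config \<Rightarrow> config" where
  "run P t c = (step P ^^ t) c"

definition init_mem :: "nat \<Rightarrow> nat list \<Rightarrow> nat \<Rightarrow> int" where
  "init_mem u xs a =
     (if a = 0 then int u
      else if a = 1 then int (length xs)
      else if a - 2 < length xs then int (xs ! (a - 2))
      else 0)"

definition init_config :: "nat \<Rightarrow> nat list \<Rightarrow> config" where
  "init_config u xs = (0, init_mem u xs)"

end

theory Submission
  imports Defs "HOL-Library.Set_Algebras" "HOL-Library.Product_Plus" "HOL-Library.Discrete_Functions"
    "HOL-Library.Log_Nat"
begin

text \<open>
  Split the input into its residue classes modulo \<open>b \<approx> sqrt (n log n)\<close>. An element of class \<open>l\<close> is \<open>y * b + l\<close>,
  so the sum of \<open>c\<close> such elements is \<open>s * b + c * l\<close> with \<open>s \<le> u / b\<close>, and it suffices to know the pairs \<open>(c, s)\<close>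
  attained by subsets of the class. A pair is encoded as \<open>c * W + s\<close>; the set of codes is computed by merging
  halves, each merge being one convolution of 0/1 sequences, which costs \<open>O((u / b) n log n log u)\<close> over all classes.
  Combining the \<open>b\<close> classes takes \<open>b\<close> further convolutions of length \<open>O(u)\<close>, at a cost of \<open>O(b u log u)\<close>.

  Convolutions use a fast Fourier transform in fixed-point complex arithmetic with \<open>O(log u)\<close> bits. Its steps split
  \<open>X^(2*m) - r\<^sup>2\<close> into \<open>(X^m - r) * (X^m + r)\<close>; visiting the roots \<open>r\<close> in bit-reversed order makes the table
  of roots independent of the length, and the inverse transform undoes the steps one by one. The entries of the
  convolution are integers, so rounding recovers them exactly once the accumulated error is below \<open>1 / 2\<close>.

  The program is written in a small language of while loops over integer variables and arrays, whose big-step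
  semantics counts steps and bounds all stored values, and is compiled to the machine. Arrays are interleaved above a
  base address kept in register 0, which makes them disjoint for all index ranges.
\<close>

section \<open>Subset sums by residue classes\<close>

lemma subset_sums_of_nat: "subset_sums (real u) X = {\<Sum>Y | Y. Y \<subseteq> X} \<inter> {..u}"
  by (auto simp: subset_sums_def upto_set_def)

lemma subset_sums_empty: "subset_sums (real u) {} = {0}"
  by (auto simp: subset_sums_of_nat)

lemma subset_sums_Un_disjoint:
  assumes "finite X" "finite Y" "X \<inter> Y = {}"
  shows "subset_sums (real u) (X \<union> Y) = (subset_sums (real u) X + subset_sums (real u) Y) \<inter> {..u}"
proof (intro set_eqI iffI)
  fix z assume "z \<in> subset_sums (real u) (X \<union> Y)"
  then obtain Z where subset: "z = \<Sum>Z" "Z \<subseteq> X \<union> Y" "z \<le> u" by (auto simp: subset_sums_of_nat)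
  have "Z = (Z \<inter> X) \<union> (Z \<inter> Y)" using subset(2) by blast
  then have "z = \<Sum>((Z \<inter> X) \<union> (Z \<inter> Y))" using subset(1) by simp
  also have "\<dots> = \<Sum>(Z \<inter> X) + \<Sum>(Z \<inter> Y)" by (rule sum.union_disjoint) (use assms in auto)
  finally have split: "z = \<Sum>(Z \<inter> X) + \<Sum>(Z \<inter> Y)" .
  then have "\<Sum>(Z \<inter> X) \<in> subset_sums (real u) X" "\<Sum>(Z \<inter> Y) \<in> subset_sums (real u) Y"
    using subset(3) by (auto simp: subset_sums_of_nat)
  then show "z \<in> (subset_sums (real u) X + subset_sums (real u) Y) \<inter> {..u}"
    using split subset(3) by auto
next
  fix z assume "z \<in> (subset_sums (real u) X + subset_sums (real u) Y) \<inter> {..u}"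
  then obtain X' Y' where parts: "z = \<Sum>X' + \<Sum>Y'" "X' \<subseteq> X" "Y' \<subseteq> Y" "z \<le> u"
    by (auto simp: subset_sums_of_nat elim!: set_plus_elim)
  have "\<Sum>(X' \<union> Y') = \<Sum>X' + \<Sum>Y'"
    by (rule sum.union_disjoint) (use parts assms finite_subset in blast)+
  then show "z \<in> subset_sums (real u) (X \<union> Y)"
    using parts by (auto simp: subset_sums_of_nat intro!: exI[of _ "X' \<union> Y'"])
qed

definition coded_sums :: "nat \<Rightarrow> nat \<Rightarrow> ('i \<Rightarrow> nat) \<Rightarrow> 'i set \<Rightarrow> nat set" where
  "coded_sums W q w I = {card J * W + sum w J | J. J \<subseteq> I \<and> sum w J \<le> q}"

lemma coded_sums_empty: "coded_sums W q w {} = {0}"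
  by (auto simp: coded_sums_def)

lemma coded_sums_singleton: "w i \<le> q \<Longrightarrow> coded_sums W q w {i} = {0, W + w i}"
  by (auto simp: coded_sums_def subset_singleton_iff intro: exI[of _ "{}"] exI[of _ "{i}"])

lemma coded_sums_less:
  assumes "z \<in> coded_sums W q w I" "q < W" "finite I"
  shows "z < (card I + 1) * W"
proof -
  obtain J where subset: "z = card J * W + sum w J" "J \<subseteq> I" "sum w J \<le> q"
    using assms(1) by (auto simp: coded_sums_def)
  have "card J * W \<le> card I * W" using card_mono[OF assms(3) subset(2)] by (rule mult_le_mono1)
  moreover have "(card I + 1) * W = card I * W + W" by simp
  ultimately show ?thesis using subset assms(2) by linarith
qed

text \<open>Since \<open>2 * q < W\<close>, no carry occurs when two codes are added, and \<open>z mod W\<close> is the sum encoded by \<open>z\<close>.\<close>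
lemma coded_sums_Un_disjoint:
  assumes "finite I" "finite J" "I \<inter> J = {}" and no_carry: "2 * q < W"
  shows "coded_sums W q w (I \<union> J) = {z \<in> coded_sums W q w I + coded_sums W q w J. z mod W \<le> q}"
proof (intro set_eqI iffI)
  fix z assume "z \<in> coded_sums W q w (I \<union> J)"
  then obtain K where subset: "z = card K * W + sum w K" "K \<subseteq> I \<union> J" "sum w K \<le> q"
    by (auto simp: coded_sums_def)
  have fin: "finite (K \<inter> I)" "finite (K \<inter> J)" using assms by auto
  have split: "K = (K \<inter> I) \<union> (K \<inter> J)" "(K \<inter> I) \<inter> (K \<inter> J) = {}" using subset(2) assms(3) by auto
  have card: "card K = card (K \<inter> I) + card (K \<inter> J)" using card_Un_disjoint[OF fin split(2)] split(1) by simp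
  have sum: "sum w K = sum w (K \<inter> I) + sum w (K \<inter> J)"
    using sum.union_disjoint[OF fin split(2), of w] split(1) by simp
  have "z = (card (K \<inter> I) * W + sum w (K \<inter> I)) + (card (K \<inter> J) * W + sum w (K \<inter> J))"
    unfolding subset(1) card sum by (simp add: algebra_simps)
  moreover have "card (K \<inter> I) * W + sum w (K \<inter> I) \<in> coded_sums W q w I"
    "card (K \<inter> J) * W + sum w (K \<inter> J) \<in> coded_sums W q w J"
    unfolding coded_sums_def using sum subset(3) by auto
  ultimately have "z \<in> coded_sums W q w I + coded_sums W q w J" by auto
  moreover have "z mod W = sum w K" using subset(1,3) no_carry by simp
  ultimately show "z \<in> {z \<in> coded_sums W q w I + coded_sums W q w J. z mod W \<le> q}" using subset(3) by simp
next
  fix z assume "z \<in> {z \<in> coded_sums W q w I + coded_sums W q w J. z mod W \<le> q}"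
  then obtain I' J' where parts: "z = (card I' * W + sum w I') + (card J' * W + sum w J')" "z mod W \<le> q"
    "I' \<subseteq> I" "sum w I' \<le> q" "J' \<subseteq> J" "sum w J' \<le> q" by (auto simp: coded_sums_def elim!: set_plus_elim)
  have disj: "finite I'" "finite J'" "I' \<inter> J' = {}" using parts assms finite_subset by blast+
  have card: "card (I' \<union> J') = card I' + card J'" by (rule card_Un_disjoint[OF disj])
  have sum: "sum w (I' \<union> J') = sum w I' + sum w J'" by (rule sum.union_disjoint[OF disj])
  have z_code: "z = card (I' \<union> J') * W + sum w (I' \<union> J')" unfolding card sum parts(1) by (simp add: algebra_simps)
  have "sum w (I' \<union> J') < W" unfolding sum using parts no_carry by linarith
  then have "z mod W = sum w (I' \<union> J')" unfolding z_code by simp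
  then show "z \<in> coded_sums W q w (I \<union> J)" unfolding coded_sums_def using z_code parts by auto
qed

definition decode :: "nat \<Rightarrow> nat \<Rightarrow> nat \<Rightarrow> nat \<Rightarrow> nat" where
  "decode W b l z = z mod W * b + z div W * l"

lemma sum_in_residue_class:
  fixes f :: "'i \<Rightarrow> nat"
  assumes "\<And>i. i \<in> J \<Longrightarrow> f i mod b = l"
  shows "sum f J = (\<Sum>i\<in>J. f i div b) * b + card J * l"
proof -
  have "sum f J = (\<Sum>i\<in>J. f i div b * b + l)"
    using assms by (intro sum.cong refl) (metis div_mult_mod_eq)
  then show ?thesis by (simp add: sum.distrib sum_distrib_right)
qed

lemma decode_code:
  assumes "\<And>i. i \<in> J \<Longrightarrow> f i mod b = l" "(\<Sum>i\<in>J. f i div b) < W"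
  shows "decode W b l (card J * W + (\<Sum>i\<in>J. f i div b)) = sum f J"
  using assms(2) sum_in_residue_class[of J f b l, OF assms(1)] by (simp add: decode_def)

lemma subset_sums_residue_class:
  assumes inj: "inj_on f I" and residue: "\<And>i. i \<in> I \<Longrightarrow> f i mod b = l" and "0 < b" and quot_less: "u div b < W"
  shows "subset_sums (real u) (f ` I) = decode W b l ` coded_sums W (u div b) (\<lambda>i. f i div b) I \<inter> {..u}"
proof (intro set_eqI iffI)
  fix v assume "v \<in> subset_sums (real u) (f ` I)"
  then obtain J where subset: "J \<subseteq> I" "v = sum f J" "v \<le> u"
    using inj_on_subset[OF inj] by (auto simp: subset_sums_of_nat subset_image_iff sum.reindex)
  have res_J: "f i mod b = l" if "i \<in> J" for i using residue subset(1) that by blast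
  have "(\<Sum>i\<in>J. f i div b) * b \<le> u" using sum_in_residue_class[of J f, OF res_J] subset by simp
  then have small: "(\<Sum>i\<in>J. f i div b) \<le> u div b" using \<open>0 < b\<close> by (simp add: less_eq_div_iff_mult_less_eq)
  then have "v = decode W b l (card J * W + (\<Sum>i\<in>J. f i div b))"
    using decode_code[of J f, OF res_J] quot_less subset(2) by simp
  then show "v \<in> decode W b l ` coded_sums W (u div b) (\<lambda>i. f i div b) I \<inter> {..u}"
    using subset small by (auto simp: coded_sums_def)
next
  fix v assume "v \<in> decode W b l ` coded_sums W (u div b) (\<lambda>i. f i div b) I \<inter> {..u}"
  then obtain J where subset: "v = decode W b l (card J * W + (\<Sum>i\<in>J. f i div b))" "J \<subseteq> I"
    "(\<Sum>i\<in>J. f i div b) \<le> u div b" "v \<le> u" by (auto simp: coded_sums_def)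
  have "v = sum f J" using decode_code[of J f b l W] residue subset quot_less by fastforce
  also have "\<dots> = \<Sum>(f ` J)" using inj_on_subset[OF inj subset(2)] by (simp add: sum.reindex)
  finally show "v \<in> subset_sums (real u) (f ` I)" using subset by (auto simp: subset_sums_of_nat)
qed

section \<open>A discrete Fourier transform in bit-reversed order\<close>

subsection \<open>Roots of unity\<close>

fun van_der_corput :: "nat \<Rightarrow> real" where
  "van_der_corput t = (if t = 0 then 0 else (of_bool (odd t) + van_der_corput (t div 2)) / 2)"

declare van_der_corput.simps [simp del]

lemma van_der_corput_0 [simp]: "van_der_corput 0 = 0"
  by (simp add: van_der_corput.simps)

lemma van_der_corput_rec: "van_der_corput t = (of_bool (odd t) + van_der_corput (t div 2)) / 2"
  by (cases "t = 0") (simp_all add: van_der_corput.simps[of t])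

lemma van_der_corput_high_bit:
  "r < 2 ^ k \<Longrightarrow> van_der_corput (2 ^ k + r) = 1 / 2 ^ Suc k + van_der_corput r"
proof (induction k arbitrary: r)
  case 0
  then show ?case by (simp add: van_der_corput_rec[of "Suc 0"])
next
  case (Suc k)
  have "(2 ^ Suc k + r) div 2 = 2 ^ k + r div 2" "odd (2 ^ Suc k + r) = odd r" by simp_all
  then have "van_der_corput (2 ^ Suc k + r) = (of_bool (odd r) + (1 / 2 ^ Suc k + van_der_corput (r div 2))) / 2"
    using Suc van_der_corput_rec[of "2 ^ Suc k + r"] by simp
  then show ?case by (simp add: van_der_corput_rec[of r] add_divide_distrib)
qed

lemma van_der_corput_denominator: "t < 2 ^ h \<Longrightarrow> 2 ^ h * van_der_corput t \<in> \<int>"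
proof (induction h arbitrary: t)
  case (Suc h)
  have "2 ^ Suc h * van_der_corput t = 2 ^ h * of_bool (odd t) + 2 ^ h * van_der_corput (t div 2)"
    by (simp add: van_der_corput_rec[of t] algebra_simps)
  then show ?case using Suc by simp
qed simp

definition twiddle :: "nat \<Rightarrow> complex" where
  "twiddle t = cis (pi * van_der_corput t)"

definition node :: "nat \<Rightarrow> complex" where
  "node t = cis (2 * pi * van_der_corput t)"

lemma twiddle_0 [simp]: "twiddle 0 = 1"
  by (simp add: twiddle_def)

lemma norm_twiddle [simp]: "cmod (twiddle t) = 1"
  and norm_node [simp]: "cmod (node t) = 1"
  by (simp_all add: twiddle_def node_def)

lemma twiddle_power2: "twiddle t ^ 2 = node t"
  by (simp add: twiddle_def node_def DeMoivre mult.assoc)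

lemma twiddle_high_bit: "r < 2 ^ k \<Longrightarrow> twiddle (2 ^ k + r) = cis (pi / 2 ^ Suc k) * twiddle r"
  by (simp add: twiddle_def van_der_corput_high_bit cis_mult distrib_left)

lemma node_eq: "node t = (- 1) ^ t * twiddle (t div 2)"
proof -
  have "2 * pi * van_der_corput t = pi * of_bool (odd t) + pi * van_der_corput (t div 2)"
    by (simp add: van_der_corput_rec[of t] algebra_simps)
  then show ?thesis by (simp add: node_def twiddle_def cis_mult[symmetric])
qed

lemma node_power: "t < 2 ^ h \<Longrightarrow> node t ^ 2 ^ h = 1"
  using cis_multiple_2pi[OF van_der_corput_denominator[of t h]] by (simp add: node_def DeMoivre ac_simps)

lemma node_power_mod:
  assumes "t < 2 ^ h"
  shows "node t ^ (k mod 2 ^ h) = node t ^ k"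
proof -
  have "node t ^ k = node t ^ (2 ^ h * (k div 2 ^ h) + k mod 2 ^ h)" by simp
  also have "\<dots> = (node t ^ 2 ^ h) ^ (k div 2 ^ h) * node t ^ (k mod 2 ^ h)" by (simp only: power_add power_mult)
  finally show ?thesis using node_power[OF assms] by simp
qed

subsection \<open>The partial transforms\<close>

text \<open>Block \<open>t\<close> of size \<open>m\<close> consists of the coefficients of the remainder of the polynomial
  \<open>\<Sum>i<q*m. a i * X^i\<close> modulo \<open>X^m - node t\<close>. A forward step splits the modulus \<open>X^(2*m) - node t\<close> into
  \<open>(X^m - twiddle t) * (X^m + twiddle t)\<close>, that is, \<open>(X^m - node (2*t)) * (X^m - node (2*t + 1))\<close>.\<close>
definition block_coeff :: "(nat \<Rightarrow> complex) \<Rightarrow> nat \<Rightarrow> nat \<Rightarrow> nat \<Rightarrow> nat \<Rightarrow> complex" where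
  "block_coeff a m q t j = (\<Sum>r<q. a (j + r * m) * node t ^ r)"

definition transform :: "(nat \<Rightarrow> complex) \<Rightarrow> nat \<Rightarrow> nat \<Rightarrow> nat \<Rightarrow> complex" where
  "transform a m q i = block_coeff a m q (i div m) (i mod m)"

lemma sum_even_odd: "(\<Sum>r<2 * q. f r) = (\<Sum>r<q. f (2 * r)) + (\<Sum>r<q. f (2 * r + 1))"
  for f :: "nat \<Rightarrow> 'a::comm_monoid_add"
  by (induction q) (auto simp: ac_simps)

lemma block_coeff_split:
  "block_coeff a m (2 * q) t j = block_coeff a (2 * m) q (t div 2) j +
    (- 1) ^ t * (twiddle (t div 2) * block_coeff a (2 * m) q (t div 2) (j + m))"
proof -
  let ?z = "(- 1) ^ t * twiddle (t div 2)"
  have even_power: "?z ^ (2 * r) = node (t div 2) ^ r" for r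
  proof -
    have "?z ^ 2 = node (t div 2)" by (simp add: power_mult_distrib twiddle_power2 flip: power_mult)
    then show ?thesis by (simp only: power_mult)
  qed
  have "block_coeff a m (2 * q) t j = (\<Sum>r<q. a (j + 2 * r * m) * ?z ^ (2 * r)) +
     (\<Sum>r<q. a (j + (2 * r + 1) * m) * ?z ^ (2 * r + 1))"
    unfolding block_coeff_def sum_even_odd node_eq[of t] ..
  also have "(\<Sum>r<q. a (j + 2 * r * m) * ?z ^ (2 * r)) = block_coeff a (2 * m) q (t div 2) j"
    unfolding block_coeff_def even_power by (simp add: mult.commute mult.left_commute)
  also have "(\<Sum>r<q. a (j + (2 * r + 1) * m) * ?z ^ (2 * r + 1)) =
    (- 1) ^ t * (twiddle (t div 2) * block_coeff a (2 * m) q (t div 2) (j + m))"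
    unfolding block_coeff_def sum_distrib_left power_add even_power
    by (intro sum.cong) (auto simp: algebra_simps)
  finally show ?thesis .
qed

lemma norm_transform_le:
  assumes "\<And>i. cmod (a i) \<le> A"
  shows "cmod (transform a m q i) \<le> real q * A"
proof -
  have "cmod (transform a m q i) \<le> (\<Sum>r<q. A)" unfolding transform_def block_coeff_def
    by (rule sum_norm_le) (simp add: norm_mult norm_power assms)
  then show ?thesis by simp
qed

lemma transform_one_block: "i < n \<Longrightarrow> transform a n 1 i = a i"
  by (simp add: transform_def block_coeff_def)

subsection \<open>Cyclic convolution\<close>

definition cyclic_conv :: "nat \<Rightarrow> (nat \<Rightarrow> 'a) \<Rightarrow> (nat \<Rightarrow> 'a) \<Rightarrow> nat \<Rightarrow> 'a::comm_semiring_1" where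
  "cyclic_conv n a b i = (\<Sum>j<n. \<Sum>k<n. of_bool ((j + k) mod n = i) * (a j * b k))"

lemma transform_cyclic_conv:
  assumes n_power: "n = 2 ^ h" and i_less: "i < n"
  shows "transform (cyclic_conv n a b) 1 n i = transform a 1 n i * transform b 1 n i"
proof -
  have "transform (cyclic_conv n a b) 1 n i =
    (\<Sum>r<n. \<Sum>j<n. \<Sum>k<n. of_bool ((j + k) mod n = r) * (a j * b k) * node i ^ r)"
    unfolding transform_def block_coeff_def cyclic_conv_def by (simp add: sum_distrib_right del: sum_of_bool_mult_eq)
  also have "\<dots> = (\<Sum>j<n. \<Sum>k<n. \<Sum>r<n. of_bool ((j + k) mod n = r) * (a j * b k) * node i ^ r)"
    by (subst sum.swap) (intro sum.cong refl sum.swap)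
  also have "\<dots> = (\<Sum>j<n. \<Sum>k<n. a j * b k * node i ^ ((j + k) mod n))"
    using i_less by (intro sum.cong refl) (simp add: of_bool_def if_distrib[of "\<lambda>x. x * _"] sum.delta cong: if_cong)
  also have "\<dots> = (\<Sum>j<n. \<Sum>k<n. (a j * node i ^ j) * (b k * node i ^ k))"
    using i_less unfolding n_power by (simp add: node_power_mod power_add ac_simps)
  also have "\<dots> = transform a 1 n i * transform b 1 n i"
    unfolding transform_def block_coeff_def by (simp add: sum_product)
  finally show ?thesis .
qed

lemma of_int_cyclic_conv:
  "(of_int (cyclic_conv n a b i) :: 'a::comm_ring_1) = cyclic_conv n (\<lambda>i. of_int (a i)) (\<lambda>i. of_int (b i)) i"
  by (simp add: cyclic_conv_def)

lemma cyclic_conv_indicator_bounds: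
  "(0::int) \<le> cyclic_conv n (\<lambda>i. of_bool (i \<in> X)) (\<lambda>i. of_bool (i \<in> Y)) i"
  "cyclic_conv n (\<lambda>i. of_bool (i \<in> X)) (\<lambda>i. of_bool (i \<in> Y)) i \<le> (int n)\<^sup>2"
proof -
  show "(0::int) \<le> cyclic_conv n (\<lambda>i. of_bool (i \<in> X)) (\<lambda>i. of_bool (i \<in> Y)) i"
    unfolding cyclic_conv_def by (intro sum_nonneg) (simp del: sum_of_bool_mult_eq)
  have "cyclic_conv n (\<lambda>i. of_bool (i \<in> X)) (\<lambda>i. of_bool (i \<in> Y)) i \<le> (\<Sum>j<n. \<Sum>k<n. 1 :: int)"
    unfolding cyclic_conv_def by (intro sum_mono) (simp del: sum_of_bool_mult_eq)
  then show "cyclic_conv n (\<lambda>i. of_bool (i \<in> X)) (\<lambda>i. of_bool (i \<in> Y)) i \<le> (int n)\<^sup>2"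
    by (simp add: power2_eq_square)
qed

text \<open>No wrap-around occurs when the sumset fits into the cycle.\<close>
lemma cyclic_conv_indicator_eq_0_iff:
  assumes X_subset: "X \<subseteq> {..<n}" and Y_subset: "Y \<subseteq> {..<n}" and sumset: "X + Y \<subseteq> {..<n}"
  shows "cyclic_conv n (\<lambda>i. of_bool (i \<in> X)) (\<lambda>i. of_bool (i \<in> Y)) i = (0::int) \<longleftrightarrow> i \<notin> X + Y"
proof -
  let ?term = "\<lambda>j k. of_bool ((j + k) mod n = i) * (of_bool (j \<in> X) * of_bool (k \<in> Y)) :: int"
  have "cyclic_conv n (\<lambda>i. of_bool (i \<in> X)) (\<lambda>i. of_bool (i \<in> Y)) i = (0::int) \<longleftrightarrow>
    (\<forall>j<n. \<forall>k<n. ?term j k = 0)"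
    unfolding cyclic_conv_def by (subst sum_nonneg_eq_0_iff; (simp add: sum_nonneg)?) (auto simp: sum_nonneg_eq_0_iff)
  also have "\<dots> \<longleftrightarrow> (\<forall>j\<in>X. \<forall>k\<in>Y. (j + k) mod n \<noteq> i)" using X_subset Y_subset by auto
  also have "\<dots> \<longleftrightarrow> i \<notin> X + Y"
  proof -
    have "(j + k) mod n = j + k" if "j \<in> X" "k \<in> Y" for j k
      using sumset set_plus_intro[OF that] by (intro mod_less) auto
    then show ?thesis by (auto simp: set_plus_def)
  qed
  finally show ?thesis .
qed

section \<open>Fixed-point arithmetic\<close>

subsection \<open>Complex multiplication\<close>

definition fp_value :: "nat \<Rightarrow> int \<times> int \<Rightarrow> complex" where
  "fp_value S z = Complex (real_of_int (fst z) / S) (real_of_int (snd z) / S)"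

definition fp_mult :: "nat \<Rightarrow> int \<times> int \<Rightarrow> int \<times> int \<Rightarrow> int \<times> int" where
  "fp_mult S z w = ((fst z * fst w - snd z * snd w) div int S, (fst z * snd w + snd z * fst w) div int S)"

definition fp_cnj :: "int \<times> int \<Rightarrow> int \<times> int" where
  "fp_cnj z = (fst z, - snd z)"

lemma fp_value_add: "fp_value S (z + w) = fp_value S z + fp_value S w"
  and fp_value_diff: "fp_value S (z - w) = fp_value S z - fp_value S w"
  and fp_value_cnj: "fp_value S (fp_cnj z) = cnj (fp_value S z)"
  by (simp_all add: fp_value_def fp_cnj_def complex_eq_iff add_divide_distrib diff_divide_distrib)

lemma div_error:
  fixes x :: int and S :: nat
  assumes "0 < S"
  shows "\<bar>real_of_int (x div int S) / S - real_of_int x / (real S * real S)\<bar> \<le> 1 / S"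
proof -
  have "real_of_int (x div int S) = of_int \<lfloor>real_of_int x / real S\<rfloor>"
    using floor_divide_of_int_eq[of x "int S", where ?'a = real] by simp
  then have "\<bar>real_of_int (x div int S) - real_of_int x / S\<bar> \<le> 1" by linarith
  then have "\<bar>(real_of_int (x div int S) - real_of_int x / S) / S\<bar> \<le> 1 / S"
    by (simp add: abs_divide divide_right_mono)
  then show ?thesis by (simp add: diff_divide_distrib)
qed

lemma fp_value_mult_error:
  assumes "0 < S"
  shows "cmod (fp_value S (fp_mult S z w) - fp_value S z * fp_value S w) \<le> 2 / S"
proof -
  let ?d = "fp_value S (fp_mult S z w) - fp_value S z * fp_value S w"
  have "Re ?d = real_of_int ((fst z * fst w - snd z * snd w) div int S) / S -
      real_of_int (fst z * fst w - snd z * snd w) / (real S * real S)"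
    "Im ?d = real_of_int ((fst z * snd w + snd z * fst w) div int S) / S -
      real_of_int (fst z * snd w + snd z * fst w) / (real S * real S)"
    by (simp_all add: fp_value_def fp_mult_def add_divide_distrib diff_divide_distrib)
  then have "\<bar>Re ?d\<bar> \<le> 1 / S" "\<bar>Im ?d\<bar> \<le> 1 / S" by (simp_all only: div_error[OF assms])
  then show ?thesis using cmod_le[of ?d] by linarith
qed

lemma norm_mult_diff_le:
  fixes z z' w w' :: complex
  assumes "cmod (z' - z) \<le> d" "cmod (w' - w) \<le> e" "cmod z \<le> M" "cmod w \<le> N"
  shows "cmod (z' * w' - z * w) \<le> d * (N + e) + e * M"
proof -
  have "z' * w' - z * w = (z' - z) * w' + (w' - w) * z" by (simp add: algebra_simps)
  then have "cmod (z' * w' - z * w) \<le> cmod (z' - z) * cmod w' + cmod (w' - w) * cmod z"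
    using norm_triangle_ineq[of "(z' - z) * w'" "(w' - w) * z"] by (simp add: norm_mult)
  moreover have "cmod w' \<le> N + e" using assms(2,4) norm_triangle_sub[of w' w] by linarith
  then have "cmod (z' - z) * cmod w' \<le> d * (N + e)"
    using assms(1) by (intro mult_mono) (auto intro: order_trans[OF norm_ge_zero])
  moreover have "cmod (w' - w) * cmod z \<le> e * M"
    using assms(2,3) by (intro mult_mono) (auto intro: order_trans[OF norm_ge_zero])
  ultimately show ?thesis by linarith
qed

lemma fp_mult_error:
  assumes "0 < S" "cmod (fp_value S z' - z) \<le> d" "cmod (fp_value S w' - w) \<le> e" "cmod z \<le> M" "cmod w \<le> N"
  shows "cmod (fp_value S (fp_mult S z' w') - z * w) \<le> d * (N + e) + e * M + 2 / S"
proof -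
  have "fp_value S (fp_mult S z' w') - z * w =
    (fp_value S (fp_mult S z' w') - fp_value S z' * fp_value S w') + (fp_value S z' * fp_value S w' - z * w)" by simp
  then have "cmod (fp_value S (fp_mult S z' w') - z * w) \<le>
    cmod (fp_value S (fp_mult S z' w') - fp_value S z' * fp_value S w') + cmod (fp_value S z' * fp_value S w' - z * w)"
    by (simp only: norm_triangle_ineq)
  then show ?thesis using fp_value_mult_error[OF assms(1), of z' w'] norm_mult_diff_le[OF assms(2-5)] by linarith
qed

lemma fp_component_bounds:
  assumes "0 < S" "cmod (fp_value S z - w) \<le> d" "cmod w \<le> M"
  shows "\<bar>real_of_int (fst z)\<bar> \<le> S * (M + d)" "\<bar>real_of_int (snd z)\<bar> \<le> S * (M + d)"
proof -
  have "cmod (fp_value S z) \<le> M + d" using assms(2,3) norm_triangle_sub[of "fp_value S z" w] by linarith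
  then have "\<bar>real_of_int (fst z) / S\<bar> \<le> M + d" "\<bar>real_of_int (snd z) / S\<bar> \<le> M + d"
    using abs_Re_le_cmod[of "fp_value S z"] abs_Im_le_cmod[of "fp_value S z"] by (auto simp: fp_value_def)
  then show "\<bar>real_of_int (fst z)\<bar> \<le> S * (M + d)" "\<bar>real_of_int (snd z)\<bar> \<le> S * (M + d)"
    using assms(1) by (simp_all add: abs_divide field_simps)
qed

definition approximates :: "nat \<Rightarrow> real \<Rightarrow> nat \<Rightarrow> (nat \<Rightarrow> int \<times> int) \<Rightarrow> (nat \<Rightarrow> complex) \<Rightarrow> bool" where
  "approximates S d n z e \<longleftrightarrow> (\<forall>i<n. cmod (fp_value S (z i) - e i) \<le> d)"

lemma approximatesD: "approximates S d n z e \<Longrightarrow> i < n \<Longrightarrow> cmod (fp_value S (z i) - e i) \<le> d"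
  by (simp add: approximates_def)

lemma approximates_mono: "approximates S d n z e \<Longrightarrow> d \<le> d' \<Longrightarrow> approximates S d' n z e"
  unfolding approximates_def by (meson order_trans)

lemma approximates_cong: "approximates S d n z e \<Longrightarrow> (\<And>i. i < n \<Longrightarrow> z' i = z i) \<Longrightarrow> approximates S d n z' e"
  by (simp add: approximates_def)

subsection \<open>Butterflies\<close>

definition butterfly_low :: "nat \<Rightarrow> nat \<Rightarrow> nat" where
  "butterfly_low m i = i div (2 * m) * (2 * m) + i mod m"

lemma butterfly_low_bounds:
  assumes "i < 2 * m * q"
  shows "butterfly_low m i + m < 2 * m * q" "i div (2 * m) < q"
proof -
  have "0 < m" using assms by (cases m) auto
  show block: "i div (2 * m) < q" using assms by (simp add: less_mult_imp_div_less mult.commute)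
  have "butterfly_low m i + m < (i div (2 * m) + 1) * (2 * m)" using \<open>0 < m\<close> by (simp add: butterfly_low_def)
  also have "\<dots> \<le> q * (2 * m)" using block by (intro mult_le_mono) auto
  finally show "butterfly_low m i + m < 2 * m * q" by (simp add: mult.commute)
qed

lemma butterfly_low_div_mod:
  assumes "0 < m"
  shows "butterfly_low m i div (2 * m) = i div (2 * m)" "butterfly_low m i mod (2 * m) = i mod m"
    "(butterfly_low m i + m) div (2 * m) = i div (2 * m)" "(butterfly_low m i + m) mod (2 * m) = i mod m + m"
    "butterfly_low m i div m = 2 * (i div (2 * m))" "butterfly_low m i mod m = i mod m"
proof -
  have "i mod m < 2 * m" "i mod m + m < 2 * m" using mod_less_divisor[OF assms, of i] by linarith+
  then have "i mod m div (2 * m) = 0" "i mod m mod (2 * m) = i mod m"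
    "(i mod m + m) div (2 * m) = 0" "(i mod m + m) mod (2 * m) = i mod m + m" by (simp_all only: div_less mod_less)
  then show "butterfly_low m i div (2 * m) = i div (2 * m)" "butterfly_low m i mod (2 * m) = i mod m"
    "(butterfly_low m i + m) div (2 * m) = i div (2 * m)" "(butterfly_low m i + m) mod (2 * m) = i mod m + m"
    unfolding butterfly_low_def add.assoc using assms by simp_all
  have "butterfly_low m i = i mod m + 2 * (i div (2 * m)) * m" by (simp add: butterfly_low_def)
  then show "butterfly_low m i div m = 2 * (i div (2 * m))" "butterfly_low m i mod m = i mod m"
    using assms by simp_all
qed

lemma butterfly_low_eq: "i = butterfly_low m i + of_bool (odd (i div m)) * m"
proof -
  have "i = i div m * m + i mod m" by simp
  also have "i div m = 2 * (i div (2 * m)) + of_bool (odd (i div m))"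
    by (simp add: mult.commute[of 2 m] div_mult2_eq flip: mod_2_eq_odd)
  finally show ?thesis by (simp add: butterfly_low_def algebra_simps)
qed

lemma transform_butterfly:
  assumes "0 < m"
  shows "transform a m (2 * q) i = transform a (2 * m) q (butterfly_low m i) +
    (- 1) ^ (i div m) * (twiddle (i div (2 * m)) * transform a (2 * m) q (butterfly_low m i + m))"
  unfolding transform_def butterfly_low_div_mod[OF assms] block_coeff_split[of a m q]
  by (simp add: mult.commute[of 2 m] div_mult2_eq)

lemma transform_butterfly_sum:
  assumes "0 < m"
  shows "transform a m (2 * q) (butterfly_low m i) + transform a m (2 * q) (butterfly_low m i + m) =
    2 * transform a (2 * m) q (butterfly_low m i)"
  unfolding transform_def block_coeff_split[of a m q] using assms by (simp add: butterfly_low_div_mod)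

lemma transform_butterfly_diff:
  assumes "0 < m"
  shows "(transform a m (2 * q) (butterfly_low m i) - transform a m (2 * q) (butterfly_low m i + m)) *
    cnj (twiddle (i div (2 * m))) = 2 * transform a (2 * m) q (butterfly_low m i + m)"
proof -
  let ?w = "twiddle (i div (2 * m))"
  have "transform a m (2 * q) (butterfly_low m i) - transform a m (2 * q) (butterfly_low m i + m) =
    2 * (?w * transform a (2 * m) q (butterfly_low m i + m))"
    unfolding transform_def block_coeff_split[of a m q] using assms by (simp add: butterfly_low_div_mod)
  moreover have "?w * cnj ?w = 1" by (simp add: complex_norm_square[symmetric])
  ultimately show ?thesis by (simp add: ac_simps)
qed

definition forward_butterfly ::
  "nat \<Rightarrow> nat \<Rightarrow> (nat \<Rightarrow> int \<times> int) \<Rightarrow> (nat \<Rightarrow> int \<times> int) \<Rightarrow> nat \<Rightarrow> int \<times> int" where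
  "forward_butterfly S m w z i =
    (let low = z (butterfly_low m i); high = fp_mult S (w (i div (2 * m))) (z (butterfly_low m i + m))
     in if even (i div m) then low + high else low - high)"

definition inverse_butterfly ::
  "nat \<Rightarrow> nat \<Rightarrow> (nat \<Rightarrow> int \<times> int) \<Rightarrow> (nat \<Rightarrow> int \<times> int) \<Rightarrow> nat \<Rightarrow> int \<times> int" where
  "inverse_butterfly S m w z i =
    (let low = z (butterfly_low m i); high = z (butterfly_low m i + m)
     in if even (i div m) then low + high else fp_mult S (low - high) (fp_cnj (w (i div (2 * m)))))"

lemma forward_butterfly_error:
  assumes S_pos: "0 < S" and m_pos: "0 < m" and z_approx: "approximates S d (2 * m * q) z (transform a (2 * m) q)"
    and w_approx: "approximates S e T w twiddle" and "q \<le> T" and e_bounds: "0 \<le> e" "e \<le> 1" and "0 \<le> d"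
    and norm_bound: "\<And>i. cmod (transform a (2 * m) q i) \<le> M" and rounding: "e * M + 2 / S \<le> \<eta>"
  shows "approximates S (3 * d + \<eta>) (2 * m * q) (forward_butterfly S m w z) (transform a m (2 * q))"
  unfolding approximates_def
proof (intro allI impI)
  fix i assume i_less: "i < 2 * m * q"
  note bounds = butterfly_low_bounds[OF i_less]
  let ?l = "butterfly_low m i" and ?t = "i div (2 * m)" and ?E = "transform a (2 * m) q"
  let ?p = "fp_mult S (w ?t) (z (?l + m))" and ?s = "(- 1) ^ (i div m) :: complex"
  have low: "cmod (fp_value S (z ?l) - ?E ?l) \<le> d"
    and high: "cmod (fp_value S (z (?l + m)) - ?E (?l + m)) \<le> d"
    using z_approx bounds(1) by (auto simp: approximates_def)
  have root: "cmod (fp_value S (w ?t) - twiddle ?t) \<le> e" using w_approx bounds(2) \<open>q \<le> T\<close>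
    by (auto simp: approximates_def)
  have prod: "cmod (fp_value S ?p - twiddle ?t * ?E (?l + m)) \<le> e * (M + d) + d * 1 + 2 / S"
    by (rule fp_mult_error[OF S_pos root high _ norm_bound]) simp
  have "fp_value S (forward_butterfly S m w z i) - transform a m (2 * q) i =
     (fp_value S (z ?l) - ?E ?l) + ?s * (fp_value S ?p - twiddle ?t * ?E (?l + m))"
    unfolding forward_butterfly_def Let_def transform_butterfly[OF m_pos]
    by (cases "even (i div m)") (simp_all add: fp_value_add fp_value_diff)
  then have "cmod (fp_value S (forward_butterfly S m w z i) - transform a m (2 * q) i) \<le>
     cmod (fp_value S (z ?l) - ?E ?l) + cmod (?s * (fp_value S ?p - twiddle ?t * ?E (?l + m)))"
    by (simp only: norm_triangle_ineq)
  also have "\<dots> \<le> d + (e * (M + d) + d * 1 + 2 / S)" using low prod by (simp add: norm_mult norm_power)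
  also have "e * d \<le> 1 * d" using e_bounds \<open>0 \<le> d\<close> by (intro mult_right_mono) auto
  then have "d + (e * (M + d) + d * 1 + 2 / S) \<le> 3 * d + \<eta>" using rounding by (simp add: algebra_simps)
  finally show "cmod (fp_value S (forward_butterfly S m w z i) - transform a m (2 * q) i) \<le> 3 * d + \<eta>" .
qed

lemma inverse_butterfly_error:
  assumes S_pos: "0 < S" and m_pos: "0 < m"
    and z_approx: "approximates S d (2 * m * q) z (\<lambda>i. s * transform a m (2 * q) i)"
    and w_approx: "approximates S e T w twiddle" and "q \<le> T" and e_bounds: "0 \<le> e" "e \<le> 1 / 2" and "0 \<le> d"
    and norm_bound: "\<And>i. cmod (s * transform a m (2 * q) i) \<le> M" and rounding: "2 * e * M + 2 / S \<le> \<eta>"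
  shows "approximates S (3 * d + \<eta>) (2 * m * q) (inverse_butterfly S m w z) (\<lambda>i. 2 * s * transform a (2 * m) q i)"
  unfolding approximates_def
proof (intro allI impI)
  fix i assume i_less: "i < 2 * m * q"
  note bounds = butterfly_low_bounds[OF i_less]
  let ?l = "butterfly_low m i" and ?t = "i div (2 * m)" and ?E = "\<lambda>i. s * transform a m (2 * q) i"
  let ?result = "fp_value S (inverse_butterfly S m w z i) - 2 * s * transform a (2 * m) q i"
  have low: "cmod (fp_value S (z ?l) - ?E ?l) \<le> d"
    and high: "cmod (fp_value S (z (?l + m)) - ?E (?l + m)) \<le> d"
    using z_approx bounds(1) by (auto simp: approximates_def)
  show "cmod ?result \<le> 3 * d + \<eta>"
  proof (cases "even (i div m)")
    case True
    then have "i = ?l" using butterfly_low_eq[of i m] by simp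
    then have "2 * s * transform a (2 * m) q i = ?E ?l + ?E (?l + m)"
      using transform_butterfly_sum[OF m_pos, of a q i] by (simp add: distrib_left[symmetric])
    then have "?result = (fp_value S (z ?l) - ?E ?l) + (fp_value S (z (?l + m)) - ?E (?l + m))"
      unfolding inverse_butterfly_def Let_def using True by (simp add: fp_value_add)
    then have "cmod ?result \<le> d + d" using norm_triangle_mono[OF low high] by simp
    moreover have "0 \<le> 2 * e * M + 2 / S" using e_bounds(1) order_trans[OF norm_ge_zero norm_bound] by simp
    ultimately show ?thesis using \<open>0 \<le> d\<close> rounding by linarith
  next
    case False
    then have "i = ?l + m" using butterfly_low_eq[of i m] by simp
    then have exact: "2 * s * transform a (2 * m) q i = (?E ?l - ?E (?l + m)) * cnj (twiddle ?t)"
      using transform_butterfly_diff[OF m_pos, of a q i] by (simp add: right_diff_distrib[symmetric])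
    have "fp_value S (z ?l - z (?l + m)) - (?E ?l - ?E (?l + m)) =
      (fp_value S (z ?l) - ?E ?l) - (fp_value S (z (?l + m)) - ?E (?l + m))" by (simp add: fp_value_diff)
    then have diff: "cmod (fp_value S (z ?l - z (?l + m)) - (?E ?l - ?E (?l + m))) \<le> d + d"
      using norm_triangle_le_diff[OF add_mono[OF low high]] by (simp only:)
    have diff_bound: "cmod (?E ?l - ?E (?l + m)) \<le> M + M"
      by (rule norm_triangle_le_diff[OF add_mono[OF norm_bound norm_bound]])
    have "fp_value S (fp_cnj (w ?t)) - cnj (twiddle ?t) = cnj (fp_value S (w ?t) - twiddle ?t)"
      by (simp add: fp_value_cnj)
    then have root: "cmod (fp_value S (fp_cnj (w ?t)) - cnj (twiddle ?t)) \<le> e"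
      using w_approx bounds(2) \<open>q \<le> T\<close> by (auto simp: approximates_def simp del: complex_cnj_diff)
    have "cmod ?result \<le> (d + d) * (1 + e) + e * (M + M) + 2 / S"
      unfolding inverse_butterfly_def Let_def exact using False
      by (simp only: if_False) (rule fp_mult_error[OF S_pos diff root diff_bound], simp)
    moreover have "d * e \<le> d * (1 / 2)" using e_bounds \<open>0 \<le> d\<close> by (intro mult_left_mono) auto
    ultimately show ?thesis using rounding by (simp add: algebra_simps)
  qed
qed

subsection \<open>The table of twiddle factors\<close>

lemma cos_half_angle: "\<lbrakk>0 \<le> x; x \<le> pi\<rbrakk> \<Longrightarrow> cos (x / 2) = sqrt ((1 + cos x) / 2)"
  using cos_double_cos[of "x / 2"] by (intro real_sqrt_unique[symmetric] cos_ge_zero) auto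

lemma sin_half_angle: "\<lbrakk>0 \<le> x; x \<le> pi\<rbrakk> \<Longrightarrow> sin (x / 2) = sqrt ((1 - cos x) / 2)"
  using cos_double_sin[of "x / 2"] by (intro real_sqrt_unique[symmetric] sin_ge_zero) auto

lemma floor_sqrt_error: "\<bar>real (floor_sqrt (y div 2)) - sqrt (real y / 2)\<bar> \<le> 2"
proof -
  define r where "r = floor_sqrt (y div 2)"
  have "r\<^sup>2 \<le> y div 2" "y div 2 < (Suc r)\<^sup>2" unfolding r_def using Suc_floor_sqrt_power2_gt by auto
  then have "2 * r\<^sup>2 \<le> y" "y \<le> 2 * (Suc r)\<^sup>2" by linarith+
  then have "real (2 * r\<^sup>2) \<le> real y" "real y \<le> real (2 * (Suc r)\<^sup>2)" by (simp_all only: of_nat_le_iff)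
  then have "(real r)\<^sup>2 \<le> real y / 2" "real y / 2 \<le> (real r + 1)\<^sup>2" by (simp_all add: add.commute)
  then have "real r \<le> sqrt (real y / 2)" "sqrt (real y / 2) \<le> real r + 1"
    by (auto intro: real_le_rsqrt real_le_lsqrt)
  then show ?thesis unfolding r_def by linarith
qed

lemma scaled_floor_sqrt_error:
  assumes "0 < S" "real y = real S * real S * x"
  shows "\<bar>real (floor_sqrt (y div 2)) / S - sqrt (x / 2)\<bar> \<le> 2 / S"
proof -
  have "sqrt (real y / 2) = sqrt ((real S)\<^sup>2 * (x / 2))" by (simp add: assms(2) power2_eq_square)
  also have "\<dots> = S * sqrt (x / 2)" by (simp only: real_sqrt_mult real_sqrt_abs abs_of_nat)
  finally have "real (floor_sqrt (y div 2)) / S - sqrt (x / 2) =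
    (real (floor_sqrt (y div 2)) - sqrt (real y / 2)) / S" using assms(1) by (simp add: field_simps)
  then show ?thesis using floor_sqrt_error[of y] by (simp add: abs_divide divide_right_mono)
qed

lemma abs_sqrt_diff_le_abs_diff:
  assumes "1 / 2 \<le> a" "1 / 2 \<le> b"
  shows "\<bar>sqrt a - sqrt b\<bar> \<le> \<bar>a - b\<bar>"
proof -
  have half: "1 / 2 \<le> sqrt x" if "1 / 2 \<le> x" for x :: real
    using that by (intro real_le_rsqrt) (simp add: power2_eq_square)
  have "a - b = (sqrt a - sqrt b) * (sqrt a + sqrt b)" using assms by (simp add: algebra_simps)
  then have "\<bar>a - b\<bar> = \<bar>sqrt a - sqrt b\<bar> * (sqrt a + sqrt b)" using assms by (simp add: abs_mult)
  moreover have "\<bar>sqrt a - sqrt b\<bar> * 1 \<le> \<bar>sqrt a - sqrt b\<bar> * (sqrt a + sqrt b)"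
    using half[OF assms(1)] half[OF assms(2)] by (intro mult_left_mono) auto
  ultimately show ?thesis by simp
qed

lemma abs_sqrt_diff_le_sqrt_abs_diff:
  assumes "0 \<le> a" "0 \<le> b"
  shows "\<bar>sqrt a - sqrt b\<bar> \<le> sqrt \<bar>a - b\<bar>"
proof -
  have one_sided: "sqrt x \<le> sqrt y + sqrt \<bar>x - y\<bar>" if "0 \<le> y" for x y
    using real_sqrt_le_mono[of x "y + \<bar>x - y\<bar>"] sqrt_add_le_add_sqrt[OF that abs_ge_zero, of "x - y"] by linarith
  show ?thesis using one_sided[OF assms(1), of b] one_sided[OF assms(2), of a]
    by (simp add: abs_le_iff abs_minus_commute)
qed

text \<open>The angles are halved from \<open>pi / 2\<close> on. Taking the square root of the small number \<open>1 - cos \<phi>\<close> halves the number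
  of correct digits, so the sine is only accurate to \<open>1 / w\<close> for the scale \<open>w * w\<close>; the sine is not iterated.\<close>
definition approximates_angle :: "nat \<Rightarrow> real \<Rightarrow> nat \<Rightarrow> nat \<Rightarrow> bool" where
  "approximates_angle w \<phi> c s \<longleftrightarrow> c \<le> w * w \<and> s \<le> w * w \<and>
     \<bar>real c / (w * w) - cos \<phi>\<bar> \<le> 4 / (w * w) \<and> \<bar>real s / (w * w) - sin \<phi>\<bar> \<le> 4 / w"

lemma approximates_angle_pi_half: "0 < w \<Longrightarrow> approximates_angle w (pi / 2) 0 (w * w)"
  by (simp add: approximates_angle_def)

lemma floor_sqrt_half_le: "y \<le> S * (2 * S) \<Longrightarrow> floor_sqrt (y div 2) \<le> S"
proof -
  assume "y \<le> S * (2 * S)"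
  then have "floor_sqrt (y div 2) \<le> floor_sqrt (S\<^sup>2)" by (intro mono_floor_sqrt') (simp add: power2_eq_square)
  then show ?thesis by simp
qed

lemma half_angle_cos_error:
  assumes "0 < w" "c \<le> w * w" "\<bar>real c / (w * w) - cos \<phi>\<bar> \<le> 4 / (w * w)" "0 \<le> \<phi>" "\<phi> \<le> pi / 2"
  shows "\<bar>real (floor_sqrt (w * w * (w * w + c) div 2)) / (w * w) - cos (\<phi> / 2)\<bar> \<le> 4 / (w * w)"
proof -
  let ?z = "real c / (w * w)"
  have "real (w * w * (w * w + c)) = real (w * w) * real (w * w) * (1 + ?z)"
    using assms(1) by (simp add: field_simps)
  then have "\<bar>real (floor_sqrt (w * w * (w * w + c) div 2)) / (w * w) - sqrt ((1 + ?z) / 2)\<bar> \<le> 2 / (w * w)"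
    using assms(1) by (intro scaled_floor_sqrt_error) auto
  moreover have "\<bar>sqrt ((1 + ?z) / 2) - sqrt ((1 + cos \<phi>) / 2)\<bar> \<le> 2 / (w * w)"
  proof -
    have "\<bar>sqrt ((1 + ?z) / 2) - sqrt ((1 + cos \<phi>) / 2)\<bar> \<le> \<bar>(1 + ?z) / 2 - (1 + cos \<phi>) / 2\<bar>"
      using assms(4,5) cos_ge_zero[of \<phi>] by (intro abs_sqrt_diff_le_abs_diff) auto
    also have "\<dots> = \<bar>?z - cos \<phi>\<bar> / 2" by (simp add: diff_divide_distrib[symmetric])
    finally show ?thesis using assms(3) by simp
  qed
  ultimately show ?thesis using assms(4,5) by (simp add: cos_half_angle)
qed

lemma half_angle_sin_error:
  assumes "0 < w" "c \<le> w * w" "\<bar>real c / (w * w) - cos \<phi>\<bar> \<le> 4 / (w * w)" "0 \<le> \<phi>" "\<phi> \<le> pi / 2"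
  shows "\<bar>real (floor_sqrt (w * w * (w * w - c) div 2)) / (w * w) - sin (\<phi> / 2)\<bar> \<le> 4 / w"
proof -
  let ?z = "real c / (w * w)"
  have le_1: "?z \<le> 1" using assms(1,2) by (simp flip: of_nat_mult)
  have "real (w * w * (w * w - c)) = real (w * w) * real (w * w) * (1 - ?z)"
    using assms(1,2) by (simp add: of_nat_diff field_simps)
  then have "\<bar>real (floor_sqrt (w * w * (w * w - c) div 2)) / (w * w) - sqrt ((1 - ?z) / 2)\<bar> \<le> 2 / (w * w)"
    using assms(1) by (intro scaled_floor_sqrt_error) auto
  moreover have "\<bar>sqrt ((1 - ?z) / 2) - sqrt ((1 - cos \<phi>) / 2)\<bar> \<le> 2 / w"
  proof -
    have "\<bar>sqrt ((1 - ?z) / 2) - sqrt ((1 - cos \<phi>) / 2)\<bar> \<le> sqrt \<bar>(1 - ?z) / 2 - (1 - cos \<phi>) / 2\<bar>"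
      using le_1 by (intro abs_sqrt_diff_le_sqrt_abs_diff) auto
    also have "\<bar>(1 - ?z) / 2 - (1 - cos \<phi>) / 2\<bar> = \<bar>?z - cos \<phi>\<bar> / 2"
      by (simp add: diff_divide_distrib[symmetric] abs_minus_commute)
    also have "\<dots> \<le> (2 / w)\<^sup>2" using assms(3) by (simp add: power2_eq_square)
    then have "sqrt (\<bar>?z - cos \<phi>\<bar> / 2) \<le> sqrt ((2 / w)\<^sup>2)" by (rule real_sqrt_le_mono)
    finally show ?thesis by simp
  qed
  moreover have "2 / real (w * w) \<le> 2 / w" using assms(1) by (simp add: field_simps)
  ultimately show ?thesis using assms(4,5) by (simp add: sin_half_angle)
qed

lemma approximates_angle_halve:
  assumes "0 < w" "approximates_angle w \<phi> c s" "0 \<le> \<phi>" "\<phi> \<le> pi / 2"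
  shows "approximates_angle w (\<phi> / 2) (floor_sqrt (w * w * (w * w + c) div 2)) (floor_sqrt (w * w * (w * w - c) div 2))"
  using half_angle_cos_error half_angle_sin_error assms unfolding approximates_angle_def
  by (auto intro!: floor_sqrt_half_le mult_le_mono)

lemma fp_value_angle_error:
  assumes "approximates_angle w \<phi> c s" "0 < w"
  shows "cmod (fp_value (w * w) (int c, int s) - cis \<phi>) \<le> 8 / w"
proof -
  have "cmod (fp_value (w * w) (int c, int s) - cis \<phi>) \<le> \<bar>real c / (w * w) - cos \<phi>\<bar> + \<bar>real s / (w * w) - sin \<phi>\<bar>"
    using cmod_le[of "fp_value (w * w) (int c, int s) - cis \<phi>"] by (simp add: fp_value_def)
  also have "\<dots> \<le> 4 / (w * w) + 4 / w" using assms(1) by (intro add_mono) (auto simp: approximates_angle_def)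
  also have "4 / real (w * w) \<le> 4 / w" using assms(2) by (simp add: field_simps)
  finally show ?thesis by simp
qed

lemma twiddle_table_double:
  assumes "0 < w" and angle: "approximates_angle w (pi / 2 ^ Suc k) c s"
    and W_approx: "approximates (w * w) (24 * real k / w) (2 ^ k) W twiddle" and "24 * k \<le> w"
    and lower: "\<And>i. i < 2 ^ k \<Longrightarrow> W' i = W i"
    and upper: "\<And>i. i < 2 ^ k \<Longrightarrow> W' (2 ^ k + i) = fp_mult (w * w) (int c, int s) (W i)"
  shows "approximates (w * w) (24 * real (Suc k) / w) (2 ^ Suc k) W' twiddle"
  unfolding approximates_def
proof (intro allI impI)
  fix i :: nat assume i_less: "i < 2 ^ Suc k"
  let ?E = "24 * real k / w"
  have "0 < real w" using \<open>0 < w\<close> by simp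
  have error_sum: "?E + 24 / w = 24 * real (Suc k) / w" by (simp add: add_divide_distrib[symmetric])
  show "cmod (fp_value (w * w) (W' i) - twiddle i) \<le> 24 * real (Suc k) / w"
  proof (cases "i < 2 ^ k")
    case True
    then have "cmod (fp_value (w * w) (W' i) - twiddle i) \<le> ?E" using approximatesD[OF W_approx] lower by simp
    then show ?thesis unfolding error_sum[symmetric] by (rule order_trans) simp
  next
    case False
    then obtain r where offset: "i = 2 ^ k + r" "r < 2 ^ k" using i_less
      by (metis add_diff_inverse_nat add_less_cancel_left mult_2 power_Suc)
    have "cmod (fp_value (w * w) (W' i) - twiddle i) \<le> 8 / w * (1 + ?E) + ?E * 1 + 2 / real (w * w)"
      unfolding offset(1) upper[OF offset(2)] twiddle_high_bit[OF offset(2)]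
      by (rule fp_mult_error[OF _ fp_value_angle_error[OF angle \<open>0 < w\<close>] approximatesD[OF W_approx offset(2)]])
        (use \<open>0 < w\<close> in auto)
    moreover have "?E \<le> 1" using \<open>24 * k \<le> w\<close> \<open>0 < real w\<close> by (simp add: field_simps)
    then have "8 / w * (1 + ?E) \<le> 8 / w * 2" by (intro mult_left_mono) auto
    moreover have "2 / real (w * w) \<le> 2 / w" using \<open>0 < w\<close> by (simp add: field_simps)
    moreover have "8 / w * 2 + 2 / w \<le> 24 / real w" using \<open>0 < real w\<close> by (simp add: field_simps)
    ultimately show ?thesis using error_sum by linarith
  qed
qed

subsection \<open>Error budget of a convolution\<close>

text \<open>The solution of \<open>e (Suc l) = 3 * e l + \<eta>\<close> with \<open>e 0 = d\<close>.\<close>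
definition accumulated_error :: "real \<Rightarrow> real \<Rightarrow> nat \<Rightarrow> real" where
  "accumulated_error d \<eta> l = 3 ^ l * (d + \<eta> / 2) - \<eta> / 2"

lemma accumulated_error_0 [simp]: "accumulated_error d \<eta> 0 = d"
  and accumulated_error_Suc: "accumulated_error d \<eta> (Suc l) = 3 * accumulated_error d \<eta> l + \<eta>"
  by (simp_all add: accumulated_error_def algebra_simps)

lemma accumulated_error_nonneg: "\<lbrakk>0 \<le> d; 0 \<le> \<eta>\<rbrakk> \<Longrightarrow> 0 \<le> accumulated_error d \<eta> l"
  by (induction l) (simp_all add: accumulated_error_Suc)

lemma accumulated_error_le:
  assumes "0 \<le> d" "0 \<le> \<eta>" "2 ^ l \<le> (T::nat)"
  shows "accumulated_error d \<eta> l \<le> (real T)\<^sup>2 * (d + \<eta>)"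
proof -
  have "(3::real) ^ l \<le> 4 ^ l" by (intro power_mono) auto
  also have "\<dots> = (real (2 ^ l))\<^sup>2" by (simp add: power_mult[symmetric] mult.commute[of _ 2] power_mult)
  also have "\<dots> \<le> (real T)\<^sup>2" using assms(3) by (intro power_mono) (simp_all only: of_nat_le_iff of_nat_0_le_iff)
  finally have "3 ^ l * (d + \<eta> / 2) \<le> (real T)\<^sup>2 * (d + \<eta>)" using assms by (intro mult_mono) auto
  then show ?thesis using assms by (simp add: accumulated_error_def)
qed

text \<open>\<open>T\<close> is the length of the table of twiddle factors, \<open>\<tau>\<close> its inverse, and \<open>T ^ 32\<close> the fixed-point scale.\<close>
locale transform_precision =
  fixes L :: nat
  assumes three_le_L: "3 \<le> L"
begin

definition T :: nat where "T = 2 ^ L"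

definition \<tau> :: real where "\<tau> = 1 / real T"

definition scale :: nat where "scale = T ^ 32"

lemma eight_le_T: "8 \<le> T"
proof -
  have "(2::nat) ^ 3 \<le> 2 ^ L" using three_le_L by (rule power_increasing) simp
  then show ?thesis by (simp add: T_def)
qed

lemma scale_pos [simp]: "0 < scale"
  using eight_le_T by (simp add: scale_def)

lemma inverse_scale: "1 / real scale = \<tau> ^ 32"
  by (simp add: scale_def \<tau>_def power_one_over)

lemma \<tau>_pos: "0 < \<tau>" and \<tau>_le: "\<tau> \<le> 1 / 8"
  using eight_le_T by (simp_all add: \<tau>_def field_simps)

lemma \<tau>_nonneg [simp]: "0 \<le> \<tau>"
  using \<tau>_pos by simp

lemma T_power_mult_\<tau>_power: "real T ^ a * \<tau> ^ (a + b) = \<tau> ^ b"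
  using eight_le_T by (simp add: \<tau>_def power_add power_one_over)

lemma \<tau>_power_antimono: "a \<le> b \<Longrightarrow> \<tau> ^ b \<le> \<tau> ^ a"
  using \<tau>_pos \<tau>_le by (intro power_decreasing) auto

lemma eight_\<tau>_power_Suc: "8 * \<tau> ^ Suc a \<le> \<tau> ^ a"
  using mult_right_mono[OF \<tau>_le zero_le_power[OF \<tau>_nonneg, of a]] by simp

lemma \<tau>_power_le: "0 < a \<Longrightarrow> \<tau> ^ a \<le> 1 / 8"
  using \<tau>_power_antimono[of 1 a] \<tau>_le by simp

definition twiddle_table :: "(nat \<Rightarrow> int \<times> int) \<Rightarrow> bool" where
  "twiddle_table w \<longleftrightarrow> approximates scale (\<tau> ^ 13) T w twiddle"

definition forward_error :: "nat \<Rightarrow> real" where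
  "forward_error = accumulated_error 0 (\<tau> ^ 11)"

definition inverse_error :: "nat \<Rightarrow> real" where
  "inverse_error = accumulated_error (\<tau> ^ 7) (\<tau> ^ 9)"

lemma forward_error_nonneg: "0 \<le> forward_error l"
  and inverse_error_nonneg: "0 \<le> inverse_error l"
  by (simp_all add: forward_error_def inverse_error_def accumulated_error_nonneg)

lemma forward_error_le:
  assumes "2 ^ l \<le> T"
  shows "forward_error l \<le> \<tau> ^ 9"
proof -
  have "forward_error l \<le> (real T)\<^sup>2 * \<tau> ^ (2 + 9)"
    using accumulated_error_le[OF _ _ assms, of 0 "\<tau> ^ 11"] by (simp add: forward_error_def)
  then show ?thesis by (simp only: T_power_mult_\<tau>_power)
qed

lemma inverse_error_le:
  assumes "2 ^ l \<le> T"
  shows "inverse_error l \<le> 1 / 4"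
proof -
  have "inverse_error l \<le> (real T)\<^sup>2 * (\<tau> ^ 7 + \<tau> ^ 9)"
    unfolding inverse_error_def by (intro accumulated_error_le assms) simp_all
  also have "\<dots> \<le> (real T)\<^sup>2 * (2 * \<tau> ^ (2 + 5))"
    using \<tau>_power_antimono[of 7 9] by (intro mult_left_mono) auto
  also have "\<dots> = 2 * ((real T)\<^sup>2 * \<tau> ^ (2 + 5))" by (simp only: ac_simps)
  also have "\<dots> = 2 * \<tau> ^ 5" by (simp only: T_power_mult_\<tau>_power)
  finally show ?thesis using \<tau>_power_le[of 5] by simp
qed

lemma rounding_budget:
  assumes "Suc a + b = 13" "Suc a \<le> 32"
  shows "2 * \<tau> ^ 13 * real T ^ b + 2 / real scale \<le> \<tau> ^ a"
proof -
  have "2 * \<tau> ^ 13 * real T ^ b = 2 * (real T ^ b * \<tau> ^ (b + Suc a))" using assms(1) by (simp add: add.commute)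
  then have "2 * \<tau> ^ 13 * real T ^ b = 2 * \<tau> ^ Suc a" by (simp only: T_power_mult_\<tau>_power)
  moreover have "2 / real scale = 2 * \<tau> ^ 32" by (simp flip: inverse_scale)
  ultimately show ?thesis
    using \<tau>_power_antimono[OF assms(2)] eight_\<tau>_power_Suc[of a] zero_le_power[OF \<tau>_nonneg, of "Suc a"] by linarith
qed

lemma forward_level:
  assumes table: "twiddle_table w" and n_power: "n = 2 ^ h" "n \<le> T" and q_power: "q = 2 ^ l" "2 * m * q = n"
    and a_bound: "\<And>i. cmod (a i) \<le> 1" and z_approx: "approximates scale (forward_error l) n z (transform a (2 * m) q)"
  shows "approximates scale (forward_error (Suc l)) n (forward_butterfly scale m w z) (transform a m (2 * q))"
proof -
  have "0 < n" using n_power by simp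
  then have m_pos: "0 < m" and "q \<le> n" using q_power(2) by (auto intro: Nat.gr0I)
  have norm_bound: "cmod (transform a (2 * m) q i) \<le> real T" for i
    using norm_transform_le[of a 1 "2 * m" q i] a_bound \<open>q \<le> n\<close> n_power(2) by simp
  have "0 \<le> \<tau> ^ 13 * real T" by simp
  moreover have "2 * \<tau> ^ 13 * real T + 2 / real scale \<le> \<tau> ^ 11" using rounding_budget[of 11 1] by simp
  ultimately have rounding: "\<tau> ^ 13 * real T + 2 / real scale \<le> \<tau> ^ 11" by linarith
  have e_bounds: "0 \<le> \<tau> ^ 13" "\<tau> ^ 13 \<le> 1" using \<tau>_power_le[of 13] by simp_all
  have "approximates scale (3 * forward_error l + \<tau> ^ 11) (2 * m * q) (forward_butterfly scale m w z) (transform a m (2 * q))"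
    by (rule forward_butterfly_error[OF scale_pos m_pos z_approx[folded q_power(2)] table[unfolded twiddle_table_def]
        _ e_bounds
          forward_error_nonneg norm_bound rounding]) (use \<open>q \<le> n\<close> n_power(2) in linarith)
  then show ?thesis by (simp only: q_power(2) forward_error_def accumulated_error_Suc)
qed

lemma norm_inverse_transform_le:
  assumes "2 * m * q = n" "n \<le> T" "\<And>i. cmod (a i) \<le> (real n)\<^sup>2"
  shows "cmod (of_nat m * transform a m (2 * q) i) \<le> real T ^ 3"
proof -
  have "real m * cmod (transform a m (2 * q) i) \<le> real m * (real (2 * q) * (real n)\<^sup>2)"
    by (intro mult_left_mono norm_transform_le assms) auto
  also have "\<dots> = real (2 * m * q) * (real n)\<^sup>2" by simp
  also have "\<dots> = real n ^ 3" by (simp only: assms(1) power2_eq_square power3_eq_cube)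
  also have "\<dots> \<le> real T ^ 3" using assms(2) by (intro power_mono) auto
  finally show ?thesis by (simp add: norm_mult)
qed

lemma inverse_level:
  assumes table: "twiddle_table w" and n_power: "n = 2 ^ h" "n \<le> T" and m_power: "m = 2 ^ l" "2 * m * q = n"
    and a_bound: "\<And>i. cmod (a i) \<le> (real n)\<^sup>2"
    and z_approx: "approximates scale (inverse_error l) n z (\<lambda>i. of_nat m * transform a m (2 * q) i)"
  shows "approximates scale (inverse_error (Suc l)) n (inverse_butterfly scale m w z)
    (\<lambda>i. of_nat (2 * m) * transform a (2 * m) q i)"
proof -
  have "0 < n" using n_power by simp
  then have "0 < m" using m_power(2) by (auto intro: Nat.gr0I)
  then have "q \<le> n" using m_power(2) by auto
  note norm_bound = norm_inverse_transform_le[OF m_power(2) n_power(2) a_bound]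
  have rounding: "2 * \<tau> ^ 13 * real T ^ 3 + 2 / real scale \<le> \<tau> ^ 9" by (rule rounding_budget) simp_all
  have e_bounds: "0 \<le> \<tau> ^ 13" "\<tau> ^ 13 \<le> 1 / 2" using \<tau>_power_le[of 13] by simp_all
  have "approximates scale (3 * inverse_error l + \<tau> ^ 9) (2 * m * q) (inverse_butterfly scale m w z)
    (\<lambda>i. 2 * of_nat m * transform a (2 * m) q i)"
    by (rule inverse_butterfly_error[OF scale_pos \<open>0 < m\<close> z_approx[folded m_power(2)]
        table[unfolded twiddle_table_def] _ e_bounds
          inverse_error_nonneg norm_bound rounding]) (use \<open>q \<le> n\<close> n_power(2) in linarith)
  then show ?thesis by (simp add: m_power(2) inverse_error_def accumulated_error_Suc)
qed

lemma pointwise_product_level: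
  assumes n_power: "n = 2 ^ h" "n \<le> T" and a_bound: "\<And>i. cmod (a i) \<le> 1" and b_bound: "\<And>i. cmod (b i) \<le> 1"
    and z_approx: "approximates scale (forward_error h) n z (transform a 1 n)"
    and z'_approx: "approximates scale (forward_error h) n z' (transform b 1 n)"
  shows "approximates scale (inverse_error 0) n (\<lambda>i. fp_mult scale (z i) (z' i)) (transform (cyclic_conv n a b) 1 n)"
  unfolding approximates_def
proof (intro allI impI)
  fix i assume i_less: "i < n"
  let ?e = "forward_error h" and ?T = "real T"
  have e_bounds: "0 \<le> ?e" "?e \<le> \<tau> ^ 9" using forward_error_nonneg forward_error_le n_power by auto
  have norm_bound: "cmod (transform a 1 n i) \<le> ?T" "cmod (transform b 1 n i) \<le> ?T"
    using norm_transform_le[of a 1 1 n i] norm_transform_le[of b 1 1 n i] a_bound b_bound n_power(2) by auto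
  have error: "cmod (fp_value scale (fp_mult scale (z i) (z' i)) - transform (cyclic_conv n a b) 1 n i) \<le>
      ?e * (?T + ?e) + ?e * ?T + 2 / real scale"
    unfolding transform_cyclic_conv[OF n_power(1) i_less]
    by (rule fp_mult_error[OF scale_pos approximatesD[OF z_approx i_less] approximatesD[OF z'_approx i_less]
        norm_bound])
  have "?e \<le> ?T" using e_bounds(2) \<tau>_power_le[of 9] eight_le_T by linarith
  then have "?e * (?T + ?e) + ?e * ?T \<le> ?e * (3 * ?T)" using mult_left_mono[OF _ e_bounds(1)]
    by (simp add: algebra_simps)
  also have "\<dots> \<le> \<tau> ^ 9 * (3 * ?T)" using e_bounds by (intro mult_right_mono) auto
  also have "\<dots> = 3 * (?T ^ 1 * \<tau> ^ (1 + 8))" by simp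
  also have "\<dots> = 3 * \<tau> ^ 8" by (simp only: T_power_mult_\<tau>_power)
  finally have "?e * (?T + ?e) + ?e * ?T \<le> 3 * \<tau> ^ 8" .
  moreover have "2 / real scale = 2 * \<tau> ^ 32" by (simp flip: inverse_scale)
  moreover have "\<tau> ^ 32 \<le> \<tau> ^ 8" by (rule \<tau>_power_antimono) simp
  moreover have "8 * \<tau> ^ 8 \<le> \<tau> ^ 7" using eight_\<tau>_power_Suc[of 7] by simp
  ultimately show "cmod (fp_value scale (fp_mult scale (z i) (z' i)) - transform (cyclic_conv n a b) 1 n i)
      \<le> inverse_error 0" using error zero_le_power[OF \<tau>_nonneg, of 8] unfolding inverse_error_def accumulated_error_0
        by linarith
qed

lemma approximates_component_bounds:
  assumes "approximates scale d n z e" "\<And>i. cmod (e i) \<le> real T ^ 3" "d \<le> 1" "i < n"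
  shows "\<bar>fst (z i)\<bar> \<le> int T ^ 36" "\<bar>snd (z i)\<bar> \<le> int T ^ 36"
proof -
  have "8 * real T ^ 3 \<le> real T * real T ^ 3" using eight_le_T by (intro mult_right_mono) auto
  moreover have "1 \<le> real T ^ 3" using eight_le_T by simp
  ultimately have "real T ^ 3 + d \<le> real T * real T ^ 3" using assms(3) by linarith
  then have "real scale * (real T ^ 3 + d) \<le> real T ^ 32 * (real T * real T ^ 3)"
    by (simp add: scale_def mult_left_mono)
  also have "\<dots> = real_of_int (int T ^ 36)" by (simp flip: power_Suc power_add)
  finally have bound: "real scale * (real T ^ 3 + d) \<le> real_of_int (int T ^ 36)" .
  have "real_of_int \<bar>fst (z i)\<bar> \<le> real_of_int (int T ^ 36)" "real_of_int \<bar>snd (z i)\<bar> \<le> real_of_int (int T ^ 36)"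
    using fp_component_bounds[OF _ approximatesD[OF assms(1,4)] assms(2)] order_trans[OF _ bound] by auto
  then show "\<bar>fst (z i)\<bar> \<le> int T ^ 36" "\<bar>snd (z i)\<bar> \<le> int T ^ 36" by (simp_all only: of_int_le_iff)
qed

end

lemma round_quotient:
  fixes x S n c :: int
  assumes "0 < S" "0 < n" "\<bar>real_of_int x / real_of_int S - real_of_int (n * c)\<bar> \<le> 1 / 4"
  shows "(2 * x + S * n) div (2 * S * n) = c"
proof -
  define D where "D = x - S * (n * c)"
  have "real_of_int D = real_of_int S * (real_of_int x / real_of_int S - real_of_int (n * c))"
    using assms(1) by (simp add: D_def field_simps)
  then have "\<bar>real_of_int D\<bar> = real_of_int S * \<bar>real_of_int x / real_of_int S - real_of_int (n * c)\<bar>"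
    using assms(1) by (simp add: abs_mult)
  also have "\<dots> \<le> real_of_int S * (1 / 4)" using assms by (intro mult_left_mono) auto
  finally have "real_of_int (4 * \<bar>D\<bar>) \<le> real_of_int S" by simp
  then have "4 * \<bar>D\<bar> \<le> S" by (simp only: of_int_le_iff)
  also have "S \<le> S * n" using assms by simp
  finally have D_bound: "4 * \<bar>D\<bar> \<le> S * n" .
  have "0 < S * n" using assms by simp
  have "2 * x + S * n = c * (2 * (S * n)) + (2 * D + S * n)" by (simp add: D_def algebra_simps)
  also have "\<dots> div (2 * (S * n)) = c + (2 * D + S * n) div (2 * (S * n))"
    using assms by (intro div_mult_self3) simp
  also have "(2 * D + S * n) div (2 * (S * n)) = 0"
    using D_bound \<open>0 < S * n\<close> by (intro div_pos_pos_trivial) linarith+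
  finally show ?thesis by (simp add: mult.assoc)
qed

section \<open>A while language\<close>

subsection \<open>Syntax and semantics\<close>

datatype var = Bound | Count | Idx | Pow_Two | Log | Modulus | Max_Quot | Width | Sum_Len | Tab_Len | Scale
  | Cosine | Sine | Filled | Radicand | Root | Bit | Residue | Class_Size | Leaves | Half | Code_Len | Offset
  | Len | Stride

datatype arr = Saved | IO | Input | Quots | Codes | Acc | XRe | XIm | YRe | YIm | BufRe | BufIm | TabRe | TabIm

datatype bop = Plus | Minus | Times | Quot | Rem

datatype exp = N int | V var | Bop bop exp exp | Get arr exp

text \<open>\<open>While e e' c\<close> repeats \<open>c\<close> as long as \<open>e < e'\<close>.\<close>
datatype com =
    Assign var exp (infix \<open>::=\<close> 62)
  | Put arr exp exp
  | Seq com com (infixr \<open>;;\<close> 60)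
  | While exp exp com

abbreviation plus_exp (infixl \<open>\<oplus>\<close> 65) where "e \<oplus> e' \<equiv> Bop Plus e e'"
abbreviation minus_exp (infixl \<open>\<ominus>\<close> 65) where "e \<ominus> e' \<equiv> Bop Minus e e'"
abbreviation times_exp (infixl \<open>\<otimes>\<close> 70) where "e \<otimes> e' \<equiv> Bop Times e e'"
abbreviation div_exp (infixl \<open>\<oslash>\<close> 70) where "e \<oslash> e' \<equiv> Bop Quot e e'"
abbreviation mod_exp (infixl \<open>\<odot>\<close> 70) where "e \<odot> e' \<equiv> Bop Rem e e'"

type_synonym state = "(var \<Rightarrow> int) \<times> (arr \<Rightarrow> nat \<Rightarrow> int)"

fun bop_value :: "bop \<Rightarrow> int \<Rightarrow> int \<Rightarrow> int" where
  "bop_value Plus x y = x + y"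
| "bop_value Minus x y = x - y"
| "bop_value Times x y = x * y"
| "bop_value Quot x y = x div y"
| "bop_value Rem x y = x mod y"

fun aval :: "exp \<Rightarrow> state \<Rightarrow> int" where
  "aval (N c) s = c"
| "aval (V x) s = fst s x"
| "aval (Bop f e e') s = bop_value f (aval e s) (aval e' s)"
| "aval (Get k e) s = snd s k (nat (aval e s))"

fun assigned_vars :: "com \<Rightarrow> var set" where
  "assigned_vars (x ::= e) = {x}"
| "assigned_vars (Put k i e) = {}"
| "assigned_vars (c ;; c') = assigned_vars c \<union> assigned_vars c'"
| "assigned_vars (While e e' c) = assigned_vars c"

fun assigned_arrs :: "com \<Rightarrow> arr set" where
  "assigned_arrs (x ::= e) = {}"
| "assigned_arrs (Put k i e) = {k}"
| "assigned_arrs (c ;; c') = assigned_arrs c \<union> assigned_arrs c'"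
| "assigned_arrs (While e e' c) = assigned_arrs c"

definition unchanged_outside :: "com \<Rightarrow> state \<Rightarrow> state \<Rightarrow> bool" where
  "unchanged_outside c s s' \<longleftrightarrow> (\<forall>x. x \<notin> assigned_vars c \<longrightarrow> fst s' x = fst s x) \<and>
     (\<forall>k. k \<notin> assigned_arrs c \<longrightarrow> snd s' k = snd s k)"

lemma unchanged_outside_refl: "unchanged_outside c s s"
  by (simp add: unchanged_outside_def)

lemma unchanged_outside_trans:
  "unchanged_outside c s s' \<Longrightarrow> unchanged_outside c s' s'' \<Longrightarrow> unchanged_outside c s s''"
  by (simp add: unchanged_outside_def)

text \<open>Stored values are at most \<open>B\<close> in absolute value. The array \<open>IO\<close> is the only one of bounded size \<open>io_size\<close>:
  it shares its place in memory with the input and the output, whereas all others lie behind it.\<close>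
locale limits =
  fixes B io_size :: int
  assumes sixty_four_le_B: "64 \<le> B"
begin

definition valid_index :: "arr \<Rightarrow> int \<Rightarrow> bool" where
  "valid_index k i \<longleftrightarrow> 0 \<le> i \<and> (k = IO \<longrightarrow> i < io_size)"

lemma valid_index_int [simp]: "valid_index k (int i) \<longleftrightarrow> (k = IO \<longrightarrow> int i < io_size)"
  by (simp add: valid_index_def)

fun safe :: "exp \<Rightarrow> state \<Rightarrow> bool" where
  "safe (N c) s = True"
| "safe (V x) s = True"
| "safe (Bop f e e') s = (safe e s \<and> safe e' s)"
| "safe (Get k e) s = (safe e s \<and> valid_index k (aval e s))"

inductive big_step :: "com \<Rightarrow> state \<Rightarrow> nat \<Rightarrow> state \<Rightarrow> bool" where
  Assign: "\<lbrakk>safe e (v, a); \<bar>aval e (v, a)\<bar> \<le> B\<rbrakk> \<Longrightarrow> big_step (x ::= e) (v, a) 1 (v(x := aval e (v, a)), a)"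
| Put: "\<lbrakk>safe i (v, a); safe e (v, a); valid_index k (aval i (v, a)); \<bar>aval e (v, a)\<bar> \<le> B\<rbrakk>
    \<Longrightarrow> big_step (Put k i e) (v, a) 1 (v, a(k := (a k)(nat (aval i (v, a)) := aval e (v, a))))"
| Seq: "\<lbrakk>big_step c s t s'; big_step c' s' t' s''\<rbrakk> \<Longrightarrow> big_step (c ;; c') s (t + t') s''"
| While_False: "\<lbrakk>safe e s; safe e' s; \<not> aval e s < aval e' s\<rbrakk> \<Longrightarrow> big_step (While e e' c) s 1 s"
| While_True: "\<lbrakk>safe e s; safe e' s; aval e s < aval e' s; big_step c s t s';
    big_step (While e e' c) s' t' s''\<rbrakk> \<Longrightarrow> big_step (While e e' c) s (Suc (t + t')) s''"

definition within_limits :: "state \<Rightarrow> bool" where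
  "within_limits s \<longleftrightarrow> (\<forall>x. \<bar>fst s x\<bar> \<le> B) \<and> (\<forall>k i. \<bar>snd s k i\<bar> \<le> B)"

lemma big_step_within_limits: "big_step c s t s' \<Longrightarrow> within_limits s \<Longrightarrow> within_limits s'"
  by (induction rule: big_step.induct) (auto simp: within_limits_def)

lemma big_step_unchanged_outside: "big_step c s t s' \<Longrightarrow> unchanged_outside c s s'"
  by (induction rule: big_step.induct) (auto simp: unchanged_outside_def)

subsection \<open>Proof rules for total correctness and running time\<close>

definition completes :: "com \<Rightarrow> state \<Rightarrow> nat \<Rightarrow> state \<Rightarrow> bool" where
  "completes c s t s' \<longleftrightarrow> (\<exists>t'\<le>t. big_step c s t' s')"

lemma completes_weaken: "completes c s t s' \<Longrightarrow> t \<le> t' \<Longrightarrow> completes c s t' s'"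
  unfolding completes_def by (meson order_trans)

lemma completes_unchanged_outside: "completes c s t s' \<Longrightarrow> unchanged_outside c s s'"
  unfolding completes_def using big_step_unchanged_outside by blast

lemma completes_unchanged_vars:
    "completes c (v, a) t (v', a') \<Longrightarrow> x \<notin> assigned_vars c \<Longrightarrow> v' x = v x"
  and completes_unchanged_arrs:
    "completes c (v, a) t (v', a') \<Longrightarrow> k \<notin> assigned_arrs c \<Longrightarrow> a' k = a k"
  using completes_unchanged_outside[of c "(v, a)" t "(v', a')"] by (simp_all add: unchanged_outside_def)

lemma completes_assign:
  "\<lbrakk>safe e (v, a); aval e (v, a) = r; \<bar>r\<bar> \<le> B\<rbrakk> \<Longrightarrow> completes (x ::= e) (v, a) 1 (v(x := r), a)"
  unfolding completes_def using big_step.Assign by blast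

lemma completes_put:
  assumes "safe i (v, a)" "aval i (v, a) = int j" "k = IO \<longrightarrow> int j < io_size"
    "safe e (v, a)" "aval e (v, a) = r" "\<bar>r\<bar> \<le> B"
  shows "completes (Put k i e) (v, a) 1 (v, a(k := (a k)(j := r)))"
  unfolding completes_def using big_step.Put[of i v a e k] assms by auto

lemma completes_seq:
  assumes "completes c s t s'" "completes c' s' t' s''"
  shows "completes (c ;; c') s (t + t') s''"
  using assms unfolding completes_def by (meson add_mono big_step.Seq)

lemma completes_while:
  assumes init: "Inv 0 s"
    and iterate: "\<And>i s'. \<lbrakk>i < n; Inv i s'; unchanged_outside c s s'\<rbrakk> \<Longrightarrow>
      safe e s' \<and> safe e' s' \<and> aval e s' < aval e' s' \<and> (\<exists>s''. completes c s' (t i) s'' \<and> Inv (Suc i) s'')"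
    and exit: "\<And>s'. \<lbrakk>Inv n s'; unchanged_outside c s s'\<rbrakk> \<Longrightarrow> safe e s' \<and> safe e' s' \<and> \<not> aval e s' < aval e' s'"
  shows "\<exists>s'. completes (While e e' c) s ((\<Sum>i<n. t i + 1) + 1) s' \<and> Inv n s'"
proof -
  have "\<exists>s''. completes (While e e' c) s' ((\<Sum>j\<in>{i..<n}. t j + 1) + 1) s'' \<and> Inv n s''"
    if "i \<le> n" "Inv i s'" "unchanged_outside c s s'" for i s'
    using that
  proof (induction "n - i" arbitrary: i s')
    case 0
    then have "big_step (While e e' c) s' 1 s'" using exit[of s'] big_step.While_False by simp
    then have "completes (While e e' c) s' 1 s'" unfolding completes_def by blast
    moreover have "i = n" using 0 by simp
    ultimately show ?case using 0 by (intro exI[of _ s']) simp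
  next
    case (Suc d)
    then have i_less: "i < n" by simp
    note guard = iterate[OF i_less Suc.prems(2,3)]
    then obtain t' s1 where body: "big_step c s' t' s1" "t' \<le> t i" "Inv (Suc i) s1" by (auto simp: completes_def)
    have "unchanged_outside c s s1"
      using Suc.prems(3) big_step_unchanged_outside[OF body(1)] by (rule unchanged_outside_trans)
    moreover have "d = n - Suc i" "Suc i \<le> n" using Suc.hyps(2) i_less by linarith+
    ultimately have "\<exists>s2. completes (While e e' c) s1 ((\<Sum>j\<in>{Suc i..<n}. t j + 1) + 1) s2 \<and> Inv n s2"
      using Suc.hyps(1) body(3) by blast
    then obtain s2 t'' where rest: "big_step (While e e' c) s1 t'' s2"
      "t'' \<le> (\<Sum>j\<in>{Suc i..<n}. t j + 1) + 1" "Inv n s2"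
      unfolding completes_def by blast
    have "(\<Sum>j\<in>{i..<n}. t j + 1) = (t i + 1) + (\<Sum>j\<in>{Suc i..<n}. t j + 1)"
      using i_less by (simp only: sum.atLeast_Suc_lessThan)
    then have "Suc (t' + t'') \<le> (\<Sum>j\<in>{i..<n}. t j + 1) + 1" using body(2) rest(2) by linarith
    moreover have "big_step (While e e' c) s' (Suc (t' + t'')) s2"
      using guard body(1) rest(1) big_step.While_True by blast
    ultimately show ?case using rest(3) unfolding completes_def by blast
  qed
  from this[OF _ init unchanged_outside_refl] show ?thesis by (simp add: lessThan_atLeast0)
qed

end

definition for_upto :: "exp \<Rightarrow> com \<Rightarrow> com" where
  "for_upto e c = Idx ::= N 0 ;; While (V Idx) e (c ;; Idx ::= V Idx \<oplus> N 1)"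

lemma assigned_for_upto [simp]:
  "assigned_vars (for_upto e c) = insert Idx (assigned_vars c)" "assigned_arrs (for_upto e c) = assigned_arrs c"
  by (auto simp: for_upto_def)

lemma (in limits) completes_for_upto:
  assumes init: "Inv 0 (v(Idx := 0), a)" and n_le_B: "int n \<le> B"
    and bound: "\<And>i v' a'. \<lbrakk>i \<le> n; Inv i (v', a'); unchanged_outside (for_upto e c) (v, a) (v', a')\<rbrakk> \<Longrightarrow>
      v' Idx = int i \<and> safe e (v', a') \<and> aval e (v', a') = int n"
    and body: "\<And>i v' a'. \<lbrakk>i < n; Inv i (v', a'); v' Idx = int i; unchanged_outside (for_upto e c) (v, a) (v', a')\<rbrakk> \<Longrightarrow>
      \<exists>v'' a''. completes c (v', a') t (v'', a'') \<and> v'' Idx = int i \<and> Inv (Suc i) (v''(Idx := int (Suc i)), a'')"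
  shows "\<exists>v' a'. completes (for_upto e c) (v, a) (n * (t + 2) + 2) (v', a') \<and> Inv n (v', a')"
proof -
  let ?body = "c ;; Idx ::= V Idx \<oplus> N 1"
  have start: "completes (Idx ::= N 0) (v, a) 1 (v(Idx := 0), a)"
    by (rule completes_assign) (use sixty_four_le_B in auto)
  have frame: "unchanged_outside (for_upto e c) (v, a) s'"
    if "unchanged_outside ?body (v(Idx := 0), a) s'" for s'
    using that by (auto simp: unchanged_outside_def)
  have "\<exists>s'. completes (While (V Idx) e ?body) (v(Idx := 0), a) ((\<Sum>i<n. (t + 1) + 1) + 1) s' \<and> Inv n s'"
  proof (rule completes_while, rule init)
    fix i s' assume i_less: "i < n" and invariant: "Inv i s'"
      and unchanged: "unchanged_outside ?body (v(Idx := 0), a) s'"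
    obtain v' a' where state: "s' = (v', a')" by (cases s')
    note guard = bound[OF less_imp_le[OF i_less] invariant[unfolded state] frame[OF unchanged, unfolded state]]
    obtain v'' a'' where iteration: "completes c (v', a') t (v'', a'')" "v'' Idx = int i"
      "Inv (Suc i) (v''(Idx := int (Suc i)), a'')"
      using body[OF i_less invariant[unfolded state] _ frame[OF unchanged, unfolded state]] guard by blast
    have "completes (Idx ::= V Idx \<oplus> N 1) (v'', a'') 1 (v''(Idx := int (Suc i)), a'')"
      by (rule completes_assign) (use iteration(2) i_less n_le_B in auto)
    then have "completes ?body (v', a') (t + 1) (v''(Idx := int (Suc i)), a'')"
      using iteration(1) by (blast intro: completes_seq)
    then show "safe (V Idx) s' \<and> safe e s' \<and> aval (V Idx) s' < aval e s' \<and>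
      (\<exists>s''. completes ?body s' (t + 1) s'' \<and> Inv (Suc i) s'')"
      using guard i_less iteration(3) unfolding state by auto
  next
    fix s' assume "Inv n s'" "unchanged_outside ?body (v(Idx := 0), a) s'"
    then show "safe (V Idx) s' \<and> safe e s' \<and> \<not> aval (V Idx) s' < aval e s'"
      using bound[of n "fst s'" "snd s'"] frame[of s'] by simp
  qed
  then obtain s' where loop: "completes (While (V Idx) e ?body) (v(Idx := 0), a) (n * (t + 2) + 1) s'" "Inv n s'"
    by auto
  have "completes (for_upto e c) (v, a) (n * (t + 2) + 2) s'"
    using completes_seq[OF start loop(1)] by (simp add: for_upto_def)
  then show ?thesis using loop(2) by (cases s') blast
qed

subsection \<open>Basic building blocks\<close>

text \<open>Since \<open>0 div 0 = 0\<close>, the expression \<open>e \<oslash> e\<close> is the indicator of \<open>e \<noteq> 0\<close>.\<close>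
definition nonzero :: "exp \<Rightarrow> exp" where
  "nonzero e = e \<oslash> e"

definition is_zero :: "exp \<Rightarrow> exp" where
  "is_zero e = N 1 \<ominus> e \<oslash> e"

definition at_most :: "exp \<Rightarrow> exp \<Rightarrow> exp" where
  "at_most e e' = is_zero (e \<oslash> (e' \<oplus> N 1))"

lemma aval_nonzero [simp]: "aval (nonzero e) s = of_bool (aval e s \<noteq> 0)"
  and aval_is_zero [simp]: "aval (is_zero e) s = of_bool (aval e s = 0)"
  by (auto simp: nonzero_def is_zero_def)

lemma aval_at_most:
  assumes "aval e s = int x" "aval e' s = int y"
  shows "aval (at_most e e') s = of_bool (x \<le> y)"
proof -
  have "int x div (int y + 1) = int (x div (y + 1))" by (simp add: zdiv_int add.commute)
  then show ?thesis using assms by (auto simp: at_most_def div_eq_0_iff)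
qed

lemma (in limits) safe_derived [simp]:
  "safe (nonzero e) s = safe e s" "safe (is_zero e) s = safe e s" "safe (at_most e e') s \<longleftrightarrow> safe e s \<and> safe e' s"
  by (auto simp: nonzero_def is_zero_def at_most_def)

definition overwrite :: "nat \<Rightarrow> nat \<Rightarrow> (nat \<Rightarrow> int) \<Rightarrow> (nat \<Rightarrow> int) \<Rightarrow> nat \<Rightarrow> int" where
  "overwrite off n f x j = (if off \<le> j \<and> j < off + n then f (j - off) else x j)"

lemma overwrite_0: "overwrite off 0 f x = x"
  by (auto simp: overwrite_def)

lemma overwrite_Suc: "overwrite off (Suc n) f x = (overwrite off n f x)(off + n := f n)"
  by (auto simp: overwrite_def fun_eq_iff less_Suc_eq)

lemma overwrite_less [simp]: "j < n \<Longrightarrow> overwrite 0 n f x j = f j"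
  and overwrite_ge [simp]: "n \<le> j \<Longrightarrow> overwrite 0 n f x j = x j"
  by (simp_all add: overwrite_def)

definition fill :: "arr \<Rightarrow> exp \<Rightarrow> exp \<Rightarrow> exp \<Rightarrow> com" where
  "fill k off e len = for_upto len (Put k (off \<oplus> V Idx) e)"

lemma assigned_fill [simp]: "assigned_vars (fill k off e len) = {Idx}" "assigned_arrs (fill k off e len) = {k}"
  by (simp_all add: fill_def)

lemma (in limits) completes_fill:
  assumes io_bound: "k = IO \<longrightarrow> int (off + n) \<le> io_size" and n_le_B: "int n \<le> B"
    and length: "\<And>i. i \<le> n \<Longrightarrow> safe len (v(Idx := int i), a(k := overwrite off i f (a k))) \<and>
      aval len (v(Idx := int i), a(k := overwrite off i f (a k))) = int n"
    and offset: "\<And>i. i < n \<Longrightarrow> safe b (v(Idx := int i), a(k := overwrite off i f (a k))) \<and>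
      aval b (v(Idx := int i), a(k := overwrite off i f (a k))) = int off"
    and entry: "\<And>i. i < n \<Longrightarrow> safe e (v(Idx := int i), a(k := overwrite off i f (a k))) \<and>
      aval e (v(Idx := int i), a(k := overwrite off i f (a k))) = f i \<and> \<bar>f i\<bar> \<le> B"
  shows "completes (fill k b e len) (v, a) (3 * n + 2) (v(Idx := int n), a(k := overwrite off n f (a k)))"
proof -
  define Inv where "Inv = (\<lambda>i s. s = (v(Idx := int i), a(k := overwrite off i f (a k))))"
  have "\<exists>v' a'. completes (fill k b e len) (v, a) (n * (1 + 2) + 2) (v', a') \<and> Inv n (v', a')"
    unfolding fill_def
  proof (rule completes_for_upto)
    fix i v' a' assume i_less: "i < n" and "Inv i (v', a')"
    then have state: "v' = v(Idx := int i)" "a' = a(k := overwrite off i f (a k))" by (simp_all add: Inv_def)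
    have "completes (Put k (b \<oplus> V Idx) e) (v', a') 1 (v', a'(k := (a' k)(off + i := f i)))"
      unfolding state by (rule completes_put) (use i_less io_bound offset[OF i_less] entry[OF i_less] in auto)
    then show "\<exists>v'' a''. completes (Put k (b \<oplus> V Idx) e) (v', a') 1 (v'', a'') \<and> v'' Idx = int i \<and>
      Inv (Suc i) (v''(Idx := int (Suc i)), a'')"
      by (intro exI conjI) (assumption, auto simp: state Inv_def overwrite_Suc)
  qed (use n_le_B length in \<open>auto simp: Inv_def overwrite_0\<close>)
  then obtain v' a' where loop: "completes (fill k b e len) (v, a) (n * (1 + 2) + 2) (v', a')" "Inv n (v', a')"
    by blast
  have "completes (fill k b e len) (v, a) (3 * n + 2) (v', a')" by (rule completes_weaken[OF loop(1)]) simp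
  then show ?thesis using loop(2) by (simp only: Inv_def)
qed

section \<open>Compilation\<close>

subsection \<open>The compiler\<close>

abbreviation (input) first_temp :: nat where "first_temp \<equiv> 32"
abbreviation (input) io_base :: nat where "io_base \<equiv> 64"

fun var_reg :: "var \<Rightarrow> nat" where
  "var_reg Bound = 1" | "var_reg Count = 2" | "var_reg Idx = 3" | "var_reg Pow_Two = 4" | "var_reg Log = 5"
| "var_reg Modulus = 6" | "var_reg Max_Quot = 7" | "var_reg Width = 8" | "var_reg Sum_Len = 9"
| "var_reg Tab_Len = 10" | "var_reg Scale = 11" | "var_reg Cosine = 12" | "var_reg Sine = 13"
| "var_reg Filled = 14" | "var_reg Radicand = 15" | "var_reg Root = 16" | "var_reg Bit = 17"
| "var_reg Residue = 18" | "var_reg Class_Size = 19" | "var_reg Leaves = 20" | "var_reg Half = 21"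
| "var_reg Code_Len = 22" | "var_reg Offset = 23" | "var_reg Len = 24" | "var_reg Stride = 25"

fun arr_slot :: "arr \<Rightarrow> nat" where
  "arr_slot Saved = 0" | "arr_slot Input = 1" | "arr_slot Quots = 2" | "arr_slot Codes = 3" | "arr_slot Acc = 4"
| "arr_slot XRe = 5" | "arr_slot XIm = 6" | "arr_slot YRe = 7" | "arr_slot YIm = 8" | "arr_slot BufRe = 9"
| "arr_slot BufIm = 10" | "arr_slot TabRe = 11" | "arr_slot TabIm = 12" | "arr_slot IO = 13"

text \<open>Register 0 holds the base address, behind which the arrays other than \<open>IO\<close> are interleaved. The registers below
  \<open>first_temp\<close> hold the variables, the registers from \<open>first_temp\<close> to \<open>io_base - 1\<close> are temporaries.\<close>
definition address :: "nat \<Rightarrow> arr \<Rightarrow> nat \<Rightarrow> nat" where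
  "address base k i = (if k = IO then io_base + i else base + 16 * i + arr_slot k)"

fun bop_instr :: "bop \<Rightarrow> nat \<Rightarrow> nat \<Rightarrow> nat \<Rightarrow> instr" where
  "bop_instr Plus = Add" | "bop_instr Minus = Sub" | "bop_instr Times = Mul" | "bop_instr Quot = Div"
| "bop_instr Rem = Mod"

definition compile_address :: "nat \<Rightarrow> arr \<Rightarrow> instr list" where
  "compile_address d k =
    (if k = IO then [Const (Suc d) (int io_base), Add d d (Suc d)]
     else [Const (Suc d) 16, Mul d d (Suc d), Add d d 0, Const (Suc d) (int (arr_slot k)), Add d d (Suc d)])"

fun compile_exp :: "nat \<Rightarrow> exp \<Rightarrow> instr list" where
  "compile_exp d (N c) = [Const d c]"
| "compile_exp d (V x) = [Const d 0, Add d d (var_reg x)]"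
| "compile_exp d (Bop f e e') = compile_exp d e @ compile_exp (Suc d) e' @ [bop_instr f d d (Suc d)]"
| "compile_exp d (Get k e) = (compile_exp d e @ compile_address d k) @ [Load d d]"

fun compile_com :: "nat \<Rightarrow> com \<Rightarrow> instr list" where
  "compile_com pc (x ::= e) = compile_exp first_temp e @ [Const (Suc first_temp) 0, Add (var_reg x) first_temp (Suc first_temp)]"
| "compile_com pc (Put k i e) =
    (compile_exp first_temp i @ compile_address first_temp k) @ compile_exp (Suc first_temp) e @ [Store (Suc first_temp) first_temp]"
| "compile_com pc (c ;; c') = (let p = compile_com pc c in p @ compile_com (pc + length p) c')"
| "compile_com pc (While e e' c) =
    (let test = compile_exp first_temp (e \<ominus> e'); start = pc + length test + 2; body = compile_com start c in
     test @ [Jneg first_temp start, Jmp (start + length body + 1)] @ body @ [Jmp pc])"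

fun exp_fits :: "nat \<Rightarrow> exp \<Rightarrow> bool" where
  "exp_fits d (N c) \<longleftrightarrow> \<bar>c\<bar> \<le> 64 \<and> d < io_base"
| "exp_fits d (V x) \<longleftrightarrow> d < io_base"
| "exp_fits d (Bop f e e') \<longleftrightarrow> exp_fits d e \<and> exp_fits (Suc d) e'"
| "exp_fits d (Get k e) \<longleftrightarrow> exp_fits d e \<and> Suc d < io_base"

fun com_fits :: "com \<Rightarrow> bool" where
  "com_fits (x ::= e) \<longleftrightarrow> exp_fits first_temp e"
| "com_fits (Put k i e) \<longleftrightarrow> exp_fits first_temp i \<and> exp_fits (Suc first_temp) e"
| "com_fits (c ;; c') \<longleftrightarrow> com_fits c \<and> com_fits c'"
| "com_fits (While e e' c) \<longleftrightarrow> exp_fits first_temp (e \<ominus> e') \<and> com_fits c"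

text \<open>The value of an expression of weight \<open>k\<close> is at most \<open>B ^ k\<close> if all stored values are at most \<open>B\<close>.\<close>
fun exp_weight :: "exp \<Rightarrow> nat" where
  "exp_weight (N c) = 1"
| "exp_weight (V x) = 1"
| "exp_weight (Bop f e e') = exp_weight e + exp_weight e'"
| "exp_weight (Get k e) = Suc (exp_weight e)"

fun com_weight :: "com \<Rightarrow> nat" where
  "com_weight (x ::= e) = exp_weight e"
| "com_weight (Put k i e) = exp_weight i + exp_weight e"
| "com_weight (c ;; c') = com_weight c + com_weight c'"
| "com_weight (While e e' c) = exp_weight e + exp_weight e' + com_weight c"

lemma var_reg_eq_iff [simp]: "var_reg x = var_reg y \<longleftrightarrow> x = y"
  by (cases x; cases y; simp)

lemma var_reg_bounds: "0 < var_reg x" "var_reg x < first_temp"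
  by (cases x; simp)+

lemma arr_slot_eq_iff [simp]: "arr_slot k = arr_slot k' \<longleftrightarrow> k = k'"
  by (cases k; cases k'; simp)

lemma arr_slot_less: "arr_slot k < 16"
  by (cases k; simp)

lemma address_eqD:
  assumes "address base k i = address base k' i'"
    "k = IO \<longrightarrow> io_base + int i < base" "k' = IO \<longrightarrow> io_base + int i' < base"
  shows "k = k' \<and> i = i'"
proof -
  have "arr_slot k = arr_slot k' \<and> i = i'" if "16 * i + arr_slot k = 16 * i' + arr_slot k'"
    using that arr_slot_less[of k] arr_slot_less[of k'] by presburger
  then show ?thesis using assms by (auto simp: address_def split: if_splits)
qed

subsection \<open>Machine executions\<close>

definition words_within :: "int \<Rightarrow> (nat \<Rightarrow> int) \<Rightarrow> bool" where
  "words_within M m \<longleftrightarrow> (\<forall>x. \<bar>m x\<bar> \<le> M)"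

lemma words_within_upd: "words_within M m \<Longrightarrow> \<bar>x\<bar> \<le> M \<Longrightarrow> words_within M (m(r := x))"
  by (simp add: words_within_def)

lemma words_within_mono: "words_within M m \<Longrightarrow> M \<le> M' \<Longrightarrow> words_within M' m"
  unfolding words_within_def by (meson order_trans)

lemma words_withinD: "words_within M m \<Longrightarrow> \<bar>m x\<bar> \<le> M" "words_within M m \<Longrightarrow> 0 \<le> M"
  unfolding words_within_def by (blast, meson abs_ge_zero order_trans)

definition reaches :: "prog \<Rightarrow> int \<Rightarrow> config \<Rightarrow> nat \<Rightarrow> config \<Rightarrow> bool" where
  "reaches P M c t c' \<longleftrightarrow> run P t c = c' \<and> (\<forall>t'\<le>t. words_within M (snd (run P t' c)))"

lemma run_add: "run P (s + t) c = run P t (run P s c)"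
  by (simp only: run_def add.commute[of s t] funpow_add o_apply)

lemma reaches_refl: "words_within M (snd c) \<Longrightarrow> reaches P M c 0 c"
  by (simp add: reaches_def run_def)

lemma reaches_trans:
  assumes "reaches P M c s c'" "reaches P M c' t c''"
  shows "reaches P M c (s + t) c''"
proof -
  have runs: "run P s c = c'" "run P t c' = c''" using assms by (simp_all add: reaches_def)
  have "words_within M (snd (run P t' c))" if "t' \<le> s + t" for t'
  proof (cases "t' \<le> s")
    case True
    then show ?thesis using assms(1) by (simp add: reaches_def)
  next
    case False
    then have "t' = s + (t' - s)" "t' - s \<le> t" using that by simp_all
    then show ?thesis using assms(2) runs(1) unfolding reaches_def by (metis run_add)
  qed
  then show ?thesis by (simp add: reaches_def run_add runs)
qed

lemma reaches_step:
  assumes "words_within M m" "pc < length P" "exec (P ! pc) (pc, m) = (pc', m')" "words_within M m'"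
  shows "reaches P M (pc, m) 1 (pc', m')"
proof -
  have "run P 1 (pc, m) = (pc', m')" using assms(2,3) by (simp add: run_def step_def halted_def)
  moreover have "run P 0 (pc, m) = (pc, m)" by (simp add: run_def)
  ultimately show ?thesis using assms(1,4) by (simp add: reaches_def le_Suc_eq)
qed

fun code_at :: "prog \<Rightarrow> nat \<Rightarrow> instr list \<Rightarrow> bool" where
  "code_at P pc [] \<longleftrightarrow> True"
| "code_at P pc (i # is) \<longleftrightarrow> pc < length P \<and> P ! pc = i \<and> code_at P (Suc pc) is"

lemma code_at_append:
  "code_at P pc (is @ js) \<longleftrightarrow> code_at P pc is \<and> code_at P (pc + length is) js"
  by (induction "is" arbitrary: pc) auto

lemma code_at_infix: "code_at (is @ js @ ks) (length is) js"
proof (induction js arbitrary: "is")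
  case (Cons j js)
  from Cons[of "is @ [j]"] show ?case by (simp add: nth_append)
qed simp

fun is_jump :: "instr \<Rightarrow> bool" where
  "is_jump (Jz r l) = True" | "is_jump (Jneg r l) = True" | "is_jump (Jmp l) = True"
| "is_jump i = False"

definition effect :: "instr \<Rightarrow> (nat \<Rightarrow> int) \<Rightarrow> nat \<Rightarrow> int" where
  "effect i m = snd (exec i (0, m))"

lemma effect_simps [simp]:
  "effect (Const r c) m = m(r := c)"
  "effect (Add r x y) m = m(r := m x + m y)"
  "effect (Sub r x y) m = m(r := m x - m y)"
  "effect (Mul r x y) m = m(r := m x * m y)"
  "effect (Div r x y) m = m(r := m x div m y)"
  "effect (Mod r x y) m = m(r := m x mod m y)"
  "effect (Load r x) m = m(r := m (nat (m x)))"
  "effect (Store r x) m = m(nat (m x) := m r)"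
  by (simp_all add: effect_def)

lemma exec_no_jump: "\<not> is_jump i \<Longrightarrow> exec i (pc, m) = (Suc pc, effect i m)"
  by (cases i) simp_all

lemma bop_instr_no_jump [simp]: "\<not> is_jump (bop_instr f r x y)"
  by (cases f) simp_all

lemma effect_bop_instr [simp]: "effect (bop_instr f r x y) m = m(r := bop_value f (m x) (m y))"
  by (cases f) simp_all

fun straight_line :: "int \<Rightarrow> instr list \<Rightarrow> (nat \<Rightarrow> int) \<Rightarrow> (nat \<Rightarrow> int) \<Rightarrow> bool" where
  "straight_line M [] m m' \<longleftrightarrow> m' = m"
| "straight_line M (i # is) m m' \<longleftrightarrow> \<not> is_jump i \<and> words_within M (effect i m) \<and> straight_line M is (effect i m) m'"

lemma straight_line_append:
  "straight_line M is m m' \<Longrightarrow> straight_line M js m' m'' \<Longrightarrow> straight_line M (is @ js) m m''"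
  by (induction "is" arbitrary: m) auto

lemma straight_line_words_within: "straight_line M is m m' \<Longrightarrow> words_within M m \<Longrightarrow> words_within M m'"
  by (induction "is" arbitrary: m) auto

lemma straight_line_mono: "straight_line M is m m' \<Longrightarrow> M \<le> M' \<Longrightarrow> straight_line M' is m m'"
  by (induction "is" arbitrary: m) (auto intro: words_within_mono)

lemma straight_line_reaches:
  "\<lbrakk>straight_line M is m m'; words_within M m; code_at P pc is\<rbrakk>
    \<Longrightarrow> reaches P M (pc, m) (length is) (pc + length is, m')"
proof (induction "is" arbitrary: pc m)
  case Nil
  then show ?case by (simp add: reaches_refl)
next
  case (Cons i "is")
  then have "reaches P M (pc, m) 1 (Suc pc, effect i m)" by (intro reaches_step) (auto simp: exec_no_jump)
  from reaches_trans[OF this Cons.IH] Cons.prems show ?case by auto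
qed

subsection \<open>Bounds on the values of expressions\<close>

lemma abs_div_pos_le: "0 < y \<Longrightarrow> \<bar>x div y\<bar> \<le> \<bar>x\<bar>" for x y :: int
proof (cases "0 \<le> x")
  case True
  moreover assume "0 < y"
  ultimately show ?thesis by (simp add: pos_imp_zdiv_nonneg_iff zdiv_mono2[of x 1 y, simplified])
next
  case False
  moreover assume "0 < y"
  ultimately have "x div y < 0" "x \<le> x div y" using zdiv_mono2_neg[of x 1 y] by (simp_all add: pos_imp_zdiv_neg_iff)
  then show ?thesis by simp
qed

lemma abs_div_le: "\<bar>x div y\<bar> \<le> \<bar>x\<bar>" for x y :: int
proof -
  consider "y = 0" | "0 < y" | "0 < - y" by linarith
  then show ?thesis using abs_div_pos_le[of y x] abs_div_pos_le[of "- y" "- x"] by cases simp_all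
qed

lemma abs_mod_le: "\<bar>x mod y\<bar> \<le> \<bar>x\<bar> + \<bar>y\<bar>" for x y :: int
proof -
  consider "y = 0" | "0 < y" | "y < 0" by linarith
  then show ?thesis
    using pos_mod_bound[of y x] pos_mod_sign[of y x] neg_mod_bound[of y x] neg_mod_sign[of y x]
    by cases (simp, linarith+)
qed

lemma bop_value_bound:
  assumes "\<bar>x\<bar> \<le> X" "\<bar>y\<bar> \<le> Y" "2 \<le> X" "2 \<le> Y"
  shows "\<bar>bop_value f x y\<bar> \<le> X * Y"
proof -
  have "0 \<le> (X - 2) * (Y - 2)" "0 \<le> (X - 1) * (Y - 1)" using assms by auto
  then have "X + Y \<le> X * Y" using assms by (simp add: algebra_simps)
  moreover have "\<bar>x * y\<bar> \<le> X * Y" unfolding abs_mult using assms by (intro mult_mono) auto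
  ultimately show ?thesis using assms abs_div_le[of x y] abs_mod_le[of x y] by (cases f) auto
qed

lemma exp_weight_pos: "0 < exp_weight e"
  by (induction e) auto

lemma exp_fits_less: "exp_fits d e \<Longrightarrow> d < io_base"
  by (induction e arbitrary: d) auto

context limits
begin

lemma B_power_le: "B ^ n \<le> M \<Longrightarrow> m \<le> n \<Longrightarrow> B ^ m \<le> M"
  using sixty_four_le_B by (meson order_trans power_increasing one_le_numeral)

lemma B_le_power: "0 < n \<Longrightarrow> B \<le> B ^ n"
  using sixty_four_le_B by (intro self_le_power) auto

lemma aval_bound:
  assumes "within_limits s" "exp_fits d e"
  shows "\<bar>aval e s\<bar> \<le> B ^ exp_weight e"
  using assms(2)
proof (induction e arbitrary: d)
  case (Bop f e e')
  have "2 \<le> B ^ exp_weight e" "2 \<le> B ^ exp_weight e'"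
    using B_le_power[OF exp_weight_pos, of e] B_le_power[OF exp_weight_pos, of e'] sixty_four_le_B by linarith+
  moreover have "\<bar>aval e s\<bar> \<le> B ^ exp_weight e" "\<bar>aval e' s\<bar> \<le> B ^ exp_weight e'"
    using Bop.IH(1)[of d] Bop.IH(2)[of "Suc d"] Bop.prems by simp_all
  ultimately show ?case by (simp add: power_add bop_value_bound)
next
  case (Get k e)
  have "\<bar>aval (Get k e) s\<bar> \<le> B" using assms(1) by (simp add: within_limits_def)
  also have "\<dots> \<le> B ^ exp_weight (Get k e)" by (rule B_le_power) simp
  finally show ?case .
qed (use assms(1) sixty_four_le_B in \<open>auto simp: within_limits_def\<close>)

end

subsection \<open>Correctness\<close>

definition agree_outside_temps :: "nat \<Rightarrow> (nat \<Rightarrow> int) \<Rightarrow> (nat \<Rightarrow> int) \<Rightarrow> bool" where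
  "agree_outside_temps d m m' \<longleftrightarrow> (\<forall>x. x < d \<or> io_base \<le> x \<longrightarrow> m' x = m x)"

definition computes :: "int \<Rightarrow> instr list \<Rightarrow> nat \<Rightarrow> int \<Rightarrow> (nat \<Rightarrow> int) \<Rightarrow> (nat \<Rightarrow> int) \<Rightarrow> bool" where
  "computes M is d r m m' \<longleftrightarrow>
    straight_line M is m m' \<and> words_within M m' \<and> m' d = r \<and> agree_outside_temps d m m'"

lemma computes_append:
  "computes M is d r m m' \<Longrightarrow> computes M js d r' m' m'' \<Longrightarrow> computes M (is @ js) d r' m m''"
  by (auto simp: computes_def agree_outside_temps_def intro: straight_line_append)

lemma computes_instr:
  "\<lbrakk>\<not> is_jump i; words_within M m; effect i m = m(d := r); \<bar>r\<bar> \<le> M; d < io_base\<rbrakk>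
    \<Longrightarrow> computes M [i] d r m (m(d := r))"
  by (simp add: computes_def agree_outside_temps_def words_within_upd)

lemma computes_bop:
  assumes "computes M is d x m m1" "computes M js (Suc d) y m1 m2" "\<bar>bop_value f x y\<bar> \<le> M" "d < io_base"
  shows "\<exists>m'. computes M (is @ js @ [bop_instr f d d (Suc d)]) d (bop_value f x y) m m'"
proof -
  have "m2 d = x" using assms(1,2) by (simp add: computes_def agree_outside_temps_def)
  then have last: "computes M [bop_instr f d d (Suc d)] d (bop_value f x y) m2 (m2(d := bop_value f x y))"
    using assms by (intro computes_instr) (auto simp: computes_def)
  have "straight_line M (is @ js @ [bop_instr f d d (Suc d)]) m (m2(d := bop_value f x y))"
    using assms(1,2) last unfolding computes_def by (blast intro: straight_line_append)
  then have "computes M (is @ js @ [bop_instr f d d (Suc d)]) d (bop_value f x y) m (m2(d := bop_value f x y))"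
    using assms(1,2,4) last by (simp add: computes_def agree_outside_temps_def)
  then show ?thesis by blast
qed

locale memory_layout = limits +
  fixes base :: nat
  assumes io_base_le_base: "io_base \<le> base" and base_le_B: "int base \<le> B"
    and io_le_base: "int io_base + io_size \<le> base"
begin

definition encodes :: "state \<Rightarrow> (nat \<Rightarrow> int) \<Rightarrow> bool" where
  "encodes s m \<longleftrightarrow> m 0 = int base \<and> (\<forall>x. m (var_reg x) = fst s x) \<and>
     (\<forall>k i. valid_index k (int i) \<longrightarrow> m (address base k i) = snd s k i)"

lemma io_base_le_address: "io_base \<le> address base k i"
  using io_base_le_base by (simp add: address_def)

lemma address_neq_var_reg [simp]: "address base k i \<noteq> var_reg x" "var_reg x \<noteq> address base k i"
  using io_base_le_address[of k i] var_reg_bounds[of x] by linarith+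

lemma address_eq_iff:
  assumes "valid_index k (int i)" "valid_index k' (int i')"
  shows "address base k i = address base k' i' \<longleftrightarrow> k = k' \<and> i = i'"
  using address_eqD[of base k i k' i'] assms io_le_base by auto

lemma encodes_agree_outside_temps:
  assumes "encodes s m" "agree_outside_temps d m m'" "first_temp \<le> d"
  shows "encodes s m'"
proof -
  have "var_reg x < d" for x using var_reg_bounds(2)[of x] assms(3) by linarith
  then show ?thesis using assms io_base_le_address by (simp add: encodes_def agree_outside_temps_def)
qed

lemma address_bound:
  assumes "\<bar>i\<bar> \<le> B ^ w" "0 < w"
  shows "16 * \<bar>i\<bar> + int base + 64 \<le> B ^ (w + 3)"
proof -
  have "16 * \<bar>i\<bar> + int base + 64 \<le> 18 * B ^ w"
    using assms(1) B_le_power[OF assms(2)] base_le_B sixty_four_le_B by linarith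
  also have "\<dots> \<le> B ^ 3 * B ^ w"
    using B_le_power[of 3] sixty_four_le_B by (intro mult_right_mono) auto
  finally show ?thesis by (simp add: power_add mult.commute)
qed

lemma compile_address_correct:
  assumes memory: "words_within M m" "m 0 = int base" and index: "m d = i" "valid_index k i"
    and limit: "16 * \<bar>i\<bar> + int base + 64 \<le> M" and d_range: "first_temp \<le> d" "Suc d < io_base"
  shows "\<exists>m'. computes M (compile_address d k) d (int (address base k (nat i))) m m'"
proof -
  have "0 \<le> i" using index(2) by (simp add: valid_index_def)
  show ?thesis
  proof (cases "k = IO")
    case True
    then show ?thesis
      using memory index limit d_range \<open>0 \<le> i\<close>
      by (auto simp: compile_address_def computes_def agree_outside_temps_def address_def intro!: words_within_upd)
  next
    case False
    then show ?thesis
      using memory index limit d_range \<open>0 \<le> i\<close> arr_slot_less[of k]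
      by (auto simp: compile_address_def computes_def agree_outside_temps_def address_def intro!: words_within_upd)
  qed
qed

lemma compile_exp_address_correct:
  assumes within: "within_limits s" and fits: "exp_fits d e" "Suc d < io_base" and "first_temp \<le> d"
    and index: "valid_index k (aval e s)" and limit: "B ^ (exp_weight e + 3) \<le> M"
    and memory: "encodes s m" and index_eval: "computes M (compile_exp d e) d (aval e s) m m1"
  shows "\<exists>m'. computes M (compile_exp d e @ compile_address d k) d (int (address base k (nat (aval e s)))) m m'"
proof -
  have "encodes s m1" using encodes_agree_outside_temps[OF memory _ \<open>first_temp \<le> d\<close>] index_eval
    by (simp add: computes_def)
  then have "m1 0 = int base" by (simp add: encodes_def)
  moreover have "16 * \<bar>aval e s\<bar> + int base + 64 \<le> M"
    using address_bound[OF aval_bound[OF within fits(1)] exp_weight_pos] limit by linarith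
  ultimately obtain m2 where "computes M (compile_address d k) d (int (address base k (nat (aval e s)))) m1 m2"
    using compile_address_correct[of M m1 d "aval e s" k] index_eval index fits(2) \<open>first_temp \<le> d\<close>
    by (auto simp: computes_def)
  then show ?thesis using computes_append[OF index_eval] by blast
qed

lemma compile_get_correct:
  assumes within: "within_limits s" and fits: "exp_fits d (Get k e)" and safe: "safe (Get k e) s" and "first_temp \<le> d"
    and limit: "B ^ (exp_weight e + 3) \<le> M" and memory: "encodes s m"
    and index_eval: "computes M (compile_exp d e) d (aval e s) m m1"
  shows "\<exists>m'. computes M (compile_exp d (Get k e)) d (aval (Get k e) s) m m'"
proof -
  obtain m2 where address_eval:
    "computes M (compile_exp d e @ compile_address d k) d (int (address base k (nat (aval e s)))) m m2"
    using compile_exp_address_correct[OF within _ _ \<open>first_temp \<le> d\<close> _ limit memory index_eval] fits safe by auto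
  have "encodes s m2" using encodes_agree_outside_temps[OF memory _ \<open>first_temp \<le> d\<close>] address_eval
    by (simp add: computes_def)
  then have "m2 (address base k (nat (aval e s))) = aval (Get k e) s"
    using safe by (auto simp: encodes_def valid_index_def)
  then have "computes M [Load d d] d (aval (Get k e) s) m2 (m2(d := aval (Get k e) s))"
    using address_eval fits words_withinD(1)[of M m2 "address base k (nat (aval e s))"]
    by (intro computes_instr) (auto simp: computes_def)
  then show ?thesis using computes_append[OF address_eval] unfolding compile_exp.simps by blast
qed

lemma compile_exp_correct:
  assumes within: "within_limits s"
  shows "\<lbrakk>exp_fits d e; safe e s; encodes s m; words_within M m; B ^ (exp_weight e + 3) \<le> M; first_temp \<le> d\<rbrakk>
    \<Longrightarrow> \<exists>m'. computes M (compile_exp d e) d (aval e s) m m'"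
proof (induction e arbitrary: d m)
  case (N c)
  have "B ^ 1 \<le> M" by (rule B_power_le[OF N.prems(5)]) simp
  then have "computes M [Const d c] d c m (m(d := c))"
    using N.prems sixty_four_le_B by (intro computes_instr) auto
  then show ?case by auto
next
  case (V x)
  have "var_reg x \<noteq> d" using V.prems(6) var_reg_bounds[of x] by linarith
  then have "computes M (compile_exp d (V x)) d (m (var_reg x)) m (m(d := m (var_reg x)))"
    using V.prems words_withinD[OF V.prems(4)]
    by (simp add: computes_def agree_outside_temps_def words_within_upd)
  then show ?case using V.prems(3) by (auto simp: encodes_def)
next
  case (Bop f e e')
  have weights: "B ^ (exp_weight e + 3) \<le> M" "B ^ (exp_weight e' + 3) \<le> M" "B ^ exp_weight (Bop f e e') \<le> M"
    by (rule B_power_le[OF Bop.prems(5)]; simp)+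
  obtain m1 where first: "computes M (compile_exp d e) d (aval e s) m m1"
    using Bop.IH(1)[OF _ _ Bop.prems(3,4) weights(1) Bop.prems(6)] Bop.prems(1,2) by auto
  then have "encodes s m1" "words_within M m1"
    using encodes_agree_outside_temps[OF Bop.prems(3)] Bop.prems(6) by (auto simp: computes_def)
  then obtain m2 where second: "computes M (compile_exp (Suc d) e') (Suc d) (aval e' s) m1 m2"
    using Bop.IH(2)[OF _ _ _ _ weights(2)] Bop.prems(1,2,6) by fastforce
  have "\<bar>aval (Bop f e e') s\<bar> \<le> M" using aval_bound[OF within Bop.prems(1)] weights(3) by linarith
  then show ?case using computes_bop[OF first second, of f] exp_fits_less[OF Bop.prems(1)] by simp
next
  case (Get k e)
  have weight: "B ^ (exp_weight e + 3) \<le> M" by (rule B_power_le[OF Get.prems(5)]) simp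
  obtain m1 where "computes M (compile_exp d e) d (aval e s) m m1"
    using Get.IH[OF _ _ Get.prems(3,4) weight Get.prems(6)] Get.prems(1,2) by auto
  then show ?case by (rule compile_get_correct[OF within Get.prems(1,2,6) weight Get.prems(3)])
qed

lemma encodes_assign:
  assumes "encodes (v, a) m"
  shows "encodes (v(x := r), a) (m(Suc first_temp := r', var_reg x := r))"
proof -
  have "0 \<noteq> var_reg x" "var_reg y \<noteq> Suc first_temp" "address base k i \<noteq> Suc first_temp" for y k i
    using var_reg_bounds[of x] var_reg_bounds[of y] io_base_le_address[of k i] by linarith+
  then show ?thesis using assms by (simp add: encodes_def)
qed

lemma encodes_put:
  assumes "encodes (v, a) m" "valid_index k (int i)"
  shows "encodes (v, a(k := (a k)(i := r))) (m(address base k i := r))"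
  using assms io_base_le_address[of k i] by (auto simp: encodes_def address_eq_iff)

lemma compile_assign_correct:
  assumes within: "within_limits (v, a)" and "exp_fits first_temp e" "safe e (v, a)"
    and memory: "encodes (v, a) m" "words_within M m" and limit: "B ^ (exp_weight e + 3) \<le> M"
  shows "\<exists>m'. straight_line M (compile_com pc (x ::= e)) m m' \<and> encodes (v(x := aval e (v, a)), a) m'"
proof -
  obtain m1 where computed: "computes M (compile_exp first_temp e) first_temp (aval e (v, a)) m m1"
    using compile_exp_correct[OF assms order_refl] by blast
  then have "words_within M m1" "\<bar>aval e (v, a)\<bar> \<le> M"
    using words_withinD(1)[of M m1 first_temp] by (auto simp: computes_def)
  then have "straight_line M [Const (Suc first_temp) 0, Add (var_reg x) first_temp (Suc first_temp)] m1
    (m1(Suc first_temp := 0, var_reg x := aval e (v, a)))"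
    using computed words_withinD(2)[of M m1] by (auto simp: computes_def intro!: words_within_upd)
  then have "straight_line M (compile_com pc (x ::= e)) m (m1(Suc first_temp := 0, var_reg x := aval e (v, a)))"
    using computed unfolding compile_com.simps computes_def by (blast intro: straight_line_append)
  moreover have "encodes (v, a) m1"
    using encodes_agree_outside_temps[OF memory(1), of first_temp m1] computed by (simp add: computes_def)
  ultimately show ?thesis using encodes_assign by blast
qed

lemma compile_put_correct:
  assumes within: "within_limits (v, a)" and fits: "exp_fits first_temp i" "exp_fits (Suc first_temp) e"
    and safe: "safe i (v, a)" "safe e (v, a)" and index: "valid_index k (aval i (v, a))"
    and memory: "encodes (v, a) m" "words_within M m" and limit: "B ^ (exp_weight i + exp_weight e + 3) \<le> M"
  shows "\<exists>m'. straight_line M (compile_com pc (Put k i e)) m m' \<and>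
    encodes (v, a(k := (a k)(nat (aval i (v, a)) := aval e (v, a)))) m'"
proof -
  let ?A = "address base k (nat (aval i (v, a)))"
  have weights: "B ^ (exp_weight i + 3) \<le> M" "B ^ (exp_weight e + 3) \<le> M" by (rule B_power_le[OF limit]; simp)+
  obtain m1 where "computes M (compile_exp first_temp i) first_temp (aval i (v, a)) m m1"
    using compile_exp_correct[OF within fits(1) safe(1) memory weights(1)] by blast
  then obtain m2 where index_eval: "computes M (compile_exp first_temp i @ compile_address first_temp k) first_temp (int ?A) m m2"
    using compile_exp_address_correct[OF within fits(1) _ _ index weights(1) memory(1)] by auto
  then have "encodes (v, a) m2" "words_within M m2"
    using encodes_agree_outside_temps[OF memory(1), of first_temp m2] by (simp_all add: computes_def)
  then obtain m3 where value_eval: "computes M (compile_exp (Suc first_temp) e) (Suc first_temp) (aval e (v, a)) m2 m3"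
    using compile_exp_correct[OF within fits(2) safe(2) _ _ weights(2)] by fastforce
  have "encodes (v, a) m3"
    using encodes_agree_outside_temps[OF \<open>encodes (v, a) m2\<close>, of "Suc first_temp" m3] value_eval
    by (simp add: computes_def)
  then have "encodes (v, a(k := (a k)(nat (aval i (v, a)) := aval e (v, a)))) (m3(?A := aval e (v, a)))"
    using index by (intro encodes_put) (simp_all add: valid_index_def)
  moreover have "m3 first_temp = int ?A" using index_eval value_eval
    by (simp add: computes_def agree_outside_temps_def)
  then have "straight_line M [Store (Suc first_temp) first_temp] m3 (m3(?A := aval e (v, a)))"
    using value_eval words_withinD(1)[of M m3 "Suc first_temp"] by (auto simp: computes_def intro: words_within_upd)
  then have "straight_line M (compile_com pc (Put k i e)) m (m3(?A := aval e (v, a)))"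
    using index_eval value_eval unfolding compile_com.simps computes_def by (blast intro: straight_line_append)
  ultimately show ?thesis by blast
qed

definition simulates :: "prog \<Rightarrow> int \<Rightarrow> nat \<Rightarrow> state \<Rightarrow> nat \<Rightarrow> nat \<Rightarrow> state \<Rightarrow> bool" where
  "simulates P M pc s n pc' s' \<longleftrightarrow> (\<forall>m. encodes s m \<and> words_within M m \<longrightarrow>
     (\<exists>t m'. reaches P M (pc, m) t (pc', m') \<and> t \<le> n \<and> encodes s' m' \<and> words_within M m'))"

lemma simulates_trans:
  assumes "simulates P M pc s n pc' s'" "simulates P M pc' s' n' pc'' s''"
  shows "simulates P M pc s (n + n') pc'' s''"
  unfolding simulates_def
proof (intro allI impI)
  fix m assume "encodes s m \<and> words_within M m"
  then obtain t m' where first: "reaches P M (pc, m) t (pc', m')" "t \<le> n" "encodes s' m'" "words_within M m'"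
    using assms(1) unfolding simulates_def by blast
  then obtain t' m'' where second: "reaches P M (pc', m') t' (pc'', m'')" "t' \<le> n'" "encodes s'' m''"
    "words_within M m''"
    using assms(2) unfolding simulates_def by blast
  have "t + t' \<le> n + n'" using first(2) second(2) by linarith
  then show "\<exists>t m''. reaches P M (pc, m) t (pc'', m'') \<and> t \<le> n + n' \<and> encodes s'' m'' \<and> words_within M m''"
    using reaches_trans[OF first(1) second(1)] second(3,4) by blast
qed

lemma simulates_weaken: "simulates P M pc s n pc' s' \<Longrightarrow> n \<le> n' \<Longrightarrow> simulates P M pc s n' pc' s'"
  unfolding simulates_def using order_trans by blast

lemma simulates_straight_line:
  assumes "\<And>m. \<lbrakk>encodes s m; words_within M m\<rbrakk> \<Longrightarrow> \<exists>m'. straight_line M is m m' \<and> encodes s' m'" "code_at P pc is"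
  shows "simulates P M pc s (length is) (pc + length is) s'"
  unfolding simulates_def
proof (intro allI impI)
  fix m assume memory: "encodes s m \<and> words_within M m"
  then obtain m' where execution: "straight_line M is m m'" "encodes s' m'" using assms(1) by blast
  show "\<exists>t m'. reaches P M (pc, m) t (pc + length is, m') \<and> t \<le> length is \<and> encodes s' m' \<and> words_within M m'"
    using straight_line_reaches[OF execution(1) _ assms(2)] straight_line_words_within[OF execution(1)] memory
        execution(2) by blast
qed

lemma simulates_jump: "code_at P pc [Jmp l] \<Longrightarrow> simulates P M pc s 1 l s"
  unfolding simulates_def by (auto intro!: exI[of _ 1] reaches_step)

lemma simulates_test:
  assumes within: "within_limits s" and fits: "exp_fits first_temp (e \<ominus> e')" and safe: "safe e s" "safe e' s"
    and limit: "B ^ (exp_weight e + exp_weight e' + 3) \<le> M"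
    and code: "code_at P pc (compile_exp first_temp (e \<ominus> e') @ [Jneg first_temp l])"
  shows "simulates P M pc s (length (compile_exp first_temp (e \<ominus> e')) + 1)
    (if aval e s < aval e' s then l else pc + length (compile_exp first_temp (e \<ominus> e')) + 1) s"
  unfolding simulates_def
proof (intro allI impI)
  fix m assume memory: "encodes s m \<and> words_within M m"
  let ?test = "compile_exp first_temp (e \<ominus> e')"
  let ?target = "if aval e s < aval e' s then l else pc + length ?test + 1"
  have test_limit: "B ^ (exp_weight (e \<ominus> e') + 3) \<le> M" using limit by simp
  obtain m1 where computed: "computes M ?test first_temp (aval e s - aval e' s) m m1"
    using compile_exp_correct[OF within fits _ _ _ test_limit] memory safe by auto
  have "reaches P M (pc, m) (length ?test) (pc + length ?test, m1)"
    using straight_line_reaches[of M ?test m m1 P pc] computed memory code unfolding computes_def code_at_append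
    by blast
  moreover have "reaches P M (pc + length ?test, m1) 1 (?target, m1)"
    using computed code by (intro reaches_step) (auto simp: computes_def code_at_append simp del: compile_exp.simps)
  ultimately have "reaches P M (pc, m) (length ?test + 1) (?target, m1)" by (rule reaches_trans)
  moreover have "encodes s m1" using encodes_agree_outside_temps[of s m first_temp m1] memory computed
    by (simp add: computes_def)
  ultimately show "\<exists>t m'. reaches P M (pc, m) t (?target, m') \<and> t \<le> length ?test + 1 \<and> encodes s m' \<and>
      words_within M m'"
    using computed unfolding computes_def by blast
qed

lemma simulates_while_exit:
  assumes within: "within_limits s" and fits: "com_fits (While e e' c)" and safe: "safe e s" "safe e' s"
    and guard: "\<not> aval e s < aval e' s" and code: "code_at P pc (compile_com pc (While e e' c))"
    and limit: "B ^ (com_weight (While e e' c) + 3) \<le> M"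
  shows "simulates P M pc s (length (compile_com pc (While e e' c))) (pc + length (compile_com pc (While e e' c))) s"
proof -
  let ?test = "compile_exp first_temp (e \<ominus> e')"
  let ?start = "pc + length ?test + 2" and ?end = "pc + length (compile_com pc (While e e' c))"
  have code: "code_at P pc (?test @ [Jneg first_temp ?start])" "code_at P (pc + length ?test + 1) [Jmp ?end]"
    using code by (simp_all add: Let_def code_at_append del: compile_exp.simps)
  have weight: "B ^ (exp_weight e + exp_weight e' + 3) \<le> M" by (rule B_power_le[OF limit]) simp
  have "simulates P M pc s (length ?test + 1) (pc + length ?test + 1) s"
    using simulates_test[OF within _ safe weight code(1)] guard fits by simp
  from simulates_trans[OF this simulates_jump[OF code(2)]] show ?thesis
    by (rule simulates_weaken) (simp add: Let_def del: compile_exp.simps)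
qed

lemma simulates_while_iteration:
  assumes within: "within_limits s" and fits: "com_fits (While e e' c)" and safe: "safe e s" "safe e' s"
    and guard: "aval e s < aval e' s" and code: "code_at P pc (compile_com pc (While e e' c))"
    and limit: "B ^ (com_weight (While e e' c) + 3) \<le> M"
    and body: "\<And>start. \<lbrakk>code_at P start (compile_com start c); length (compile_com start c) \<le> K\<rbrakk> \<Longrightarrow>
      simulates P M start s n (start + length (compile_com start c)) s'"
    and rest: "simulates P M pc s' n' (pc + length (compile_com pc (While e e' c))) s''"
    and length: "length (compile_com pc (While e e' c)) \<le> K"
  shows "simulates P M pc s (K + n + n') (pc + length (compile_com pc (While e e' c))) s''"
proof -
  let ?test = "compile_exp first_temp (e \<ominus> e')"
  let ?start = "pc + length ?test + 2" let ?body = "compile_com ?start c"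
  have code: "code_at P pc (?test @ [Jneg first_temp ?start])" "code_at P ?start ?body"
    "code_at P (?start + length ?body) [Jmp pc]"
    using code by (simp_all add: Let_def code_at_append del: compile_exp.simps)
  have weight: "B ^ (exp_weight e + exp_weight e' + 3) \<le> M" by (rule B_power_le[OF limit]) simp
  have test: "simulates P M pc s (length ?test + 1) ?start s"
    using simulates_test[OF within _ safe weight code(1)] guard fits by simp
  have "length ?test + length ?body + 3 \<le> K" using length by (simp add: Let_def del: compile_exp.simps)
  then have "length ?body \<le> K" "length ?test + 1 + n + 1 + n' \<le> K + n + n'" by linarith+
  from simulates_trans[OF simulates_trans[OF simulates_trans[OF test body[OF code(2) \<open>length ?body \<le> K\<close>]]
      simulates_jump[OF code(3)]] rest]
  show ?thesis by (rule simulates_weaken) (use \<open>length ?test + 1 + n + 1 + n' \<le> K + n + n'\<close> in simp)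
qed

theorem compile_com_correct:
  "\<lbrakk>big_step c s t s'; within_limits s; com_fits c; code_at P pc (compile_com pc c); B ^ (com_weight c + 3) \<le> M;
    length (compile_com pc c) \<le> K\<rbrakk> \<Longrightarrow> simulates P M pc s (K * t) (pc + length (compile_com pc c)) s'"
proof (induction arbitrary: pc rule: big_step.induct)
  case (Assign e v a x)
  have "simulates P M pc (v, a) (length (compile_com pc (x ::= e))) (pc + length (compile_com pc (x ::= e)))
    (v(x := aval e (v, a)), a)"
    using compile_assign_correct[of v a e _ M pc x] Assign by (intro simulates_straight_line) auto
  then show ?case by (rule simulates_weaken) (use Assign.prems(5) in linarith)
next
  case (Put i v a e k)
  have "simulates P M pc (v, a) (length (compile_com pc (Put k i e))) (pc + length (compile_com pc (Put k i e)))
    (v, a(k := (a k)(nat (aval i (v, a)) := aval e (v, a))))"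
    using compile_put_correct[of v a i e k _ M pc] Put by (intro simulates_straight_line) auto
  then show ?case by (rule simulates_weaken) (use Put.prems(5) in linarith)
next
  case (Seq c s t s' c' t' s'')
  let ?mid = "pc + length (compile_com pc c)"
  have weights: "B ^ (com_weight c + 3) \<le> M" "B ^ (com_weight c' + 3) \<le> M"
    by (rule B_power_le[OF Seq.prems(4)]; simp)+
  have "simulates P M pc s (K * t) ?mid s'"
    using Seq.IH(1)[OF Seq.prems(1) _ _ weights(1)] Seq.prems by (auto simp: Let_def code_at_append)
  moreover have "simulates P M ?mid s' (K * t') (?mid + length (compile_com ?mid c')) s''"
    using Seq.IH(2)[OF big_step_within_limits[OF Seq.hyps(1) Seq.prems(1)] _ _ weights(2)] Seq.prems
    by (auto simp: Let_def code_at_append)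
  ultimately show ?case using simulates_trans by (fastforce simp: Let_def distrib_left add.assoc)
next
  case (While_False e s e' c)
  have "simulates P M pc s (length (compile_com pc (While e e' c))) (pc + length (compile_com pc (While e e' c))) s"
    using While_False.prems While_False.hyps by (intro simulates_while_exit)
  then show ?case by (rule simulates_weaken) (use While_False.prems(5) in linarith)
next
  case (While_True e s e' c t s' t' s'')
  let ?end = "pc + length (compile_com pc (While e e' c))"
  have weight: "B ^ (com_weight c + 3) \<le> M" by (rule B_power_le[OF While_True.prems(4)]) simp
  have body: "simulates P M start s (K * t) (start + length (compile_com start c)) s'"
    if "code_at P start (compile_com start c)" "length (compile_com start c) \<le> K" for start
    by (rule While_True.IH(1)[OF While_True.prems(1) _ that(1) weight that(2)]) (use While_True.prems(2) in simp)
  have rest: "simulates P M pc s' (K * t') ?end s''"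
    by (rule While_True.IH(2)[OF big_step_within_limits[OF While_True.hyps(4) While_True.prems(1)]
        While_True.prems(2-5)])
  from simulates_while_iteration[OF While_True.prems(1,2) While_True.hyps(1-3) While_True.prems(3,4) body rest
      While_True.prems(5)]
  show ?case by (simp only: mult_Suc_right distrib_left add.assoc)
qed

end

section \<open>The convolution program\<close>

subsection \<open>Complex expressions\<close>

type_synonym complex_exp = "exp \<times> exp"

definition complex_arr :: "(arr \<Rightarrow> nat \<Rightarrow> int) \<Rightarrow> arr \<Rightarrow> arr \<Rightarrow> nat \<Rightarrow> int \<times> int" where
  "complex_arr a x y i = (a x i, a y i)"

definition complex_aval :: "complex_exp \<Rightarrow> state \<Rightarrow> int \<times> int" where
  "complex_aval z s = (aval (fst z) s, aval (snd z) s)"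

definition complex_get :: "arr \<Rightarrow> arr \<Rightarrow> exp \<Rightarrow> complex_exp" where
  "complex_get x y e = (Get x e, Get y e)"

definition complex_plus :: "complex_exp \<Rightarrow> complex_exp \<Rightarrow> complex_exp" where
  "complex_plus z w = (fst z \<oplus> fst w, snd z \<oplus> snd w)"

definition complex_minus :: "complex_exp \<Rightarrow> complex_exp \<Rightarrow> complex_exp" where
  "complex_minus z w = (fst z \<ominus> fst w, snd z \<ominus> snd w)"

definition complex_times :: "complex_exp \<Rightarrow> complex_exp \<Rightarrow> complex_exp" where
  "complex_times z w = ((fst z \<otimes> fst w \<ominus> snd z \<otimes> snd w) \<oslash> V Scale, (fst z \<otimes> snd w \<oplus> snd z \<otimes> fst w) \<oslash> V Scale)"

definition complex_cnj :: "complex_exp \<Rightarrow> complex_exp" where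
  "complex_cnj z = (fst z, N 0 \<ominus> snd z)"

definition complex_if :: "exp \<Rightarrow> complex_exp \<Rightarrow> complex_exp \<Rightarrow> complex_exp" where
  "complex_if e z w = (e \<otimes> fst z \<oplus> (N 1 \<ominus> e) \<otimes> fst w, e \<otimes> snd z \<oplus> (N 1 \<ominus> e) \<otimes> snd w)"

lemma complex_aval_simps [simp]:
  "complex_aval (complex_plus z w) s = complex_aval z s + complex_aval w s"
  "complex_aval (complex_minus z w) s = complex_aval z s - complex_aval w s"
  "complex_aval (complex_cnj z) s = fp_cnj (complex_aval z s)"
  "fst s Scale = int S \<Longrightarrow> complex_aval (complex_times z w) s = fp_mult S (complex_aval z s) (complex_aval w s)"
  by (simp_all add: complex_aval_def complex_plus_def complex_minus_def complex_cnj_def complex_times_def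
      fp_cnj_def fp_mult_def)

lemma complex_aval_get: "aval e s = int i \<Longrightarrow> complex_aval (complex_get x y e) s = complex_arr (snd s) x y i"
  by (simp add: complex_aval_def complex_get_def complex_arr_def)

lemma complex_aval_if:
  "aval e s = of_bool b \<Longrightarrow> complex_aval (complex_if e z w) s = (if b then complex_aval z s else complex_aval w s)"
  by (simp add: complex_aval_def complex_if_def)

context limits
begin

definition complex_safe :: "complex_exp \<Rightarrow> state \<Rightarrow> bool" where
  "complex_safe z s \<longleftrightarrow> safe (fst z) s \<and> safe (snd z) s"

lemma complex_safe_simps [simp]:
  "complex_safe (complex_plus z w) s \<longleftrightarrow> complex_safe z s \<and> complex_safe w s"
  "complex_safe (complex_minus z w) s \<longleftrightarrow> complex_safe z s \<and> complex_safe w s"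
  "complex_safe (complex_times z w) s \<longleftrightarrow> complex_safe z s \<and> complex_safe w s"
  "complex_safe (complex_cnj z) s \<longleftrightarrow> complex_safe z s"
  "complex_safe (complex_if e z w) s \<longleftrightarrow> safe e s \<and> complex_safe z s \<and> complex_safe w s"
  by (auto simp: complex_safe_def complex_plus_def complex_minus_def complex_times_def complex_cnj_def complex_if_def)

lemma complex_safe_get:
  "\<lbrakk>safe e s; aval e s = int i; x \<noteq> IO; y \<noteq> IO\<rbrakk> \<Longrightarrow> complex_safe (complex_get x y e) s"
  by (simp add: complex_safe_def complex_get_def)

end

definition update_pair :: "arr \<Rightarrow> arr \<Rightarrow> complex_exp \<Rightarrow> com" where
  "update_pair x y z = fill BufRe (N 0) (fst z) (V Len) ;; fill BufIm (N 0) (snd z) (V Len) ;;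
     fill x (N 0) (Get BufRe (V Idx)) (V Len) ;; fill y (N 0) (Get BufIm (V Idx)) (V Len)"

lemma assigned_update_pair [simp]:
  "assigned_vars (update_pair x y z) = {Idx}" "assigned_arrs (update_pair x y z) = {BufRe, BufIm, x, y}"
  by (auto simp: update_pair_def)

lemma (in limits) completes_update_pair:
  assumes arrays: "x \<noteq> y" "x \<notin> {BufRe, BufIm, IO}" "y \<notin> {BufRe, BufIm, IO}" and Len: "v Len = int n" "int n \<le> B"
    and z_value: "\<And>i a'. \<lbrakk>i < n; \<And>k. k \<notin> {BufRe, BufIm} \<Longrightarrow> a' k = a k\<rbrakk> \<Longrightarrow>
      complex_safe z (v(Idx := int i), a') \<and> complex_aval z (v(Idx := int i), a') = f i"
    and f_bound: "\<And>i. i < n \<Longrightarrow> \<bar>fst (f i)\<bar> \<le> B \<and> \<bar>snd (f i)\<bar> \<le> B"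
  shows "\<exists>a'. completes (update_pair x y z) (v, a) (12 * n + 8) (v(Idx := int n), a') \<and>
    (\<forall>i<n. complex_arr a' x y i = f i)"
proof -
  define w where "w = v(Idx := int n)"
  have w_vals: "w Len = int n" "w(Idx := i) = v(Idx := i)" for i using Len by (simp_all add: w_def)
  have w_Idx: "w(Idx := int n) = w" by (simp add: w_def)
  define a1 where "a1 = a(BufRe := overwrite 0 n (\<lambda>i. fst (f i)) (a BufRe))"
  define a2 where "a2 = a1(BufIm := overwrite 0 n (\<lambda>i. snd (f i)) (a1 BufIm))"
  define a3 where "a3 = a2(x := overwrite 0 n (\<lambda>i. fst (f i)) (a2 x))"
  define a4 where "a4 = a3(y := overwrite 0 n (\<lambda>i. snd (f i)) (a3 y))"
  have eval_real: "safe (fst z) (v(Idx := int i), a(BufRe := g))"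
      "aval (fst z) (v(Idx := int i), a(BufRe := g)) = fst (f i)" if "i < n" for i g
    using z_value[OF that, of "a(BufRe := g)"] by (auto simp: complex_safe_def complex_aval_def prod_eq_iff)
  have eval_imaginary: "safe (snd z) (v(Idx := int i), a1(BufIm := g))"
      "aval (snd z) (v(Idx := int i), a1(BufIm := g)) = snd (f i)" if "i < n" for i g
    using z_value[OF that, of "a1(BufIm := g)"] by (auto simp: complex_safe_def complex_aval_def prod_eq_iff a1_def)
  have real_parts: "completes (fill BufRe (N 0) (fst z) (V Len)) (v, a) (3 * n + 2) (w, a1)"
    unfolding a1_def w_def by (rule completes_fill) (use Len f_bound eval_real in auto)
  have imaginary_parts: "completes (fill BufIm (N 0) (snd z) (V Len)) (w, a1) (3 * n + 2) (w(Idx := int n), a2)"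
    unfolding a2_def
    by (rule completes_fill) (use Len f_bound w_vals eval_imaginary in auto)
  have copy_real: "completes (fill x (N 0) (Get BufRe (V Idx)) (V Len)) (w, a2) (3 * n + 2) (w(Idx := int n), a3)"
    unfolding a3_def
    by (rule completes_fill) (use Len f_bound w_vals arrays in \<open>auto simp: a1_def a2_def\<close>)
  have copy_imaginary: "completes (fill y (N 0) (Get BufIm (V Idx)) (V Len)) (w, a3) (3 * n + 2) (w(Idx := int n), a4)"
    unfolding a4_def
    by (rule completes_fill) (use Len f_bound w_vals arrays in \<open>auto simp: a2_def a3_def\<close>)
  have "completes (update_pair x y z) (v, a) (12 * n + 8) (w, a4)"
    using completes_seq[OF real_parts completes_seq[OF imaginary_parts[unfolded w_Idx]
        completes_seq[OF copy_real[unfolded w_Idx] copy_imaginary[unfolded w_Idx]]]]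
    unfolding update_pair_def by (rule completes_weaken) simp
  moreover have "\<forall>i<n. complex_arr a4 x y i = f i" using arrays by (simp add: complex_arr_def a3_def a4_def)
  ultimately show ?thesis unfolding w_def by blast
qed

subsection \<open>Forward and inverse transforms\<close>

definition low_exp :: exp where
  "low_exp = V Idx \<oslash> (N 2 \<otimes> V Stride) \<otimes> (N 2 \<otimes> V Stride) \<oplus> V Idx \<odot> V Stride"

definition high_exp :: exp where
  "high_exp = low_exp \<oplus> V Stride"

definition block_exp :: exp where
  "block_exp = V Idx \<oslash> (N 2 \<otimes> V Stride)"

definition odd_exp :: exp where
  "odd_exp = V Idx \<oslash> V Stride \<odot> N 2"

lemma aval_index_exps:
  assumes "fst s Idx = int i" "fst s Stride = int m"
  shows "aval low_exp s = int (butterfly_low m i)" "aval high_exp s = int (butterfly_low m i + m)"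
    "aval block_exp s = int (i div (2 * m))" "aval odd_exp s = of_bool (odd (i div m))"
proof -
  have "int i div int m mod 2 = int (i div m mod 2)" by (simp add: zdiv_int zmod_int)
  also have "\<dots> = of_bool (odd (i div m))" by (simp add: mod_2_eq_odd)
  finally show "aval odd_exp s = of_bool (odd (i div m))" using assms by (simp add: odd_exp_def)
qed (use assms in \<open>simp_all add: low_exp_def high_exp_def block_exp_def butterfly_low_def zdiv_int zmod_int\<close>)

lemma (in limits) safe_index_exps [simp]:
  "safe low_exp s" "safe high_exp s" "safe block_exp s" "safe odd_exp s"
  by (simp_all add: low_exp_def high_exp_def block_exp_def odd_exp_def)

definition forward_exp :: "arr \<Rightarrow> arr \<Rightarrow> complex_exp" where
  "forward_exp x y =
    (let low = complex_get x y low_exp;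
         high = complex_times (complex_get TabRe TabIm block_exp) (complex_get x y high_exp)
     in complex_if odd_exp (complex_minus low high) (complex_plus low high))"

definition inverse_exp :: "arr \<Rightarrow> arr \<Rightarrow> complex_exp" where
  "inverse_exp x y =
    (let low = complex_get x y low_exp; high = complex_get x y high_exp
     in complex_if odd_exp
       (complex_times (complex_minus low high) (complex_cnj (complex_get TabRe TabIm block_exp)))
       (complex_plus low high))"

lemma aval_butterfly_exps:
  assumes "fst s Idx = int i" "fst s Stride = int m" "fst s Scale = int S"
  shows "complex_aval (forward_exp x y) s =
      forward_butterfly S m (complex_arr (snd s) TabRe TabIm) (complex_arr (snd s) x y) i"
    "complex_aval (inverse_exp x y) s =
      inverse_butterfly S m (complex_arr (snd s) TabRe TabIm) (complex_arr (snd s) x y) i"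
  using assms(3) aval_index_exps[OF assms(1,2)]
  by (simp_all add: forward_exp_def inverse_exp_def forward_butterfly_def inverse_butterfly_def Let_def
      complex_aval_if complex_aval_get del: of_nat_add)

lemma (in limits) safe_butterfly_exps:
  assumes "fst s Idx = int i" "fst s Stride = int m" "x \<noteq> IO" "y \<noteq> IO"
  shows "complex_safe (forward_exp x y) s" "complex_safe (inverse_exp x y) s"
  using assms(3,4) aval_index_exps[OF assms(1,2)]
  by (simp_all add: forward_exp_def inverse_exp_def Let_def complex_safe_get del: of_nat_add)

definition forward_pass :: "arr \<Rightarrow> arr \<Rightarrow> com" where
  "forward_pass x y = Stride ::= V Stride \<oslash> N 2 ;; update_pair x y (forward_exp x y)"

definition inverse_pass :: "arr \<Rightarrow> arr \<Rightarrow> com" where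
  "inverse_pass x y = update_pair x y (inverse_exp x y) ;; Stride ::= V Stride \<otimes> N 2"

definition fft :: "arr \<Rightarrow> arr \<Rightarrow> com" where
  "fft x y = Stride ::= V Len ;; While (N 1) (V Stride) (forward_pass x y)"

definition ifft :: "arr \<Rightarrow> arr \<Rightarrow> com" where
  "ifft x y = Stride ::= N 1 ;; While (V Stride) (V Len) (inverse_pass x y)"

lemma assigned_passes [simp]:
  "assigned_vars (forward_pass x y) = {Stride, Idx}" "assigned_arrs (forward_pass x y) = {BufRe, BufIm, x, y}"
  "assigned_vars (inverse_pass x y) = {Stride, Idx}" "assigned_arrs (inverse_pass x y) = {BufRe, BufIm, x, y}"
  by (auto simp: forward_pass_def inverse_pass_def)

lemma assigned_ffts [simp]:
  "assigned_vars (fft x y) = {Stride, Idx}" "assigned_arrs (fft x y) = {BufRe, BufIm, x, y}"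
  "assigned_vars (ifft x y) = {Stride, Idx}" "assigned_arrs (ifft x y) = {BufRe, BufIm, x, y}"
  by (auto simp: fft_def ifft_def)

locale convolution = transform_precision L + limits B io_size
  for L :: nat and B io_size :: int +
  assumes T_power_le_B: "int T ^ 64 \<le> B"
begin

lemma T_power_le_B': "a \<le> 64 \<Longrightarrow> int T ^ a \<le> B"
  using eight_le_T T_power_le_B order_trans[OF power_increasing[of a 64 "int T"]] by simp

lemma T_le_B: "int T \<le> B"
  using T_power_le_B'[of 1] by simp

definition fft_ready :: "nat \<Rightarrow> nat \<Rightarrow> state \<Rightarrow> bool" where
  "fft_ready n h s \<longleftrightarrow> n = 2 ^ h \<and> n \<le> T \<and> fst s Len = int n \<and> fst s Scale = int scale \<and>
     twiddle_table (complex_arr (snd s) TabRe TabIm)"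

lemma fft_ready_unchanged:
  assumes "fft_ready n h s" "unchanged_outside c s s'"
    and "assigned_vars c \<inter> {Len, Scale} = {}" "assigned_arrs c \<inter> {TabRe, TabIm} = {}"
  shows "fft_ready n h s'"
proof -
  have "fst s' Len = fst s Len" "fst s' Scale = fst s Scale"
    "complex_arr (snd s') TabRe TabIm = complex_arr (snd s) TabRe TabIm"
    using assms(2-4) by (auto simp: unchanged_outside_def complex_arr_def fun_eq_iff)
  then show ?thesis using assms(1) by (simp add: fft_ready_def)
qed

lemma completes_update_approximation:
  assumes arrays: "x \<noteq> y" "x \<notin> {BufRe, BufIm, IO}" "y \<notin> {BufRe, BufIm, IO}" and Len: "v Len = int n" "n \<le> T"
    and z_value: "\<And>i a'. \<lbrakk>i < n; \<And>k. k \<notin> {BufRe, BufIm} \<Longrightarrow> a' k = a k\<rbrakk> \<Longrightarrow>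
      complex_safe z (v(Idx := int i), a') \<and> complex_aval z (v(Idx := int i), a') = f i"
    and f_approx: "approximates scale d n f e" "d \<le> 1" and e_bound: "\<And>i. cmod (e i) \<le> real T ^ 3"
  shows "\<exists>a'. completes (update_pair x y z) (v, a) (12 * n + 8) (v(Idx := int n), a') \<and>
    approximates scale d n (complex_arr a' x y) e"
proof -
  have "int n \<le> B" using Len(2) T_le_B by linarith
  moreover have "\<bar>fst (f i)\<bar> \<le> B \<and> \<bar>snd (f i)\<bar> \<le> B" if "i < n" for i
    using approximates_component_bounds[OF f_approx(1) e_bound f_approx(2) that] T_power_le_B'[of 36] by auto
  ultimately obtain a' where update: "completes (update_pair x y z) (v, a) (12 * n + 8) (v(Idx := int n), a')"
    "\<forall>i<n. complex_arr a' x y i = f i"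
    using completes_update_pair[where f = f, OF arrays Len(1) _ z_value] by blast
  moreover have "approximates scale d n (complex_arr a' x y) e"
    by (rule approximates_cong[OF f_approx(1)]) (use update(2) in simp)
  ultimately show ?thesis by blast
qed

lemma completes_forward_pass:
  assumes arrays: "x \<noteq> y" "x \<notin> {BufRe, BufIm, IO, TabRe, TabIm}" "y \<notin> {BufRe, BufIm, IO, TabRe, TabIm}"
    and ready: "fft_ready n h (v, a)" and Stride: "v Stride = int (2 * m)" "2 * m * 2 ^ l = n"
    and c_bound: "\<And>i. cmod (c i) \<le> 1"
    and z_approx: "approximates scale (forward_error l) n (complex_arr a x y) (transform c (2 * m) (2 ^ l))"
  shows "\<exists>v' a'. completes (forward_pass x y) (v, a) (12 * n + 9) (v', a') \<and> v' Stride = int m \<and>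
    approximates scale (forward_error (Suc l)) n (complex_arr a' x y) (transform c m (2 ^ Suc l))"
proof -
  let ?f = "forward_butterfly scale m (complex_arr a TabRe TabIm) (complex_arr a x y)"
  have n_power: "n = 2 ^ h" "n \<le> T" and vals: "v Len = int n" "v Scale = int scale"
    and table: "twiddle_table (complex_arr a TabRe TabIm)" using ready by (auto simp: fft_ready_def)
  have approx: "approximates scale (forward_error (Suc l)) n ?f (transform c m (2 ^ Suc l))"
    using forward_level[OF table n_power refl Stride(2) c_bound z_approx] by simp
  have "0 < m" using Stride(2) n_power(1) by (auto intro: Nat.gr0I)
  then have "2 ^ Suc l \<le> n" unfolding Stride(2)[symmetric] by simp
  then have level_le_T: "2 ^ Suc l \<le> T" using n_power(2) by linarith
  have "cmod (transform c m (2 ^ Suc l) i) \<le> real T ^ 3" for i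
  proof -
    have "cmod (transform c m (2 ^ Suc l) i) \<le> real (2 ^ Suc l) * 1" by (rule norm_transform_le[OF c_bound])
    also have "\<dots> \<le> real T ^ 1" using level_le_T by (simp only: mult_1_right power_one_right of_nat_le_iff)
    also have "\<dots> \<le> real T ^ 3" using eight_le_T by (intro power_increasing) auto
    finally show ?thesis .
  qed
  moreover have "forward_error (Suc l) \<le> 1" using forward_error_le[OF level_le_T] \<tau>_power_le[of 9] by simp
  moreover have "complex_safe (forward_exp x y) (v(Stride := int m, Idx := int i), a') \<and>
      complex_aval (forward_exp x y) (v(Stride := int m, Idx := int i), a') = ?f i"
    if "\<And>k. k \<notin> {BufRe, BufIm} \<Longrightarrow> a' k = a k" for i a'
  proof -
    have "complex_arr a' x y = complex_arr a x y" "complex_arr a' TabRe TabIm = complex_arr a TabRe TabIm"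
      using that arrays by (auto simp: complex_arr_def fun_eq_iff)
    then show ?thesis using aval_butterfly_exps(1) safe_butterfly_exps(1) arrays vals by simp
  qed
  ultimately obtain a' where update:
    "completes (update_pair x y (forward_exp x y)) (v(Stride := int m), a) (12 * n + 8) (v(Stride := int m, Idx := int n), a')"
    "approximates scale (forward_error (Suc l)) n (complex_arr a' x y) (transform c m (2 ^ Suc l))"
    using completes_update_approximation[OF arrays(1) _ _ _ n_power(2) _ approx,
        of "v(Stride := int m)" a "forward_exp x y"] arrays vals
    by auto
  have "m \<le> n" unfolding Stride(2)[symmetric] by simp
  then have "completes (Stride ::= V Stride \<oslash> N 2) (v, a) 1 (v(Stride := int m), a)"
    by (intro completes_assign) (use Stride(1) n_power(2) T_le_B in auto)
  from completes_seq[OF this update(1)] have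
    "completes (forward_pass x y) (v, a) (12 * n + 9) (v(Stride := int m, Idx := int n), a')"
    unfolding forward_pass_def by (rule completes_weaken) simp
  then show ?thesis using update(2) by fastforce
qed

lemma two_power_diff: "l < h \<Longrightarrow> 2 ^ (h - l) = 2 * (2::nat) ^ (h - Suc l)"
  by (simp flip: power_Suc add: Suc_diff_Suc)

lemma two_power_split: "l < h \<Longrightarrow> 2 * 2 ^ l * 2 ^ (h - Suc l) = (2::nat) ^ h"
  by (simp flip: power_Suc power_add)

lemma sum_passes_le: "(\<Sum>i<h. 12 * 2 ^ k + 9 + 1) + 1 \<le> 22 * 2 ^ k * h + (1::nat)"
proof -
  have "h * (12 * 2 ^ k + 9 + 1) \<le> h * (22 * 2 ^ k)" by (intro mult_le_mono2) simp
  then show ?thesis by (simp add: mult.commute)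
qed

lemma completes_fft:
  assumes arrays: "x \<noteq> y" "x \<notin> {BufRe, BufIm, IO, TabRe, TabIm}" "y \<notin> {BufRe, BufIm, IO, TabRe, TabIm}"
    and ready: "fft_ready n h (v, a)" and c_bound: "\<And>i. cmod (c i) \<le> 1"
    and z_approx: "approximates scale 0 n (complex_arr a x y) c"
  shows "\<exists>v' a'. completes (fft x y) (v, a) (22 * n * h + 2) (v', a') \<and>
    approximates scale (forward_error h) n (complex_arr a' x y) (transform c 1 n)"
proof -
  have n_power: "n = 2 ^ h" "n \<le> T" and Len: "v Len = int n" using ready by (auto simp: fft_ready_def)
  let ?v = "v(Stride := int n)"
  have start: "completes (Stride ::= V Len) (v, a) 1 (?v, a)"
    by (rule completes_assign) (use Len n_power(2) T_le_B in auto)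
  define Inv where "Inv = (\<lambda>l s. fst s Stride = int (2 ^ (h - l)) \<and>
     approximates scale (forward_error l) n (complex_arr (snd s) x y) (transform c (2 ^ (h - l)) (2 ^ l)))"
  have "\<exists>s'. completes (While (N 1) (V Stride) (forward_pass x y)) (?v, a) ((\<Sum>i<h. 12 * n + 9 + 1) + 1) s' \<and> Inv h s'"
  proof (rule completes_while)
    show "Inv 0 (?v, a)" using z_approx transform_one_block[of _ n c]
      by (simp add: Inv_def n_power(1) approximates_def forward_error_def)
  next
    fix l s' assume l_less: "l < h" and invariant: "Inv l s'"
      and unchanged: "unchanged_outside (forward_pass x y) (?v, a) s'"
    obtain v' a' where state: "s' = (v', a')" by (cases s')
    have "2 * 2 ^ (h - Suc l) * 2 ^ l = n" using two_power_split[OF l_less] by (simp add: n_power(1) mult_ac)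
    moreover have "fft_ready n h (v', a')"
      using fft_ready_unchanged[OF _ unchanged] ready arrays by (auto simp: fft_ready_def state)
    ultimately have "\<exists>v'' a''. completes (forward_pass x y) (v', a') (12 * n + 9) (v'', a'') \<and> Inv (Suc l) (v'', a'')"
      using completes_forward_pass[OF arrays, of n h v' a' "2 ^ (h - Suc l)" l c] c_bound invariant
      unfolding Inv_def state two_power_diff[OF l_less] by simp
    moreover have "1 < v' Stride" using invariant one_less_power[of "2::int" "h - l"] l_less
      by (simp add: Inv_def state)
    ultimately show "safe (N 1) s' \<and> safe (V Stride) s' \<and> aval (N 1) s' < aval (V Stride) s' \<and>
        (\<exists>s''. completes (forward_pass x y) s' (12 * n + 9) s'' \<and> Inv (Suc l) s'')"
      unfolding state by auto
  qed (simp add: Inv_def)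
  then obtain v' a' where loop:
    "completes (While (N 1) (V Stride) (forward_pass x y)) (?v, a) ((\<Sum>i<h. 12 * n + 9 + 1) + 1) (v', a')"
      "Inv h (v', a')"
    by auto
  have "completes (fft x y) (v, a) (22 * n * h + 2) (v', a')"
    using completes_seq[OF start loop(1)] sum_passes_le[of h h] unfolding fft_def n_power(1)
    by (elim completes_weaken) simp
  then show ?thesis using loop(2) by (auto simp: Inv_def n_power(1))
qed

lemma completes_inverse_pass:
  assumes arrays: "x \<noteq> y" "x \<notin> {BufRe, BufIm, IO, TabRe, TabIm}" "y \<notin> {BufRe, BufIm, IO, TabRe, TabIm}"
    and ready: "fft_ready n h (v, a)" and Stride: "v Stride = int m" "m = 2 ^ l" "2 * m * q = n"
    and c_bound: "\<And>i. cmod (c i) \<le> (real n)\<^sup>2"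
    and z_approx: "approximates scale (inverse_error l) n (complex_arr a x y) (\<lambda>i. of_nat m * transform c m (2 * q) i)"
  shows "\<exists>v' a'. completes (inverse_pass x y) (v, a) (12 * n + 9) (v', a') \<and> v' Stride = int (2 * m) \<and>
    approximates scale (inverse_error (Suc l)) n (complex_arr a' x y) (\<lambda>i. of_nat (2 * m) * transform c (2 * m) q i)"
proof -
  let ?f = "inverse_butterfly scale m (complex_arr a TabRe TabIm) (complex_arr a x y)"
  have n_power: "n = 2 ^ h" "n \<le> T" and vals: "v Len = int n" "v Scale = int scale"
    and table: "twiddle_table (complex_arr a TabRe TabIm)" using ready by (auto simp: fft_ready_def)
  have approx: "approximates scale (inverse_error (Suc l)) n ?f (\<lambda>i. of_nat (2 * m) * transform c (2 * m) q i)"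
    by (rule inverse_level[OF table n_power Stride(2,3) c_bound z_approx])
  have "0 < q" using Stride(3) n_power(1) by (auto intro: Nat.gr0I)
  then have m_le: "2 * m \<le> n" unfolding Stride(3)[symmetric] by simp
  have bound: "cmod (of_nat (2 * m) * transform c (2 * m) q i) \<le> real T ^ 3" for i
  proof -
    have "cmod (of_nat (2 * m) * transform c (2 * m) q i) \<le> real (2 * m) * (real q * (real n)\<^sup>2)"
      using norm_transform_le[OF c_bound] by (simp add: norm_mult mult_left_mono)
    also have "\<dots> = real (2 * m * q) * (real n)\<^sup>2" by simp
    also have "\<dots> = real n ^ 3" by (simp only: Stride(3) power2_eq_square power3_eq_cube)
    also have "\<dots> \<le> real T ^ 3" using n_power(2) by (intro power_mono) auto
    finally show ?thesis .
  qed
  have "inverse_error (Suc l) \<le> 1" using inverse_error_le[of "Suc l"] m_le Stride(2) n_power(2) by simp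
  moreover have "complex_safe (inverse_exp x y) (v(Idx := int i), a') \<and>
      complex_aval (inverse_exp x y) (v(Idx := int i), a') = ?f i"
    if "\<And>k. k \<notin> {BufRe, BufIm} \<Longrightarrow> a' k = a k" for i a'
  proof -
    have "complex_arr a' x y = complex_arr a x y" "complex_arr a' TabRe TabIm = complex_arr a TabRe TabIm"
      using that arrays by (auto simp: complex_arr_def fun_eq_iff)
    then show ?thesis using aval_butterfly_exps(2) safe_butterfly_exps(2) arrays vals Stride(1) by simp
  qed
  ultimately have "\<exists>a'. completes (update_pair x y (inverse_exp x y)) (v, a) (12 * n + 8) (v(Idx := int n), a') \<and>
    approximates scale (inverse_error (Suc l)) n (complex_arr a' x y) (\<lambda>i. of_nat (2 * m) * transform c (2 * m) q i)"
    using arrays vals(1) n_power(2) bound by (intro completes_update_approximation[where f = ?f] approx) auto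
  then obtain a' where update:
    "completes (update_pair x y (inverse_exp x y)) (v, a) (12 * n + 8) (v(Idx := int n), a')"
    "approximates scale (inverse_error (Suc l)) n (complex_arr a' x y) (\<lambda>i. of_nat (2 * m) * transform c (2 * m) q i)"
    by blast
  have "completes (Stride ::= V Stride \<otimes> N 2) (v(Idx := int n), a') 1 (v(Idx := int n, Stride := int (2 * m)), a')"
    by (rule completes_assign) (use Stride(1) m_le n_power(2) T_le_B in auto)
  from completes_seq[OF update(1) this] have
    "completes (inverse_pass x y) (v, a) (12 * n + 9) (v(Idx := int n, Stride := int (2 * m)), a')"
    unfolding inverse_pass_def by (rule completes_weaken) simp
  then show ?thesis using update(2) by fastforce
qed

lemma completes_ifft:
  assumes arrays: "x \<noteq> y" "x \<notin> {BufRe, BufIm, IO, TabRe, TabIm}" "y \<notin> {BufRe, BufIm, IO, TabRe, TabIm}"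
    and ready: "fft_ready n h (v, a)" and c_bound: "\<And>i. cmod (c i) \<le> (real n)\<^sup>2"
    and z_approx: "approximates scale (inverse_error 0) n (complex_arr a x y) (transform c 1 n)"
  shows "\<exists>v' a'. completes (ifft x y) (v, a) (22 * n * h + 2) (v', a') \<and>
    approximates scale (inverse_error h) n (complex_arr a' x y) (\<lambda>i. of_nat n * c i)"
proof -
  have n_power: "n = 2 ^ h" "n \<le> T" and Len: "v Len = int n" using ready by (auto simp: fft_ready_def)
  let ?v = "v(Stride := 1)"
  have start: "completes (Stride ::= N 1) (v, a) 1 (?v, a)"
    by (rule completes_assign) (use sixty_four_le_B in auto)
  define Inv where "Inv = (\<lambda>l s. fst s Stride = int (2 ^ l) \<and>
     approximates scale (inverse_error l) n (complex_arr (snd s) x y) (\<lambda>i. of_nat (2 ^ l) * transform c (2 ^ l) (2 ^ (h - l)) i))"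
  have "\<exists>s'. completes (While (V Stride) (V Len) (inverse_pass x y)) (?v, a) ((\<Sum>i<h. 12 * n + 9 + 1) + 1) s' \<and>
      Inv h s'"
  proof (rule completes_while)
    show "Inv 0 (?v, a)" using z_approx by (simp add: Inv_def n_power(1))
  next
    fix l s' assume l_less: "l < h" and invariant: "Inv l s'"
      and unchanged: "unchanged_outside (inverse_pass x y) (?v, a) s'"
    obtain v' a' where state: "s' = (v', a')" by (cases s')
    have blocks: "2 * 2 ^ l * 2 ^ (h - Suc l) = n" using two_power_split[OF l_less] by (simp add: n_power(1))
    have "fft_ready n h (v', a')"
      using fft_ready_unchanged[OF _ unchanged] ready arrays by (auto simp: fft_ready_def state)
    then have "\<exists>v'' a''. completes (inverse_pass x y) (v', a') (12 * n + 9) (v'', a'') \<and> Inv (Suc l) (v'', a'')"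
      using completes_inverse_pass[OF arrays, of n h v' a' "2 ^ l" l "2 ^ (h - Suc l)" c] c_bound invariant blocks
      unfolding Inv_def state two_power_diff[OF l_less] by simp
    moreover have "v' Stride = int (2 ^ l)" "v' Len = int n"
      using invariant unchanged Len by (simp_all add: Inv_def state unchanged_outside_def)
    moreover have "(2::nat) ^ l < n" using l_less by (simp add: n_power(1))
    ultimately show "safe (V Stride) s' \<and> safe (V Len) s' \<and> aval (V Stride) s' < aval (V Len) s' \<and>
        (\<exists>s''. completes (inverse_pass x y) s' (12 * n + 9) s'' \<and> Inv (Suc l) s'')"
      unfolding state by auto
  next
    fix s' assume "Inv h s'" "unchanged_outside (inverse_pass x y) (?v, a) s'"
    then show "safe (V Stride) s' \<and> safe (V Len) s' \<and> \<not> aval (V Stride) s' < aval (V Len) s'"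
      using Len by (simp add: Inv_def n_power(1) unchanged_outside_def)
  qed
  then obtain v' a' where loop:
    "completes (While (V Stride) (V Len) (inverse_pass x y)) (?v, a) ((\<Sum>i<h. 12 * n + 9 + 1) + 1) (v', a')"
      "Inv h (v', a')"
    by auto
  have "completes (ifft x y) (v, a) (22 * n * h + 2) (v', a')"
    using completes_seq[OF start loop(1)] sum_passes_le[of h h] unfolding ifft_def n_power(1)
    by (elim completes_weaken) simp
  moreover have "approximates scale (inverse_error h) n (complex_arr a' x y) (\<lambda>i. of_nat n * c i)"
    using loop(2) transform_one_block[of _ n c] by (simp add: Inv_def n_power(1) approximates_def)
  ultimately show ?thesis by blast
qed

end

subsection \<open>Convolution of indicator sequences\<close>

definition represents :: "nat \<Rightarrow> (nat \<Rightarrow> int) \<Rightarrow> nat set \<Rightarrow> bool" where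
  "represents n f X \<longleftrightarrow> (\<forall>i<n. f i = of_bool (i \<in> X))"

definition to_fixed_point :: "arr \<Rightarrow> arr \<Rightarrow> com" where
  "to_fixed_point x y = fill x (N 0) (Get x (V Idx) \<otimes> V Scale) (V Len) ;; fill y (N 0) (N 0) (V Len)"

definition round_exp :: "arr \<Rightarrow> exp" where
  "round_exp x = (N 2 \<otimes> Get x (V Idx) \<oplus> V Scale \<otimes> V Len) \<oslash> (N 2 \<otimes> V Scale \<otimes> V Len)"

definition transform_inputs :: com where
  "transform_inputs = to_fixed_point XRe XIm ;; to_fixed_point YRe YIm ;; fft XRe XIm ;; fft YRe YIm"

definition convolve :: com where
  "convolve = transform_inputs ;;
     update_pair XRe XIm (complex_times (complex_get XRe XIm (V Idx)) (complex_get YRe YIm (V Idx))) ;;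
     ifft XRe XIm ;; fill XRe (N 0) (nonzero (round_exp XRe)) (V Len)"

lemma assigned_to_fixed_point [simp]:
  "assigned_vars (to_fixed_point x y) = {Idx}" "assigned_arrs (to_fixed_point x y) = {x, y}"
  by (auto simp: to_fixed_point_def)

lemma assigned_convolve [simp]:
  "assigned_vars transform_inputs = {Idx, Stride}"
  "assigned_arrs transform_inputs = {XRe, XIm, YRe, YIm, BufRe, BufIm}"
  "assigned_vars convolve = {Idx, Stride}" "assigned_arrs convolve = {XRe, XIm, YRe, YIm, BufRe, BufIm}"
  by (auto simp: transform_inputs_def convolve_def)

context convolution
begin

lemma completes_to_fixed_point:
  assumes arrays: "x \<noteq> y" "x \<noteq> IO" "y \<noteq> IO" and ready: "fft_ready n h (v, a)"
    and X_represented: "represents n (a x) X"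
  shows "\<exists>v' a'. completes (to_fixed_point x y) (v, a) (6 * n + 4) (v', a') \<and>
    approximates scale 0 n (complex_arr a' x y) (\<lambda>i. of_bool (i \<in> X))"
proof -
  have vals: "v Len = int n" "v Scale = int scale" and "n \<le> T" using ready by (simp_all add: fft_ready_def)
  then have "int n \<le> B" using T_le_B by linarith
  have "int scale \<le> B" using T_power_le_B'[of 32] by (simp add: scale_def)
  let ?v = "v(Idx := int n)"
  define a1 where "a1 = a(x := overwrite 0 n (\<lambda>i. of_bool (i \<in> X) * int scale) (a x))"
  define a2 where "a2 = a1(y := overwrite 0 n (\<lambda>_. 0) (a1 y))"
  have scaling: "completes (fill x (N 0) (Get x (V Idx) \<otimes> V Scale) (V Len)) (v, a) (3 * n + 2) (?v, a1)"
    unfolding a1_def using vals \<open>int n \<le> B\<close> \<open>int scale \<le> B\<close> arrays X_represented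
    by (intro completes_fill) (auto simp: represents_def)
  have clearing: "completes (fill y (N 0) (N 0) (V Len)) (?v, a1) (3 * n + 2) (?v(Idx := int n), a2)"
    unfolding a2_def using vals \<open>int n \<le> B\<close> arrays by (intro completes_fill) auto
  have "completes (to_fixed_point x y) (v, a) (6 * n + 4) (?v, a2)"
    using completes_seq[OF scaling clearing] unfolding to_fixed_point_def by (auto elim: completes_weaken)
  moreover have "approximates scale 0 n (complex_arr a2 x y) (\<lambda>i. of_bool (i \<in> X))"
    using arrays by (auto simp: approximates_def fp_value_def complex_arr_def a1_def a2_def complex_eq_iff)
  ultimately show ?thesis by blast
qed

lemma completes_product:
  assumes ready: "fft_ready n h (v, a)" and unit_bounds: "\<And>i. cmod (c i) \<le> 1" "\<And>i. cmod (d i) \<le> 1"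
    and conv: "\<And>i. cmod (cyclic_conv n c d i) \<le> (real n)\<^sup>2"
    and x_approx: "approximates scale (forward_error h) n (complex_arr a XRe XIm) (transform c 1 n)"
    and y_approx: "approximates scale (forward_error h) n (complex_arr a YRe YIm) (transform d 1 n)"
  shows "\<exists>v' a'. completes (update_pair XRe XIm (complex_times (complex_get XRe XIm (V Idx)) (complex_get YRe YIm (V Idx))))
      (v, a) (12 * n + 8) (v', a') \<and>
    approximates scale (inverse_error 0) n (complex_arr a' XRe XIm) (transform (cyclic_conv n c d) 1 n)"
proof -
  let ?z = "complex_times (complex_get XRe XIm (V Idx)) (complex_get YRe YIm (V Idx))"
  have n_power: "n = 2 ^ h" "n \<le> T" and vals: "v Len = int n" "v Scale = int scale" using ready
    by (auto simp: fft_ready_def)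
  have z_value: "complex_safe ?z (v(Idx := int i), a') \<and>
      complex_aval ?z (v(Idx := int i), a') = fp_mult scale (complex_arr a XRe XIm i) (complex_arr a YRe YIm i)"
    if "i < n" "\<And>k. k \<notin> {BufRe, BufIm} \<Longrightarrow> a' k = a k" for i a'
    using that vals by (simp add: complex_safe_get[where i = i] complex_aval_get[where i = i] complex_arr_def)
  have bound: "cmod (transform (cyclic_conv n c d) 1 n i) \<le> real T ^ 3" for i
  proof -
    have "cmod (transform (cyclic_conv n c d) 1 n i) \<le> real n * (real n)\<^sup>2" by (rule norm_transform_le[OF conv])
    also have "\<dots> = real n ^ 3" by (simp add: power2_eq_square power3_eq_cube)
    also have "\<dots> \<le> real T ^ 3" using n_power(2) by (intro power_mono) auto
    finally show ?thesis .
  qed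
  have "inverse_error 0 \<le> 1" using inverse_error_le[of 0] eight_le_T by simp
  then have "\<exists>a'. completes (update_pair XRe XIm ?z) (v, a) (12 * n + 8) (v(Idx := int n), a') \<and>
    approximates scale (inverse_error 0) n (complex_arr a' XRe XIm) (transform (cyclic_conv n c d) 1 n)"
    by (intro completes_update_approximation[OF _ _ _ vals(1) n_power(2) z_value pointwise_product_level[OF n_power
        unit_bounds x_approx y_approx] _ bound]) simp_all
  then show ?thesis by blast
qed

lemma completes_round:
  assumes ready: "fft_ready n h (v, a)"
    and x_approx: "approximates scale (inverse_error h) n (complex_arr a XRe XIm) (\<lambda>i. of_nat n * of_int (c i))"
  shows "completes (fill XRe (N 0) (nonzero (round_exp XRe)) (V Len)) (v, a) (3 * n + 2)
    (v(Idx := int n), a(XRe := overwrite 0 n (\<lambda>i. of_bool (c i \<noteq> 0)) (a XRe)))"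
proof (rule completes_fill)
  have n_power: "n = 2 ^ h" "n \<le> T" and vals: "v Len = int n" "v Scale = int scale" using ready
    by (auto simp: fft_ready_def)
  show "int n \<le> B" using n_power(2) T_le_B by linarith
  fix i assume i_less: "i < n"
  let ?s = "(v(Idx := int i), a(XRe := overwrite 0 i (\<lambda>i. of_bool (c i \<noteq> 0)) (a XRe)))"
  let ?d = "fp_value scale (complex_arr a XRe XIm i) - of_nat n * of_int (c i)"
  have "\<bar>Re ?d\<bar> \<le> inverse_error h" using abs_Re_le_cmod[of ?d] approximatesD[OF x_approx i_less] by linarith
  also have "\<dots> \<le> 1 / 4" using inverse_error_le n_power by simp
  finally have "\<bar>real_of_int (a XRe i) / real_of_int (int scale) - real_of_int (int n * c i)\<bar> \<le> 1 / 4"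
    by (simp add: fp_value_def complex_arr_def)
  then have "(2 * a XRe i + int scale * int n) div (2 * int scale * int n) = c i"
    using i_less by (intro round_quotient) auto
  then have "aval (round_exp XRe) ?s = c i" using vals by (simp add: round_exp_def)
  then show "safe (nonzero (round_exp XRe)) ?s \<and> aval (nonzero (round_exp XRe)) ?s = of_bool (c i \<noteq> 0) \<and>
    \<bar>of_bool (c i \<noteq> 0)\<bar> \<le> B" using sixty_four_le_B by (simp add: round_exp_def)
qed (use ready in \<open>auto simp: fft_ready_def\<close>)

lemma completes_transform_inputs:
  assumes ready: "fft_ready n h (v, a)" and X_represented: "represents n (a XRe) X"
    and Y_represented: "represents n (a YRe) Y"
  shows "\<exists>v' a'. completes transform_inputs (v, a) (12 * n + 44 * n * h + 12) (v', a') \<and>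
    approximates scale (forward_error h) n (complex_arr a' XRe XIm) (transform (\<lambda>i. of_bool (i \<in> X)) 1 n) \<and>
    approximates scale (forward_error h) n (complex_arr a' YRe YIm) (transform (\<lambda>i. of_bool (i \<in> Y)) 1 n)"
proof -
  let ?x = "\<lambda>i. of_bool (i \<in> X) :: complex" and ?y = "\<lambda>i. of_bool (i \<in> Y) :: complex"
  have unit: "cmod (?x i) \<le> 1" "cmod (?y i) \<le> 1" for i by simp_all
  obtain v1 a1 where load_X: "completes (to_fixed_point XRe XIm) (v, a) (6 * n + 4) (v1, a1)"
    "approximates scale 0 n (complex_arr a1 XRe XIm) ?x"
    using completes_to_fixed_point[OF _ _ _ ready X_represented] by blast
  have ready1: "fft_ready n h (v1, a1)" using fft_ready_unchanged[OF ready completes_unchanged_outside[OF load_X(1)]]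
    by simp
  have "represents n (a1 YRe) Y" using completes_unchanged_arrs[OF load_X(1), of YRe] Y_represented by simp
  then obtain v2 a2 where load_Y: "completes (to_fixed_point YRe YIm) (v1, a1) (6 * n + 4) (v2, a2)"
    "approximates scale 0 n (complex_arr a2 YRe YIm) ?y"
    using completes_to_fixed_point[OF _ _ _ ready1] by blast
  have ready2: "fft_ready n h (v2, a2)" using fft_ready_unchanged[OF ready1 completes_unchanged_outside[OF load_Y(1)]]
    by simp
  have "approximates scale 0 n (complex_arr a2 XRe XIm) ?x"
    using load_X(2) completes_unchanged_arrs[OF load_Y(1)] by (simp add: approximates_def complex_arr_def)
  then obtain v3 a3 where fft_X: "completes (fft XRe XIm) (v2, a2) (22 * n * h + 2) (v3, a3)"
    "approximates scale (forward_error h) n (complex_arr a3 XRe XIm) (transform ?x 1 n)"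
    using completes_fft[OF _ _ _ ready2 unit(1)] by fastforce
  have ready3: "fft_ready n h (v3, a3)" using fft_ready_unchanged[OF ready2 completes_unchanged_outside[OF fft_X(1)]]
    by simp
  have "approximates scale 0 n (complex_arr a3 YRe YIm) ?y"
    using load_Y(2) completes_unchanged_arrs[OF fft_X(1)] by (simp add: approximates_def complex_arr_def)
  then obtain v4 a4 where fft_Y: "completes (fft YRe YIm) (v3, a3) (22 * n * h + 2) (v4, a4)"
    "approximates scale (forward_error h) n (complex_arr a4 YRe YIm) (transform ?y 1 n)"
    using completes_fft[OF _ _ _ ready3 unit(2)] by fastforce
  have "completes transform_inputs (v, a) (12 * n + 44 * n * h + 12) (v4, a4)" unfolding transform_inputs_def
    by (rule completes_weaken[OF completes_seq[OF load_X(1) completes_seq[OF load_Y(1)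
        completes_seq[OF fft_X(1) fft_Y(1)]]]])
      simp
  moreover have "approximates scale (forward_error h) n (complex_arr a4 XRe XIm) (transform ?x 1 n)"
    using fft_X(2) completes_unchanged_arrs[OF fft_Y(1)] by (simp add: approximates_def complex_arr_def)
  ultimately show ?thesis using fft_Y(2) by blast
qed

lemma completes_convolve:
  assumes ready: "fft_ready n h (v, a)" and X_represented: "represents n (a XRe) X"
    and Y_represented: "represents n (a YRe) Y"
    and fits: "X \<subseteq> {..<n}" "Y \<subseteq> {..<n}" "X + Y \<subseteq> {..<n}"
  shows "\<exists>v' a'. completes convolve (v, a) (66 * n * (h + 1)) (v', a') \<and> represents n (a' XRe) (X + Y)"
proof -
  let ?x = "\<lambda>i. of_bool (i \<in> X) :: complex" and ?y = "\<lambda>i. of_bool (i \<in> Y) :: complex"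
  define C where "C = cyclic_conv n (\<lambda>i. of_bool (i \<in> X)) (\<lambda>i. of_bool (i \<in> Y) :: int)"
  have C_of_int: "cyclic_conv n ?x ?y i = of_int (C i)" for i unfolding C_def of_int_cyclic_conv by simp
  have unit: "cmod (?x i) \<le> 1" "cmod (?y i) \<le> 1" for i by simp_all
  have conv_bound: "cmod (cyclic_conv n ?x ?y i) \<le> (real n)\<^sup>2" for i
  proof -
    have "real_of_int \<bar>C i\<bar> \<le> real_of_int ((int n)\<^sup>2)"
      unfolding of_int_le_iff C_def using cyclic_conv_indicator_bounds[of n X Y i] by linarith
    then show ?thesis unfolding C_of_int by simp
  qed
  obtain v1 a1 where inputs: "completes transform_inputs (v, a) (12 * n + 44 * n * h + 12) (v1, a1)"
    "approximates scale (forward_error h) n (complex_arr a1 XRe XIm) (transform ?x 1 n)"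
    "approximates scale (forward_error h) n (complex_arr a1 YRe YIm) (transform ?y 1 n)"
    using completes_transform_inputs[OF ready X_represented Y_represented] by blast
  have ready1: "fft_ready n h (v1, a1)" using fft_ready_unchanged[OF ready completes_unchanged_outside[OF inputs(1)]]
    by simp
  obtain v2 a2 where product: "completes (update_pair XRe XIm (complex_times (complex_get XRe XIm (V Idx))
      (complex_get YRe YIm (V Idx)))) (v1, a1) (12 * n + 8) (v2, a2)"
    "approximates scale (inverse_error 0) n (complex_arr a2 XRe XIm) (transform (cyclic_conv n ?x ?y) 1 n)"
    using completes_product[OF ready1 unit conv_bound inputs(2,3)] by blast
  have ready2: "fft_ready n h (v2, a2)"
    using fft_ready_unchanged[OF ready1 completes_unchanged_outside[OF product(1)]] by simp
  obtain v3 a3 where ifft: "completes (ifft XRe XIm) (v2, a2) (22 * n * h + 2) (v3, a3)"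
    "approximates scale (inverse_error h) n (complex_arr a3 XRe XIm) (\<lambda>i. of_nat n * of_int (C i))"
    using completes_ifft[OF _ _ _ ready2 conv_bound product(2)] unfolding C_of_int by auto
  have ready3: "fft_ready n h (v3, a3)" using fft_ready_unchanged[OF ready2 completes_unchanged_outside[OF ifft(1)]]
    by simp
  have "1 \<le> n" using ready by (simp add: fft_ready_def)
  then have time: "12 * n + 44 * n * h + 12 + (12 * n + 8 + (22 * n * h + 2 + (3 * n + 2))) \<le> 66 * n * (h + 1)"
    by (simp add: algebra_simps)
  have "completes convolve (v, a) (66 * n * (h + 1))
      (v3(Idx := int n), a3(XRe := overwrite 0 n (\<lambda>i. of_bool (C i \<noteq> 0)) (a3 XRe)))"
    unfolding convolve_def
    by (rule completes_weaken[OF completes_seq[OF inputs(1) completes_seq[OF product(1) completes_seq[OF ifft(1)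
          completes_round[OF ready3 ifft(2)]]]] time])
  moreover have "represents n (overwrite 0 n (\<lambda>i. of_bool (C i \<noteq> 0)) (a3 XRe)) (X + Y)"
    using cyclic_conv_indicator_eq_0_iff[OF fits] by (simp add: represents_def C_def)
  ultimately show ?thesis by fastforce
qed

end

section \<open>Auxiliary programs\<close>

subsection \<open>Powers of two and integer square roots\<close>

lemma two_power_less_if_less_ceillog2: "i < ceillog2 e \<Longrightarrow> 2 ^ i < e"
  using ceillog2_le_iff[of e i] by (cases "e = 0") auto

definition next_power :: "var \<Rightarrow> exp \<Rightarrow> com" where
  "next_power x e = x ::= N 1 ;; While (V x) e (x ::= V x \<otimes> N 2)"

lemma assigned_next_power [simp]: "assigned_vars (next_power x e) = {x}" "assigned_arrs (next_power x e) = {}"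
  by (simp_all add: next_power_def)

lemma (in limits) completes_next_power:
  assumes e_value: "\<And>w. safe e (v(x := w), a) \<and> aval e (v(x := w), a) = int E" and double_le_B: "2 * int E \<le> B"
  shows "completes (next_power x e) (v, a) (2 * ceillog2 E + 2) (v(x := int (2 ^ ceillog2 E)), a)"
proof -
  define Inv where "Inv = (\<lambda>l s. s = (v(x := int (2 ^ l)), a))"
  have start: "completes (x ::= N 1) (v, a) 1 (v(x := int (2 ^ 0)), a)"
    by (rule completes_assign) (use sixty_four_le_B in auto)
  have "\<exists>s'. completes (While (V x) e (x ::= V x \<otimes> N 2)) (v(x := int (2 ^ 0)), a)
      ((\<Sum>l<ceillog2 E. 1 + 1) + 1) s' \<and> Inv (ceillog2 E) s'"
  proof (rule completes_while)
    fix l s' assume l_less: "l < ceillog2 E" and "Inv l s'"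
    then have state: "s' = (v(x := int (2 ^ l)), a)" by (simp add: Inv_def)
    have less: "int (2 ^ l) < int E" using two_power_less_if_less_ceillog2[OF l_less] by (simp only: of_nat_less_iff)
    with double_le_B have "2 * int (2 ^ l) \<le> B" by linarith
    then have "2 * 2 ^ l \<le> B" by simp
    then have "completes (x ::= V x \<otimes> N 2) s' 1 ((v(x := int (2 ^ l)))(x := int (2 ^ Suc l)), a)"
      unfolding state using double_le_B by (intro completes_assign) auto
    then show "safe (V x) s' \<and> safe e s' \<and> aval (V x) s' < aval e s' \<and>
        (\<exists>s''. completes (x ::= V x \<otimes> N 2) s' 1 s'' \<and> Inv (Suc l) s'')"
      using e_value less unfolding state Inv_def by auto
  next
    fix s' assume "Inv (ceillog2 E) s'"
    moreover have "int E \<le> int (2 ^ ceillog2 E)" using le_two_power_ceillog2 by (simp only: of_nat_le_iff)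
    ultimately show "safe (V x) s' \<and> safe e s' \<and> \<not> aval (V x) s' < aval e s'" using e_value by (simp add: Inv_def)
  qed (unfold Inv_def, rule refl)
  then have loop: "completes (While (V x) e (x ::= V x \<otimes> N 2)) (v(x := int (2 ^ 0)), a)
      ((\<Sum>l<ceillog2 E. 1 + 1) + 1) (v(x := int (2 ^ ceillog2 E)), a)" unfolding Inv_def by blast
  show ?thesis unfolding next_power_def by (rule completes_weaken[OF completes_seq[OF start loop]]) simp
qed

definition compute_log :: com where
  "compute_log = Pow_Two ::= N 1 ;; Log ::= N 0 ;;
     While (V Pow_Two) (V Count \<oplus> N 1) (Pow_Two ::= V Pow_Two \<otimes> N 2 ;; Log ::= V Log \<oplus> N 1)"

lemma (in limits) completes_compute_log:
  assumes Count: "v Count = int n" and double_le_B: "2 * int n + 2 \<le> B"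
  shows "completes compute_log (v, a) (3 * ceillog2 (n + 1) + 3)
    (v(Pow_Two := int (2 ^ ceillog2 (n + 1)), Log := int (ceillog2 (n + 1))), a)"
proof -
  let ?L = "ceillog2 (n + 1)" and ?body = "Pow_Two ::= V Pow_Two \<otimes> N 2 ;; Log ::= V Log \<oplus> N 1"
  let ?state = "\<lambda>l. (v(Pow_Two := int (2 ^ l), Log := int l), a)"
  have start_pow: "completes (Pow_Two ::= N 1) (v, a) 1 (v(Pow_Two := int (2 ^ 0)), a)"
    by (rule completes_assign) (use sixty_four_le_B in auto)
  have start_log: "completes (Log ::= N 0) (v(Pow_Two := int (2 ^ 0)), a) 1 (?state 0)"
    by (rule completes_assign) (use sixty_four_le_B in auto)
  have "\<exists>s'. completes (While (V Pow_Two) (V Count \<oplus> N 1) ?body) (?state 0) ((\<Sum>l<?L. (1 + 1) + 1) + 1) s' \<and>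
      s' = ?state ?L"
  proof (rule completes_while[where Inv = "\<lambda>l s. s = ?state l"])
    fix l s' assume l_less: "l < ?L" and state: "s' = ?state l"
    have less: "2 ^ l < n + 1" using two_power_less_if_less_ceillog2[OF l_less] .
    then have "l \<le> n" using less_exp[of l] by linarith
    have "int (2 ^ l) < int (n + 1)" using less by (simp only: of_nat_less_iff)
    then have "completes (Pow_Two ::= V Pow_Two \<otimes> N 2) s' 1 ((v(Pow_Two := int (2 ^ l), Log := int l))(Pow_Two := int (2 ^ Suc l)), a)"
      unfolding state by (intro completes_assign) (use double_le_B in auto)
    moreover have "completes (Log ::= V Log \<oplus> N 1) ((v(Pow_Two := int (2 ^ l), Log := int l))(Pow_Two := int (2 ^ Suc l)), a) 1
        ((v(Pow_Two := int (2 ^ l), Log := int l))(Pow_Two := int (2 ^ Suc l), Log := int (Suc l)), a)"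
      by (rule completes_assign) (use double_le_B \<open>l \<le> n\<close> in auto)
    ultimately have "completes ?body s' (1 + 1) ((v(Pow_Two := int (2 ^ l), Log := int l))(Pow_Two := int (2 ^ Suc l), Log := int (Suc l)), a)"
      by (rule completes_seq)
    moreover have "(v(Pow_Two := int (2 ^ l), Log := int l))(Pow_Two := int (2 ^ Suc l), Log := int (Suc l)) =
      v(Pow_Two := int (2 ^ Suc l), Log := int (Suc l))" by (simp add: fun_eq_iff)
    ultimately have "completes ?body s' (1 + 1) (?state (Suc l))" by (simp only:)
    then show "safe (V Pow_Two) s' \<and> safe (V Count \<oplus> N 1) s' \<and> aval (V Pow_Two) s' < aval (V Count \<oplus> N 1) s' \<and>
        (\<exists>s''. completes ?body s' (1 + 1) s'' \<and> s'' = ?state (Suc l))"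
      using Count less by (simp add: state)
  next
    fix s' assume "s' = ?state ?L"
    moreover have "n < 2 ^ ?L" using le_two_power_ceillog2[of "n + 1"] by linarith
    ultimately show "safe (V Pow_Two) s' \<and> safe (V Count \<oplus> N 1) s' \<and> \<not> aval (V Pow_Two) s' < aval (V Count \<oplus> N 1) s'"
      using Count by (auto simp: not_less)
  qed simp
  then have loop: "completes (While (V Pow_Two) (V Count \<oplus> N 1) ?body) (?state 0) ((\<Sum>l<?L. (1 + 1) + 1) + 1) (?state ?L)"
    by blast
  show ?thesis unfolding compute_log_def
    by (rule completes_weaken[OF completes_seq[OF start_pow completes_seq[OF start_log loop]]]) simp
qed

definition compute_modulus :: com where
  "compute_modulus = Modulus ::= N 0 ;;
     While ((V Modulus \<oplus> N 1) \<otimes> (V Modulus \<oplus> N 1)) (V Count \<otimes> V Log \<oplus> N 1) (Modulus ::= V Modulus \<oplus> N 1)"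

lemma (in limits) completes_compute_modulus:
  assumes vals: "v Count = int n" "v Log = int l" and root_le_B: "int (floor_sqrt (n * l)) \<le> B"
  shows "completes compute_modulus (v, a) (2 * floor_sqrt (n * l) + 2) (v(Modulus := int (floor_sqrt (n * l))), a)"
proof -
  let ?b = "floor_sqrt (n * l)"
  let ?lhs = "(V Modulus \<oplus> N 1) \<otimes> (V Modulus \<oplus> N 1)" and ?rhs = "V Count \<otimes> V Log \<oplus> N 1"
  let ?state = "\<lambda>i. (v(Modulus := int i), a)"
  have guard: "aval ?lhs (?state i) < aval ?rhs (?state i) \<longleftrightarrow> i < ?b" for i
  proof -
    have "aval ?lhs (?state i) < aval ?rhs (?state i) \<longleftrightarrow> int ((Suc i)\<^sup>2) \<le> int (n * l)"
      using vals by (simp add: power2_eq_square algebra_simps) linarith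
    also have "\<dots> \<longleftrightarrow> i < ?b" by (simp only: of_nat_le_iff le_floor_sqrt_iff[symmetric] Suc_le_eq)
    finally show ?thesis .
  qed
  have start: "completes (Modulus ::= N 0) (v, a) 1 (?state 0)"
    by (rule completes_assign) (use sixty_four_le_B in auto)
  have "\<exists>s'. completes (While ?lhs ?rhs (Modulus ::= V Modulus \<oplus> N 1)) (?state 0) ((\<Sum>i<?b. 1 + 1) + 1) s' \<and>
      s' = ?state ?b"
  proof (rule completes_while[where Inv = "\<lambda>i s. s = ?state i"])
    fix i s' assume i_less: "i < ?b" and state: "s' = ?state i"
    have "completes (Modulus ::= V Modulus \<oplus> N 1) s' 1 ((v(Modulus := int i))(Modulus := int (Suc i)), a)"
      unfolding state by (rule completes_assign) (use i_less root_le_B in auto)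
    then show "safe ?lhs s' \<and> safe ?rhs s' \<and> aval ?lhs s' < aval ?rhs s' \<and>
        (\<exists>s''. completes (Modulus ::= V Modulus \<oplus> N 1) s' 1 s'' \<and> s'' = ?state (Suc i))"
      using guard[of i] i_less by (simp add: state)
  qed (use guard[of ?b] in auto)
  then have loop: "completes (While ?lhs ?rhs (Modulus ::= V Modulus \<oplus> N 1)) (?state 0) ((\<Sum>i<?b. 1 + 1) + 1) (?state ?b)"
    by blast
  show ?thesis unfolding compute_modulus_def by (rule completes_weaken[OF completes_seq[OF start loop]]) simp
qed

text \<open>The bits of the root are determined one by one, starting from the power of two in the variable \<open>Scale\<close>.\<close>
definition isqrt_step :: com where
  "isqrt_step = Root ::= V Root \<oplus> V Bit \<otimes> at_most ((V Root \<oplus> V Bit) \<otimes> (V Root \<oplus> V Bit)) (V Radicand) ;;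
     Bit ::= V Bit \<oslash> N 2"

definition isqrt :: com where
  "isqrt = Root ::= N 0 ;; Bit ::= V Scale ;; While (N 0) (V Bit) isqrt_step"

lemma assigned_isqrt [simp]: "assigned_vars isqrt = {Root, Bit}" "assigned_arrs isqrt = {}"
  by (auto simp: isqrt_def isqrt_step_def)

lemma (in limits) completes_isqrt_step:
  assumes Radicand: "v Radicand = int X" and root_range: "r\<^sup>2 \<le> X" "X < (r + 2 * t)\<^sup>2"
    and le_B: "int t \<le> B" "int (floor_sqrt X) \<le> B"
  shows "\<exists>r'. completes isqrt_step (v(Root := int r, Bit := int t), a) 2 (v(Root := int r', Bit := int (t div 2)), a) \<and>
    r'\<^sup>2 \<le> X \<and> X < (r' + t)\<^sup>2"
proof -
  let ?s = "(v(Root := int r, Bit := int t), a)"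
  define r' where "r' = (if (r + t)\<^sup>2 \<le> X then r + t else r)"
  have root_range': "r'\<^sup>2 \<le> X" "X < (r' + t)\<^sup>2" using root_range by (auto simp: r'_def mult_2 add.assoc)
  then have "int r' \<le> B" using le_B(2) le_floor_sqrtI[of r' X] by linarith
  moreover have "aval (at_most ((V Root \<oplus> V Bit) \<otimes> (V Root \<oplus> V Bit)) (V Radicand)) ?s = of_bool ((r + t)\<^sup>2 \<le> X)"
    by (rule aval_at_most) (simp_all add: Radicand power2_eq_square)
  ultimately have "completes (Root ::= V Root \<oplus> V Bit \<otimes> at_most ((V Root \<oplus> V Bit) \<otimes> (V Root \<oplus> V Bit)) (V Radicand)) ?s 1
      (v(Root := int r, Bit := int t, Root := int r'), a)"
    by (intro completes_assign) (auto simp: r'_def)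
  moreover have "int t div 2 \<le> B" "int (t div 2) = int t div 2" using le_B(1) by linarith (simp add: zdiv_int)
  then have "completes (Bit ::= V Bit \<oslash> N 2) (v(Root := int r, Bit := int t, Root := int r'), a) 1
      (v(Root := int r, Bit := int t, Root := int r', Bit := int (t div 2)), a)"
    by (intro completes_assign) auto
  ultimately have "completes isqrt_step ?s 2 (v(Root := int r, Bit := int t, Root := int r', Bit := int (t div 2)), a)"
    unfolding isqrt_step_def by (intro completes_weaken[OF completes_seq, of _ _ 1 _ _ 1]) simp_all
  moreover have "v(Root := int r, Bit := int t, Root := int r', Bit := int (t div 2)) =
      v(Root := int r', Bit := int (t div 2))"
    by (simp add: fun_eq_iff)
  ultimately show ?thesis using root_range' by auto
qed

lemma (in limits) completes_isqrt:
  assumes Scale: "v Scale = int (2 ^ p)" and Radicand: "v Radicand = int X" "X \<le> 2 ^ p * 2 ^ p"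
    and power_le_B: "int (2 ^ p) \<le> B"
  shows "completes isqrt (v, a) (3 * p + 6) (v(Root := int (floor_sqrt X), Bit := 0), a)"
proof -
  have "floor_sqrt X \<le> floor_sqrt ((2 ^ p)\<^sup>2)" using Radicand(2)
    by (intro mono_floor_sqrt') (simp add: power2_eq_square)
  then have "int (floor_sqrt X) \<le> int (2 ^ p)" by (simp only: floor_sqrt_inverse_power2 of_nat_le_iff)
  then have root_B: "int (floor_sqrt X) \<le> B" using power_le_B by linarith
  let ?w = "v(Root := 0, Bit := int (2 ^ p))"
  define Inv where "Inv = (\<lambda>i s. \<exists>r. s = (v(Root := int r, Bit := int (2 ^ (Suc p - i) div 2)), a) \<and>
     r\<^sup>2 \<le> X \<and> X < (r + 2 ^ (Suc p - i))\<^sup>2)"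
  have start_root: "completes (Root ::= N 0) (v, a) 1 (v(Root := 0), a)"
    by (rule completes_assign) (use sixty_four_le_B in auto)
  have start_bit: "completes (Bit ::= V Scale) (v(Root := 0), a) 1 (?w, a)"
    by (rule completes_assign) (use Scale power_le_B in auto)
  have "\<exists>s'. completes (While (N 0) (V Bit) isqrt_step) (?w, a) ((\<Sum>i<Suc p. 2 + 1) + 1) s' \<and> Inv (Suc p) s'"
  proof (rule completes_while)
    have "X < (2 ^ Suc p)\<^sup>2" using Radicand(2) by (rule order_le_less_trans) (simp add: power2_eq_square)
    then show "Inv 0 (?w, a)" unfolding Inv_def by (intro exI[of _ 0]) simp
  next
    fix i s' assume i_less: "i < Suc p" and "Inv i s'"
    define t :: nat where "t = 2 ^ (p - i)"
    have double: "2 ^ (Suc p - i) = 2 * t" using i_less by (simp add: t_def Suc_diff_le)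
    obtain r where root: "s' = (v(Root := int r, Bit := int t), a)" "r\<^sup>2 \<le> X" "X < (r + 2 * t)\<^sup>2"
      using \<open>Inv i s'\<close> unfolding Inv_def double by auto
    have "t \<le> 2 ^ p" unfolding t_def by (intro power_increasing) auto
    then have "int t \<le> B" using power_le_B by (meson of_nat_le_iff order_trans)
    then obtain r' where "completes isqrt_step s' 2 (v(Root := int r', Bit := int (t div 2)), a)"
      "r'\<^sup>2 \<le> X" "X < (r' + t)\<^sup>2"
      using completes_isqrt_step[where v = v, OF Radicand(1) root(2,3) _ root_B] root(1) by blast
    then have "\<exists>s''. completes isqrt_step s' 2 s'' \<and> Inv (Suc i) s''" unfolding Inv_def by (auto simp: t_def)
    moreover have "0 < t" by (simp add: t_def)
    ultimately show "safe (N 0) s' \<and> safe (V Bit) s' \<and> aval (N 0) s' < aval (V Bit) s' \<and>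
        (\<exists>s''. completes isqrt_step s' 2 s'' \<and> Inv (Suc i) s'')" by (simp add: root(1))
  qed (auto simp: Inv_def)
  then obtain r where loop: "completes (While (N 0) (V Bit) isqrt_step) (?w, a) ((\<Sum>i<Suc p. 2 + 1) + 1)
      (v(Root := int r, Bit := 0), a)" and root: "r\<^sup>2 \<le> X" "X < (Suc r)\<^sup>2"
    by (auto simp: Inv_def)
  have "floor_sqrt X = r" using root by (rule floor_sqrt_unique)
  then show ?thesis unfolding isqrt_def
    by (intro completes_weaken[OF completes_seq[OF start_root
        completes_seq[OF start_bit loop[unfolded \<open>floor_sqrt X = r\<close>[symmetric]]]]]) simp
qed

subsection \<open>The table of twiddle factors\<close>

definition halve_angle :: com where
  "halve_angle = Radicand ::= V Scale \<otimes> (V Scale \<ominus> V Cosine) \<oslash> N 2 ;; isqrt ;; Sine ::= V Root ;;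
     Radicand ::= V Scale \<otimes> (V Scale \<oplus> V Cosine) \<oslash> N 2 ;; isqrt ;; Cosine ::= V Root"

definition rotated_exp :: complex_exp where
  "rotated_exp = complex_times (V Cosine, V Sine) (complex_get TabRe TabIm (V Idx))"

definition double_table :: com where
  "double_table = fill TabRe (V Filled) (fst rotated_exp) (V Filled) ;;
     fill TabIm (V Filled) (snd rotated_exp) (V Filled) ;; halve_angle ;; Filled ::= V Filled \<otimes> N 2"

definition make_table :: com where
  "make_table = Put TabRe (N 0) (V Scale) ;; Put TabIm (N 0) (N 0) ;; Cosine ::= N 0 ;; Sine ::= V Scale ;;
     Filled ::= N 1 ;; While (V Filled) (V Tab_Len) double_table"

lemma assigned_table_commands [simp]:
  "assigned_vars halve_angle = {Radicand, Root, Bit, Sine, Cosine}" "assigned_arrs halve_angle = {}"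
  "assigned_vars double_table = {Idx, Radicand, Root, Bit, Sine, Cosine, Filled}"
  "assigned_arrs double_table = {TabRe, TabIm}"
  "assigned_vars make_table = {Idx, Radicand, Root, Bit, Sine, Cosine, Filled}"
  "assigned_arrs make_table = {TabRe, TabIm}"
  by (auto simp: halve_angle_def double_table_def make_table_def)

lemma (in limits) completes_halve_angle:
  assumes vals: "v Scale = int S" "v Cosine = int c" and S_power: "S = 2 ^ p" "int (S * S) \<le> B" and c_le: "c \<le> S"
  shows "\<exists>v'. completes halve_angle (v, a) (6 * p + 16) (v', a) \<and>
    v' Cosine = int (floor_sqrt (S * (S + c) div 2)) \<and> v' Sine = int (floor_sqrt (S * (S - c) div 2))"
proof -
  let ?X = "S * (S - c) div 2" and ?Y = "S * (S + c) div 2"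
  have "S * (S - c) \<le> S * S" "S * (S + c) \<le> S * (2 * S)" using c_le by (intro mult_le_mono2; simp)+
  then have X_le: "?X \<le> S * S" and Y_le: "?Y \<le> S * S" by linarith+
  have "1 \<le> S" by (simp add: S_power(1))
  then have "S * 1 \<le> S * S" by (rule mult_le_mono2)
  then have "int S \<le> int (S * S)" by (simp only: of_nat_le_iff mult_1_right)
  then have S_le_B: "int S \<le> B" using S_power(2) by linarith
  have roots: "int (floor_sqrt ?X) \<le> B" "int (floor_sqrt ?Y) \<le> B"
    using S_le_B mono_floor_sqrt'[OF X_le] mono_floor_sqrt'[OF Y_le] by (simp_all flip: power2_eq_square)
  let ?v1 = "v(Radicand := int ?X)" let ?v2 = "?v1(Root := int (floor_sqrt ?X), Bit := 0)"
  let ?v3 = "?v2(Sine := int (floor_sqrt ?X))" let ?v4 = "?v3(Radicand := int ?Y)"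
  let ?v5 = "?v4(Root := int (floor_sqrt ?Y), Bit := 0)" let ?v6 = "?v5(Cosine := int (floor_sqrt ?Y))"
  have "int ?X \<le> B" "int ?Y \<le> B" using X_le Y_le S_power(2) by (meson of_nat_le_iff order_trans)+
  then have radicands:
    "completes (Radicand ::= V Scale \<otimes> (V Scale \<ominus> V Cosine) \<oslash> N 2) (v, a) 1 (?v1, a)"
    "completes (Radicand ::= V Scale \<otimes> (V Scale \<oplus> V Cosine) \<oslash> N 2) (?v3, a) 1 (?v4, a)"
    using vals c_le by (intro completes_assign; simp add: zdiv_int of_nat_diff)+
  have isqrts: "completes isqrt (?v1, a) (3 * p + 6) (?v2, a)" "completes isqrt (?v4, a) (3 * p + 6) (?v5, a)"
    using vals(1) S_le_B X_le Y_le S_power(1) by (intro completes_isqrt; simp)+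
  have copies: "completes (Sine ::= V Root) (?v2, a) 1 (?v3, a)" "completes (Cosine ::= V Root) (?v5, a) 1 (?v6, a)"
    using roots by (intro completes_assign; simp)+
  have "completes halve_angle (v, a) (6 * p + 16) (?v6, a)" unfolding halve_angle_def
    by (rule completes_weaken[OF completes_seq[OF radicands(1) completes_seq[OF isqrts(1) completes_seq[OF copies(1)
          completes_seq[OF radicands(2) completes_seq[OF isqrts(2) copies(2)]]]]]]) simp
  then show ?thesis by (intro exI[of _ ?v6]) simp
qed

context convolution
begin

definition table_prefix :: "nat \<Rightarrow> state \<Rightarrow> bool" where
  "table_prefix k s \<longleftrightarrow> fst s Filled = int (2 ^ k) \<and>
     (\<exists>c d. fst s Cosine = int c \<and> fst s Sine = int d \<and> approximates_angle (T ^ 16) (pi / 2 ^ Suc k) c d) \<and>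
     approximates scale (24 * real k / T ^ 16) (2 ^ k) (complex_arr (snd s) TabRe TabIm) twiddle"

lemma scale_eq_square: "scale = T ^ 16 * T ^ 16"
  by (simp add: scale_def flip: power_add)

lemma table_error_le:
  assumes "k \<le> L"
  shows "24 * k \<le> T ^ 3" "24 * k \<le> T ^ 16" "24 * real k / T ^ 16 \<le> \<tau> ^ 13"
proof -
  have "k \<le> T" unfolding T_def using assms less_exp[of L] by linarith
  then have "24 * k \<le> 8 * 8 * T" by simp
  also have "\<dots> \<le> T * T * T" using eight_le_T by (intro mult_le_mono) auto
  finally show le_cube: "24 * k \<le> T ^ 3" by (simp add: power3_eq_cube)
  also have "\<dots> \<le> T ^ 16" using eight_le_T by (intro power_increasing) auto
  finally show "24 * k \<le> T ^ 16" .
  have "real (24 * k) / T ^ 16 \<le> real (T ^ 3) / T ^ 16" using le_cube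
    by (intro divide_right_mono) (simp_all only: of_nat_le_iff of_nat_0_le_iff)
  also have "\<dots> = real T ^ 3 * \<tau> ^ (3 + 13)" by (simp add: \<tau>_def power_one_over)
  also have "\<dots> = \<tau> ^ 13" by (rule T_power_mult_\<tau>_power)
  finally show "24 * real k / T ^ 16 \<le> \<tau> ^ 13" by simp
qed

definition extended_table :: "nat \<Rightarrow> int \<times> int \<Rightarrow> (nat \<Rightarrow> int \<times> int) \<Rightarrow> nat \<Rightarrow> int \<times> int" where
  "extended_table n r z i = (if i < n then z i else fp_mult scale r (z (i - n)))"

lemma extended_table_approximates:
  assumes "k < L" "approximates_angle (T ^ 16) (pi / 2 ^ Suc k) c d"
    and "approximates scale (24 * real k / T ^ 16) (2 ^ k) z twiddle"
  shows "approximates scale (24 * real (Suc k) / T ^ 16) (2 ^ Suc k) (extended_table (2 ^ k) (int c, int d) z) twiddle"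
  unfolding scale_eq_square
  by (rule twiddle_table_double[OF _ assms(2) assms(3)[unfolded scale_eq_square]])
    (use table_error_le(2)[of k] assms(1) eight_le_T in \<open>auto simp: extended_table_def scale_eq_square\<close>)

lemma extended_table_bounds:
  assumes "k < L" "approximates_angle (T ^ 16) (pi / 2 ^ Suc k) c d"
    and "approximates scale (24 * real k / T ^ 16) (2 ^ k) z twiddle" and "i < 2 ^ k"
  shows "\<bar>fst (fp_mult scale (int c, int d) (z i))\<bar> \<le> B" "\<bar>snd (fp_mult scale (int c, int d) (z i))\<bar> \<le> B"
proof -
  let ?e = "extended_table (2 ^ k) (int c, int d) z (2 ^ k + i)"
  have "24 * real (Suc k) / T ^ 16 \<le> 1" using table_error_le(3)[of "Suc k"] assms(1) \<tau>_power_le[of 13] by simp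
  then have "\<bar>fst ?e\<bar> \<le> int T ^ 36 \<and> \<bar>snd ?e\<bar> \<le> int T ^ 36"
    using approximates_component_bounds[OF extended_table_approximates[OF assms(1-3)],
        of "2 ^ k + i"] assms(4) eight_le_T by simp
  moreover have "?e = fp_mult scale (int c, int d) (z i)" by (simp add: extended_table_def)
  ultimately show "\<bar>fst (fp_mult scale (int c, int d) (z i))\<bar> \<le> B" "\<bar>snd (fp_mult scale (int c, int d) (z i))\<bar> \<le> B"
    using T_power_le_B'[of 36] by auto
qed

lemma rotated_exp_correct:
  assumes "v Scale = int scale" "v Cosine = int c" "v Sine = int d"
  shows "safe (fst rotated_exp) (v(Idx := int i), a)" "safe (snd rotated_exp) (v(Idx := int i), a)"
    "aval (fst rotated_exp) (v(Idx := int i), a) = fst (fp_mult scale (int c, int d) (complex_arr a TabRe TabIm i))"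
    "aval (snd rotated_exp) (v(Idx := int i), a) = snd (fp_mult scale (int c, int d) (complex_arr a TabRe TabIm i))"
  using assms by (simp_all add: rotated_exp_def complex_times_def complex_get_def complex_arr_def fp_mult_def)

lemma completes_fill_table:
  assumes k_less: "k < L" and prefix: "table_prefix k (v, a)" and Scale: "v Scale = int scale"
  shows "\<exists>v1 a1. completes (fill TabRe (V Filled) (fst rotated_exp) (V Filled)) (v, a) (3 * 2 ^ k + 2) (v1, a1) \<and>
    (\<exists>v2 a2. completes (fill TabIm (V Filled) (snd rotated_exp) (V Filled)) (v1, a1) (3 * 2 ^ k + 2) (v2, a2) \<and>
      approximates scale (24 * real (Suc k) / T ^ 16) (2 ^ Suc k) (complex_arr a2 TabRe TabIm) twiddle)"
proof -
  let ?n = "2 ^ k :: nat" and ?z = "complex_arr a TabRe TabIm"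
  obtain c d where rotation: "v Cosine = int c" "v Sine = int d" "approximates_angle (T ^ 16) (pi / 2 ^ Suc k) c d"
    and Filled: "v Filled = int ?n" and old: "approximates scale (24 * real k / T ^ 16) ?n ?z twiddle"
    using prefix by (auto simp: table_prefix_def)
  note rotated_bounds = extended_table_bounds[OF k_less rotation(3) old]
  define f where "f i = fp_mult scale (int c, int d) (?z i)" for i
  define a1 where "a1 = a(TabRe := overwrite ?n ?n (\<lambda>i. fst (f i)) (a TabRe))"
  define a2 where "a2 = a1(TabIm := overwrite ?n ?n (\<lambda>i. snd (f i)) (a1 TabIm))"
  have "?n \<le> T" unfolding T_def using k_less by (intro power_increasing) auto
  then have length_B: "int ?n \<le> B" using T_le_B by linarith
  have "completes (fill TabRe (V Filled) (fst rotated_exp) (V Filled)) (v, a) (3 * ?n + 2) (v(Idx := int ?n), a1)"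
    unfolding a1_def
  proof (rule completes_fill)
    fix i assume "i < ?n"
    then show "safe (fst rotated_exp) (v(Idx := int i), a(TabRe := overwrite ?n i (\<lambda>i. fst (f i)) (a TabRe))) \<and>
      aval (fst rotated_exp) (v(Idx := int i), a(TabRe := overwrite ?n i (\<lambda>i. fst (f i)) (a TabRe))) = fst (f i) \<and>
          \<bar>fst (f i)\<bar> \<le> B"
      using rotated_bounds(1) rotated_exp_correct[OF Scale rotation(1,2)]
      by (simp add: f_def complex_arr_def overwrite_def)
  qed (use length_B Filled in auto)
  moreover have "completes (fill TabIm (V Filled) (snd rotated_exp) (V Filled)) (v(Idx := int ?n), a1) (3 * ?n + 2)
      (v(Idx := int ?n, Idx := int ?n), a2)"
    unfolding a2_def
  proof (rule completes_fill)
    fix i assume "i < ?n"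
    then show "safe (snd rotated_exp) (v(Idx := int ?n, Idx := int i), a1(TabIm := overwrite ?n i (\<lambda>i. snd (f i)) (a1 TabIm))) \<and>
      aval (snd rotated_exp) (v(Idx := int ?n, Idx := int i), a1(TabIm := overwrite ?n i (\<lambda>i. snd (f i)) (a1 TabIm))) = snd (f i) \<and>
      \<bar>snd (f i)\<bar> \<le> B"
      using rotated_bounds(2) rotated_exp_correct[OF Scale rotation(1,2)]
      by (simp add: f_def complex_arr_def overwrite_def a1_def)
  qed (use length_B Filled in auto)
  moreover have "approximates scale (24 * real (Suc k) / T ^ 16) (2 ^ Suc k) (complex_arr a2 TabRe TabIm) twiddle"
    by (rule approximates_cong[OF extended_table_approximates[OF k_less rotation(3) old]])
      (auto simp: extended_table_def complex_arr_def a1_def a2_def overwrite_def f_def)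
  ultimately show ?thesis by blast
qed

lemma completes_double_table:
  assumes k_less: "k < L" and prefix: "table_prefix k (v, a)" and Scale: "v Scale = int scale"
  shows "\<exists>v' a'. completes double_table (v, a) (6 * 2 ^ k + 192 * L + 21) (v', a') \<and> table_prefix (Suc k) (v', a')"
proof -
  let ?w = "T ^ 16"
  obtain c d where rotation: "v Cosine = int c" "v Sine = int d" "approximates_angle ?w (pi / 2 ^ Suc k) c d"
    and Filled: "v Filled = int (2 ^ k)" using prefix by (auto simp: table_prefix_def)
  obtain v1 a1 v2 a2 where fills:
    "completes (fill TabRe (V Filled) (fst rotated_exp) (V Filled)) (v, a) (3 * 2 ^ k + 2) (v1, a1)"
    "completes (fill TabIm (V Filled) (snd rotated_exp) (V Filled)) (v1, a1) (3 * 2 ^ k + 2) (v2, a2)"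
    and new: "approximates scale (24 * real (Suc k) / ?w) (2 ^ Suc k) (complex_arr a2 TabRe TabIm) twiddle"
    using completes_fill_table[OF assms] by blast
  have vals2: "v2 Scale = int scale" "v2 Cosine = int c" "v2 Filled = int (2 ^ k)"
    using completes_unchanged_vars[OF fills(1)] completes_unchanged_vars[OF fills(2)] Scale rotation Filled
    by simp_all
  have "scale = 2 ^ (32 * L)" by (simp add: scale_def T_def flip: power_mult)
  moreover have "int (scale * scale) \<le> B" using T_power_le_B by (simp add: scale_def flip: power_add)
  moreover have "c \<le> scale" using rotation(3) by (simp add: approximates_angle_def scale_eq_square)
  ultimately obtain v3 where halve: "completes halve_angle (v2, a2) (6 * (32 * L) + 16) (v3, a2)"
    "v3 Cosine = int (floor_sqrt (scale * (scale + c) div 2))"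
      "v3 Sine = int (floor_sqrt (scale * (scale - c) div 2))"
    using completes_halve_angle[OF vals2(1,2)] by blast
  have "pi / 2 ^ Suc k \<le> pi / 2 ^ 1" by (intro divide_left_mono power_increasing) auto
  then have angle: "approximates_angle ?w (pi / 2 ^ Suc k / 2) (floor_sqrt (scale * (scale + c) div 2))
      (floor_sqrt (scale * (scale - c) div 2))"
    unfolding scale_eq_square using eight_le_T rotation(3) by (intro approximates_angle_halve[where s = d]) auto
  have "v3 Filled = int (2 ^ k)" using completes_unchanged_vars[OF halve(1)] vals2(3) by simp
  moreover have "2 ^ Suc k \<le> T" unfolding T_def using k_less by (intro power_increasing) auto
  then have "int (2 ^ Suc k) \<le> B" using T_le_B by linarith
  ultimately have double: "completes (Filled ::= V Filled \<otimes> N 2) (v3, a2) 1 (v3(Filled := int (2 ^ Suc k)), a2)"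
    by (intro completes_assign) auto
  have "completes double_table (v, a) (6 * 2 ^ k + 192 * L + 21) (v3(Filled := int (2 ^ Suc k)), a2)"
    unfolding double_table_def
    by (rule completes_weaken[OF completes_seq[OF fills(1) completes_seq[OF fills(2)
        completes_seq[OF halve(1) double]]]]) simp
  moreover have "table_prefix (Suc k) (v3(Filled := int (2 ^ Suc k)), a2)"
    using new angle halve(2,3) by (auto simp: table_prefix_def mult.commute)
  ultimately show ?thesis by blast
qed

lemma table_prefix_0:
  assumes "fst s Filled = 1" "fst s Cosine = 0" "fst s Sine = int scale" "snd s TabRe 0 = int scale"
    "snd s TabIm 0 = 0"
  shows "table_prefix 0 s"
proof -
  have "approximates_angle (T ^ 16) (pi / 2) 0 scale"
    using approximates_angle_pi_half[of "T ^ 16"] eight_le_T by (simp add: scale_eq_square)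
  then have "\<exists>c d. fst s Cosine = int c \<and> fst s Sine = int d \<and> approximates_angle (T ^ 16) (pi / 2 ^ Suc 0) c d"
    using assms by (intro exI[of _ 0] exI[of _ scale]) simp
  then show ?thesis
    using assms by (simp add: table_prefix_def approximates_def fp_value_def complex_arr_def complex_eq_iff)
qed

lemma table_loop_time: "(\<Sum>k<L. 6 * 2 ^ k + 192 * L + 21 + 1) + 1 \<le> 6 * T + L * (192 * L + 22) + 1"
proof -
  have "(\<Sum>k<L. 6 * 2 ^ k + 192 * L + 21 + 1) = 6 * (\<Sum>k<L. 2 ^ k) + L * (192 * L + 22)"
    by (simp add: sum.distrib sum_distrib_left algebra_simps)
  moreover have "(\<Sum>k<L. (2::nat) ^ k) \<le> T" unfolding T_def by (induction L) auto
  ultimately show ?thesis by simp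
qed

lemma completes_make_table:
  assumes vals: "v Scale = int scale" "v Tab_Len = int T"
  shows "\<exists>v' a'. completes make_table (v, a) (6 * T + L * (192 * L + 22) + 6) (v', a') \<and>
    twiddle_table (complex_arr a' TabRe TabIm)"
proof -
  have scale_B: "int scale \<le> B" using T_power_le_B'[of 32] by (simp add: scale_def)
  let ?a1 = "a(TabRe := (a TabRe)(0 := int scale))" let ?a2 = "?a1(TabIm := (?a1 TabIm)(0 := 0))"
  let ?v3 = "v(Cosine := 0)" let ?v4 = "?v3(Sine := int scale)" let ?v5 = "?v4(Filled := 1)"
  have puts: "completes (Put TabRe (N 0) (V Scale)) (v, a) 1 (v, ?a1)"
    "completes (Put TabIm (N 0) (N 0)) (v, ?a1) 1 (v, ?a2)"
    using vals(1) scale_B sixty_four_le_B by (intro completes_put; simp)+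
  have assigns: "completes (Cosine ::= N 0) (v, ?a2) 1 (?v3, ?a2)"
    "completes (Sine ::= V Scale) (?v3, ?a2) 1 (?v4, ?a2)"
    "completes (Filled ::= N 1) (?v4, ?a2) 1 (?v5, ?a2)"
    using vals(1) scale_B sixty_four_le_B by (intro completes_assign; simp)+
  have "\<exists>s'. completes (While (V Filled) (V Tab_Len) double_table) (?v5, ?a2)
      ((\<Sum>k<L. 6 * 2 ^ k + 192 * L + 21 + 1) + 1) s' \<and> (table_prefix L s' \<and> fst s' Tab_Len = int T)"
  proof (rule completes_while[where Inv = "\<lambda>k s. table_prefix k s \<and> fst s Tab_Len = int T"])
    show "table_prefix 0 (?v5, ?a2) \<and> fst (?v5, ?a2) Tab_Len = int T" using vals(2) by (simp add: table_prefix_0)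
  next
    fix k s' assume k_less: "k < L" and invariant: "table_prefix k s' \<and> fst s' Tab_Len = int T"
      and unchanged: "unchanged_outside double_table (?v5, ?a2) s'"
    obtain v' a' where state: "s' = (v', a')" by (cases s')
    have "v' Scale = int scale" using unchanged vals by (simp add: unchanged_outside_def state)
    then obtain v'' a'' where body: "completes double_table (v', a') (6 * 2 ^ k + 192 * L + 21) (v'', a'')"
      "table_prefix (Suc k) (v'', a'')" using completes_double_table[OF k_less] invariant state by blast
    then have "v'' Tab_Len = int T" using completes_unchanged_vars[OF body(1)] invariant state by simp
    moreover have "int (2 ^ k) < int T" unfolding T_def of_nat_less_iff using k_less
      by (intro power_strict_increasing) auto
    ultimately show "safe (V Filled) s' \<and> safe (V Tab_Len) s' \<and> aval (V Filled) s' < aval (V Tab_Len) s' \<and>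
      (\<exists>s''. completes double_table s' (6 * 2 ^ k + 192 * L + 21) s'' \<and> (table_prefix (Suc k) s'' \<and>
          fst s'' Tab_Len = int T))"
      using body invariant unfolding state by (auto simp: table_prefix_def)
  qed (simp add: table_prefix_def T_def)
  then obtain v' a' where "completes (While (V Filled) (V Tab_Len) double_table) (?v5, ?a2)
      ((\<Sum>k<L. 6 * 2 ^ k + 192 * L + 21 + 1) + 1) (v', a')" and prefix: "table_prefix L (v', a')"
    by (metis surj_pair)
  note loop = completes_weaken[OF this(1) table_loop_time]
  have "completes make_table (v, a) (6 * T + L * (192 * L + 22) + 6) (v', a')" unfolding make_table_def
    by (rule completes_weaken[OF completes_seq[OF puts(1) completes_seq[OF puts(2) completes_seq[OF assigns(1)
          completes_seq[OF assigns(2) completes_seq[OF assigns(3) loop]]]]]]) simp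
  moreover have "twiddle_table (complex_arr a' TabRe TabIm)"
    using prefix approximates_mono[OF _ table_error_le(3)[OF order_refl]]
    by (simp add: table_prefix_def twiddle_table_def T_def)
  ultimately show ?thesis by blast
qed

end

subsection \<open>The fixed-point scale\<close>

definition compute_scale :: com where
  "compute_scale = Scale ::= V Tab_Len \<otimes> V Tab_Len ;; Scale ::= V Scale \<otimes> V Scale ;; Scale ::= V Scale \<otimes> V Scale ;;
     Scale ::= V Scale \<otimes> V Scale ;; Scale ::= V Scale \<otimes> V Scale"

lemma (in convolution) completes_compute_scale:
  assumes "v Tab_Len = int T"
  shows "completes compute_scale (v, a) 5 (v(Scale := int scale), a)"
proof -
  let ?square = "Scale ::= V Scale \<otimes> V Scale"
  have first: "completes (Scale ::= V Tab_Len \<otimes> V Tab_Len) (v, a) 1 (v(Scale := int T ^ 2), a)"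
    using assms T_power_le_B'[of 2] by (intro completes_assign) (auto simp: power2_eq_square)
  have square: "completes ?square (v(Scale := int T ^ k), a) 1 (v(Scale := int T ^ (2 * k)), a)" if "2 * k \<le> 64" for k
  proof -
    have "completes ?square (v(Scale := int T ^ k), a) 1 ((v(Scale := int T ^ k))(Scale := int T ^ (2 * k)), a)"
      using T_power_le_B'[OF that] by (intro completes_assign) (auto simp: power_add mult_2)
    then show ?thesis by simp
  qed
  have "completes compute_scale (v, a) 5 (v(Scale := int T ^ (2 * (2 * (2 * (2 * 2))))), a)"
    unfolding compute_scale_def
    by (rule completes_weaken[OF completes_seq[OF first completes_seq[OF square completes_seq[OF square
          completes_seq[OF square square]]]]]) simp_all
  then show ?thesis by (simp add: scale_def)
qed

section \<open>One residue class\<close>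

subsection \<open>Merging codes\<close>

definition index_block :: "nat \<Rightarrow> nat \<Rightarrow> nat \<Rightarrow> nat set" where
  "index_block c j p = {p * 2 ^ j..<(p + 1) * 2 ^ j} \<inter> {..<c}"

lemma finite_index_block [simp]: "finite (index_block c j p)"
  by (simp add: index_block_def)

lemma card_index_block_le: "card (index_block c j p) \<le> 2 ^ j"
  using card_mono[of "{p * 2 ^ j..<(p + 1) * 2 ^ j}" "index_block c j p"] by (simp add: index_block_def)

lemma index_block_0: "index_block c 0 p = (if p < c then {p} else {})"
  by (auto simp: index_block_def)

lemma index_block_whole: "c \<le> 2 ^ j \<Longrightarrow> index_block c j 0 = {..<c}"
  by (auto simp: index_block_def)

lemma index_block_disjoint: "index_block c j (2 * p) \<inter> index_block c j (2 * p + 1) = {}"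
  and index_block_Suc: "index_block c (Suc j) p = index_block c j (2 * p) \<union> index_block c j (2 * p + 1)"
  by (auto simp: index_block_def algebra_simps)

lemma coded_sums_index_block_subset:
  assumes "q < W"
  shows "coded_sums W q w (index_block c j p) \<subseteq> {..<2 ^ Suc j * W}"
proof
  fix z assume "z \<in> coded_sums W q w (index_block c j p)"
  then have "z < (card (index_block c j p) + 1) * W" using assms by (rule coded_sums_less) simp
  also have "\<dots> \<le> (2 ^ j + 2 ^ j) * W"
    using card_index_block_le[of c j p] by (intro mult_le_mono1 add_mono) simp_all
  also have "\<dots> = 2 ^ Suc j * W" by simp
  finally show "z \<in> {..<2 ^ Suc j * W}" by simp
qed

lemma coded_sums_index_block_Suc:
  assumes "2 * q < W"
  shows "coded_sums W q w (index_block c (Suc j) p) =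
    {z \<in> coded_sums W q w (index_block c j (2 * p)) + coded_sums W q w (index_block c j (2 * p + 1)). z mod W \<le> q}"
  unfolding index_block_Suc using assms by (intro coded_sums_Un_disjoint index_block_disjoint) simp_all

definition codes_of_blocks :: "nat \<Rightarrow> nat \<Rightarrow> (nat \<Rightarrow> nat) \<Rightarrow> nat \<Rightarrow> nat \<Rightarrow> nat \<Rightarrow> (nat \<Rightarrow> int) \<Rightarrow> bool" where
  "codes_of_blocks W q w c m j f \<longleftrightarrow>
     (\<forall>p<m. represents (2 ^ Suc j * W) (\<lambda>i. f (p * (2 ^ Suc j * W) + i)) (coded_sums W q w (index_block c j p)))"

definition load_block :: "arr \<Rightarrow> exp \<Rightarrow> com" where
  "load_block k off = fill k (N 0) (Get Codes (off \<oplus> V Idx \<odot> V Half) \<otimes> is_zero (V Idx \<oslash> V Half)) (V Len)"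

definition merge_blocks :: com where
  "merge_blocks = Len ::= N 2 \<otimes> V Half ;; load_block XRe (V Offset) ;; load_block YRe (V Offset \<oplus> V Half) ;; convolve ;;
     fill Codes (V Offset) (Get XRe (V Idx) \<otimes> at_most (V Idx \<odot> V Width) (V Max_Quot)) (V Len) ;;
     Offset ::= V Offset \<oplus> V Len"

definition merge_level :: com where
  "merge_level = Offset ::= N 0 ;; While (V Offset) (V Code_Len) merge_blocks ;; Half ::= N 2 \<otimes> V Half"

definition merge_all :: com where
  "merge_all = While (V Half) (V Code_Len) merge_level"

lemma assigned_merges [simp]:
  "assigned_vars (load_block k off) = {Idx}" "assigned_arrs (load_block k off) = {k}"
  "assigned_vars merge_blocks = {Len, Idx, Stride, Offset}"
  "assigned_arrs merge_blocks = {XRe, XIm, YRe, YIm, BufRe, BufIm, Codes}"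
  "assigned_vars merge_level = {Len, Idx, Stride, Offset, Half}"
  "assigned_arrs merge_level = {XRe, XIm, YRe, YIm, BufRe, BufIm, Codes}"
  "assigned_vars merge_all = {Len, Idx, Stride, Offset, Half}"
  "assigned_arrs merge_all = {XRe, XIm, YRe, YIm, BufRe, BufIm, Codes}"
  by (auto simp: load_block_def merge_blocks_def merge_level_def merge_all_def)

locale subset_sum_instance =
  fixes u b :: nat and xs :: "nat list"
  assumes b_pos: "0 < b" and xs: "xs \<noteq> []" "distinct xs" "set xs \<subseteq> {..u}"
begin

abbreviation max_quot :: nat where "max_quot \<equiv> u div b"

definition width :: nat where "width = 2 ^ ceillog2 (2 * max_quot + 1)"

definition sum_len :: nat where "sum_len = 2 ^ ceillog2 (2 * u + 1)"

lemma two_max_quot_less_width: "2 * max_quot < width"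
  using le_two_power_ceillog2[of "2 * max_quot + 1"] unfolding width_def by linarith

lemma max_quot_less_width: "max_quot < width"
  using two_max_quot_less_width by linarith

lemma width_pos: "0 < width"
  by (simp add: width_def)

lemma two_u_less_sum_len: "2 * u < sum_len"
  using le_two_power_ceillog2[of "2 * u + 1"] unfolding sum_len_def by linarith

end

locale residue_class_algorithm = subset_sum_instance u b xs + convolution L B io_size
  for u b :: nat and xs :: "nat list" and L :: nat and B io_size :: int +
  assumes codes_fit: "4 * length xs * width \<le> T" and sum_len_le_T: "sum_len \<le> T"
begin

lemma le_B_if_le_T: "m \<le> T \<Longrightarrow> int m \<le> B"
  using T_le_B by linarith

definition parameters :: "state \<Rightarrow> bool" where
  "parameters s \<longleftrightarrow> fst s Bound = int u \<and> fst s Count = int (length xs) \<and> fst s Modulus = int b \<and>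
     fst s Max_Quot = int max_quot \<and> fst s Width = int width \<and> fst s Sum_Len = int sum_len \<and>
     fst s Scale = int scale \<and> twiddle_table (complex_arr (snd s) TabRe TabIm) \<and>
     (\<forall>i<length xs. snd s Input i = int (xs ! i))"

lemma parameters_unchanged:
  assumes "parameters s" "unchanged_outside c s s'"
    and "assigned_vars c \<inter> {Bound, Count, Modulus, Max_Quot, Width, Sum_Len, Scale} = {}"
      "assigned_arrs c \<inter> {TabRe, TabIm, Input} = {}"
  shows "parameters s'"
proof -
  have "fst s' x = fst s x" if "x \<in> {Bound, Count, Modulus, Max_Quot, Width, Sum_Len, Scale}" for x
    using assms(2,3) that unfolding unchanged_outside_def by blast
  moreover have "snd s' k = snd s k" if "k \<in> {TabRe, TabIm, Input}" for k
    using assms(2,4) that unfolding unchanged_outside_def by blast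
  moreover from this have "complex_arr (snd s') TabRe TabIm = complex_arr (snd s) TabRe TabIm"
    by (simp add: complex_arr_def fun_eq_iff)
  ultimately show ?thesis using assms(1) by (simp add: parameters_def)
qed

lemma fft_ready_if_parameters:
  "parameters (v, a) \<Longrightarrow> v Len = int (2 ^ h) \<Longrightarrow> 2 ^ h \<le> T \<Longrightarrow> fft_ready (2 ^ h) h (v, a)"
  by (simp add: parameters_def fft_ready_def)

lemma completes_load_block:
  assumes array: "k \<notin> {Codes, IO}" and vals: "v Half = int D" "v Len = int (2 * D)" "2 * D \<le> T"
    and offset: "\<And>i a'. safe e (v(Idx := int i), a') \<and> aval e (v(Idx := int i), a') = int off"
    and X_represented: "represents D (\<lambda>i. a Codes (off + i)) X" "X \<subseteq> {..<D}"
  shows "\<exists>a'. completes (load_block k e) (v, a) (6 * D + 2) (v(Idx := int (2 * D)), a') \<and> represents (2 * D) (a' k) X"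
proof -
  define a' where "a' = a(k := overwrite 0 (2 * D) (\<lambda>i. of_bool (i \<in> X)) (a k))"
  have "completes (load_block k e) (v, a) (3 * (2 * D) + 2) (v(Idx := int (2 * D)), a')"
    unfolding load_block_def a'_def
  proof (rule completes_fill)
    fix i assume i_less: "i < 2 * D"
    let ?s = "(v(Idx := int i), a(k := overwrite 0 i (\<lambda>i. of_bool (i \<in> X)) (a k)))"
    have "a Codes (off + i mod D) = of_bool (i mod D \<in> X)" using X_represented(1) i_less by (simp add: represents_def)
    moreover have "nat (int off + int i mod int D) = off + i mod D" "int i div int D = 0 \<longleftrightarrow> i < D"
      using i_less by (simp_all add: nat_add_distrib div_eq_0_iff flip: of_nat_mod of_nat_div)
    moreover have "0 \<le> int off + int i mod int D" using i_less by simp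
    moreover have "i mod D \<in> X \<and> i < D \<longleftrightarrow> i \<in> X" using X_represented(2) by auto
    ultimately show "safe (Get Codes (e \<oplus> V Idx \<odot> V Half) \<otimes> is_zero (V Idx \<oslash> V Half)) ?s \<and>
      aval (Get Codes (e \<oplus> V Idx \<odot> V Half) \<otimes> is_zero (V Idx \<oslash> V Half)) ?s = of_bool (i \<in> X) \<and> \<bar>of_bool (i \<in> X)\<bar> \<le> B"
      using offset[of i] array vals(1) sixty_four_le_B by (auto simp: valid_index_def)
  qed (use array vals le_B_if_le_T[of "2 * D"] in auto)
  moreover have "represents (2 * D) (a' k) X" by (simp add: represents_def a'_def)
  ultimately show ?thesis by auto
qed

lemma completes_store_merged:
  assumes params: "parameters (v, a)" and vals: "v Len = int n" "v Offset = int off"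
    and n_fits: "n \<le> T" "int (off + n) \<le> B"
    and X_represented: "represents n (a XRe) X"
  shows "completes (fill Codes (V Offset) (Get XRe (V Idx) \<otimes> at_most (V Idx \<odot> V Width) (V Max_Quot)) (V Len) ;;
      Offset ::= V Offset \<oplus> V Len) (v, a) (3 * n + 3)
    (v(Idx := int n, Offset := int (off + n)),
     a(Codes := overwrite off n (\<lambda>i. of_bool (i \<in> X \<and> i mod width \<le> max_quot)) (a Codes)))"
proof -
  let ?f = "\<lambda>i. of_bool (i \<in> X \<and> i mod width \<le> max_quot)"
  have filling: "completes (fill Codes (V Offset) (Get XRe (V Idx) \<otimes> at_most (V Idx \<odot> V Width) (V Max_Quot)) (V Len)) (v, a)
      (3 * n + 2) (v(Idx := int n), a(Codes := overwrite off n ?f (a Codes)))"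
  proof (rule completes_fill)
    fix i assume i_less: "i < n"
    let ?s = "(v(Idx := int i), a(Codes := overwrite off i ?f (a Codes)))"
    have "aval (at_most (V Idx \<odot> V Width) (V Max_Quot)) ?s = of_bool (i mod width \<le> max_quot)"
      using params by (intro aval_at_most) (simp_all add: parameters_def zmod_int)
    then show "safe (Get XRe (V Idx) \<otimes> at_most (V Idx \<odot> V Width) (V Max_Quot)) ?s \<and>
        aval (Get XRe (V Idx) \<otimes> at_most (V Idx \<odot> V Width) (V Max_Quot)) ?s = ?f i \<and> \<bar>?f i\<bar> \<le> B"
      using i_less X_represented sixty_four_le_B by (auto simp: represents_def)
  qed (use vals le_B_if_le_T[OF n_fits(1)] in auto)
  have advance: "completes (Offset ::= V Offset \<oplus> V Len) (v(Idx := int n), a(Codes := overwrite off n ?f (a Codes))) 1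
      (v(Idx := int n, Offset := int (off + n)), a(Codes := overwrite off n ?f (a Codes)))"
    by (rule completes_assign) (use vals n_fits(2) in auto)
  show ?thesis by (rule completes_weaken[OF completes_seq[OF filling advance]]) simp
qed

lemma merge_blocks_time:
  assumes "2 * D = (2::nat) ^ h" "2 * D \<le> 2 ^ l"
  shows "1 + (6 * D + 2 + (6 * D + 2 + (66 * (2 * D) * (h + 1) + (3 * (2 * D) + 3)))) \<le> 2 * D * (83 * (l + 1))"
proof -
  have "(2::nat) ^ h \<le> 2 ^ l" using assms by simp
  then have "66 * (2 * D) * (h + 1) \<le> 66 * (2 * D) * (l + 1)" by (intro mult_le_mono2) simp
  moreover have "17 * (2 * D) \<le> 17 * (2 * D) * (l + 1)" by simp
  moreover have "1 \<le> D" using assms(1) by (cases D) auto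
  moreover have "2 * D * (83 * (l + 1)) = 66 * (2 * D) * (l + 1) + 17 * (2 * D) * (l + 1)"
    by (simp add: algebra_simps)
  ultimately show ?thesis by linarith
qed

lemma completes_merge_blocks:
  assumes params: "parameters (v, a)" and vals: "v Half = int D" "v Offset = int off"
    and D_fits: "2 * D = 2 ^ h" "2 * D \<le> T" "int (off + 2 * D) \<le> B"
    and X_represented: "represents D (\<lambda>i. a Codes (off + i)) X" "X \<subseteq> {..<D}"
    and Y_represented: "represents D (\<lambda>i. a Codes (off + D + i)) Y" "Y \<subseteq> {..<D}"
  shows "\<exists>v' a'. completes merge_blocks (v, a) (2 * D * (83 * (L + 1))) (v', a') \<and> v' Offset = int (off + 2 * D) \<and>
    a' Codes = overwrite off (2 * D) (\<lambda>i. of_bool (i \<in> X + Y \<and> i mod width \<le> max_quot)) (a Codes)"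
proof -
  let ?v0 = "v(Len := int (2 * D))" let ?v1 = "?v0(Idx := int (2 * D))"
  have start: "completes (Len ::= N 2 \<otimes> V Half) (v, a) 1 (?v0, a)"
    by (rule completes_assign) (use vals le_B_if_le_T[OF D_fits(2)] in auto)
  obtain a1 where load_X: "completes (load_block XRe (V Offset)) (?v0, a) (6 * D + 2) (?v1, a1)"
    "represents (2 * D) (a1 XRe) X"
    using completes_load_block[of XRe ?v0 D "V Offset" off a X] vals D_fits(2) X_represented by auto
  have "a1 Codes = a Codes" using completes_unchanged_arrs[OF load_X(1)] by simp
  then obtain a2 where load_Y: "completes (load_block YRe (V Offset \<oplus> V Half)) (?v1, a1) (6 * D + 2) (?v1, a2)"
    "represents (2 * D) (a2 YRe) Y"
    using completes_load_block[of YRe ?v1 D "V Offset \<oplus> V Half" "off + D" a1 Y] vals D_fits(2) Y_represented by auto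
  have params0: "parameters (?v0, a)" using params by (simp add: parameters_def)
  have params1: "parameters (?v1, a1)"
    using parameters_unchanged[OF params0 completes_unchanged_outside[OF load_X(1)]] by simp
  have params2: "parameters (?v1, a2)"
    using parameters_unchanged[OF params1 completes_unchanged_outside[OF load_Y(1)]] by simp
  have "represents (2 * D) (a2 XRe) X" using load_X(2) completes_unchanged_arrs[OF load_Y(1)] by simp
  moreover have "X \<subseteq> {..<2 * D}" "Y \<subseteq> {..<2 * D}" using X_represented(2) Y_represented(2) by auto
  moreover have "X + Y \<subseteq> {..<2 * D}" using X_represented(2) Y_represented(2) by (force elim!: set_plus_elim)
  moreover have "fft_ready (2 * D) h (?v1, a2)" using fft_ready_if_parameters[OF params2, of h] D_fits by simp
  ultimately obtain v3 a3 where conv: "completes convolve (?v1, a2) (66 * (2 * D) * (h + 1)) (v3, a3)"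
    "represents (2 * D) (a3 XRe) (X + Y)"
    using completes_convolve[where n = "2 * D" and Y = Y] load_Y(2) by blast
  have params3: "parameters (v3, a3)" using parameters_unchanged[OF params2 completes_unchanged_outside[OF conv(1)]]
    by simp
  have vals3: "v3 Len = int (2 * D)" "v3 Offset = int off" using completes_unchanged_vars[OF conv(1)] vals by simp_all
  note store = completes_store_merged[OF params3 vals3 D_fits(2,3) conv(2)]
  have "a3 Codes = a Codes"
    using completes_unchanged_arrs[OF load_X(1)] completes_unchanged_arrs[OF load_Y(1)]
      completes_unchanged_arrs[OF conv(1)]
    by simp
  moreover have "completes merge_blocks (v, a) (1 + (6 * D + 2 + (6 * D + 2 + (66 * (2 * D) * (h + 1) + (3 * (2 * D) + 3)))))
      (v3(Idx := int (2 * D), Offset := int (off + 2 * D)),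
       a3(Codes := overwrite off (2 * D) (\<lambda>i. of_bool (i \<in> X + Y \<and> i mod width \<le> max_quot)) (a3 Codes)))"
    unfolding merge_blocks_def
    by (rule completes_seq[OF start completes_seq[OF load_X(1) completes_seq[OF load_Y(1)
        completes_seq[OF conv(1) store]]]])
  moreover have "1 + (6 * D + 2 + (6 * D + 2 + (66 * (2 * D) * (h + 1) + (3 * (2 * D) + 3)))) \<le>
      2 * D * (83 * (L + 1))"
    using D_fits(1,2) unfolding T_def by (rule merge_blocks_time)
  ultimately show ?thesis using completes_weaken by fastforce
qed

definition merge_progress :: "(nat \<Rightarrow> nat) \<Rightarrow> nat \<Rightarrow> nat \<Rightarrow> (nat \<Rightarrow> int) \<Rightarrow> nat \<Rightarrow> state \<Rightarrow> bool" where
  "merge_progress w c j f p s \<longleftrightarrow> fst s Offset = int (p * (2 ^ Suc (Suc j) * width)) \<and>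
     (\<forall>i\<ge>p * (2 ^ Suc (Suc j) * width). snd s Codes i = f i) \<and>
     codes_of_blocks width max_quot w c p (Suc j) (snd s Codes)"

lemma codes_of_blocks_overwrite:
  assumes old: "codes_of_blocks W q w c p j f" and D_eq: "D = 2 ^ Suc j * W"
    and block: "\<And>i. i < D \<Longrightarrow> g i = of_bool (i \<in> coded_sums W q w (index_block c j p))"
  shows "codes_of_blocks W q w c (Suc p) j (overwrite (p * D) D g f)"
  unfolding codes_of_blocks_def D_eq[symmetric]
proof (intro allI impI)
  fix p' assume p'_less: "p' < Suc p"
  show "represents D (\<lambda>i. overwrite (p * D) D g f (p' * D + i)) (coded_sums W q w (index_block c j p'))"
  proof (cases "p' = p")
    case True
    then show ?thesis using block by (simp add: represents_def overwrite_def)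
  next
    case False
    then have "(p' + 1) * D \<le> p * D" using p'_less by (intro mult_le_mono1) simp
    moreover have "represents D (\<lambda>i. f (p' * D + i)) (coded_sums W q w (index_block c j p'))"
      using old p'_less False by (simp add: codes_of_blocks_def D_eq)
    ultimately show ?thesis by (simp add: represents_def overwrite_def)
  qed
qed

lemma completes_merge_step:
  assumes params: "parameters (v, a)" and D_eq: "D = 2 ^ Suc j * width" and vals: "v Half = int D"
    and fits: "m * (2 * D) \<le> T" and p_less: "p < m" and codes: "codes_of_blocks width max_quot w c (2 * m) j f"
    and progress: "merge_progress w c j f p (v, a)"
  shows "\<exists>v' a'. completes merge_blocks (v, a) (2 * D * (83 * (L + 1))) (v', a') \<and>
      merge_progress w c j f (Suc p) (v', a')"
proof -
  let ?sums = "\<lambda>r. coded_sums width max_quot w (index_block c j (2 * p + r))"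
  let ?g = "\<lambda>i. of_bool (i \<in> ?sums 0 + ?sums 1 \<and> i mod width \<le> max_quot)"
  have power: "2 * D = 2 ^ (Suc (Suc j) + ceillog2 (2 * max_quot + 1))" by (simp add: D_eq width_def power_add)
  have D_Suc: "2 ^ Suc (Suc j) * width = 2 * D" by (simp add: D_eq)
  note progress = progress[unfolded merge_progress_def D_Suc fst_conv snd_conv]
  have old: "represents D (\<lambda>i. a Codes (p * (2 * D) + r * D + i)) (?sums r)" if "r < 2" for r
  proof -
    have "2 * p + r < 2 * m" using p_less that by linarith
    then have "represents D (\<lambda>i. f ((2 * p + r) * D + i)) (?sums r)"
      using codes unfolding codes_of_blocks_def D_eq by blast
    moreover have "(2 * p + r) * D = p * (2 * D) + r * D" by (simp add: algebra_simps)
    moreover have "a Codes (p * (2 * D) + r * D + i) = f (p * (2 * D) + r * D + i)" for i using progress by simp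
    ultimately show ?thesis by simp
  qed
  have sums_D: "?sums r \<subseteq> {..<D}" for r unfolding D_eq by (rule coded_sums_index_block_subset[OF max_quot_less_width])
  have "(p + 1) * (2 * D) \<le> m * (2 * D)" using p_less by (intro mult_le_mono1) simp
  then have "2 * D \<le> T" "int (p * (2 * D) + 2 * D) \<le> B"
    using fits le_B_if_le_T[of "p * (2 * D) + 2 * D"] by (simp_all add: algebra_simps)
  moreover have "v Offset = int (p * (2 * D))" using progress by blast
  moreover have "represents D (\<lambda>i. a Codes (p * (2 * D) + i)) (?sums 0)"
    "represents D (\<lambda>i. a Codes (p * (2 * D) + D + i)) (?sums 1)" using old[of 0] old[of 1] by simp_all
  ultimately obtain v' a' where merge: "completes merge_blocks (v, a) (2 * D * (83 * (L + 1))) (v', a')"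
    "v' Offset = int (p * (2 * D) + 2 * D)" "a' Codes = overwrite (p * (2 * D)) (2 * D) ?g (a Codes)"
    using completes_merge_blocks[OF params vals _ power] sums_D by blast
  have "codes_of_blocks width max_quot w c (Suc p) (Suc j) (a' Codes)"
    unfolding merge(3)
    by (rule codes_of_blocks_overwrite)
      (use progress coded_sums_index_block_Suc[OF two_max_quot_less_width] D_eq in auto)
  moreover have "\<forall>i\<ge>Suc p * (2 * D). a' Codes i = f i" using progress unfolding merge(3) by (simp add: overwrite_def)
  ultimately have "merge_progress w c j f (Suc p) (v', a')"
    unfolding merge_progress_def D_Suc using merge(2) by (simp add: add.commute)
  then show ?thesis using merge(1) by blast
qed

lemma merge_level_time:
  fixes m D l :: nat
  assumes "0 < m" "0 < D"
  shows "1 + ((\<Sum>p<m. 2 * D * (83 * (l + 1)) + 1) + 1 + 1) \<le> m * (2 * D) * (88 * (l + 1))"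
proof -
  have "m * 1 \<le> m * (2 * D)" using assms(2) by (intro mult_le_mono2) simp
  moreover have "1 + ((\<Sum>p<m. 2 * D * (83 * (l + 1)) + 1) + 1 + 1) = m * (2 * D) * (83 * (l + 1)) + m + 3" by simp
  moreover have "m * (2 * D) * (88 * (l + 1)) = m * (2 * D) * (83 * (l + 1)) + 5 * (m * (2 * D)) * (l + 1)"
    by (simp add: algebra_simps)
  moreover have "5 * (m * (2 * D)) \<le> 5 * (m * (2 * D)) * (l + 1)" by simp
  ultimately show ?thesis using assms(1) by linarith
qed

lemma completes_merge_level:
  assumes params: "parameters (v, a)" and D_eq: "D = 2 ^ Suc j * width"
    and vals: "v Half = int D" "v Code_Len = int (m * (2 * D))" and fits: "m * (2 * D) \<le> T" "0 < m"
    and codes: "codes_of_blocks width max_quot w c (2 * m) j (a Codes)"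
  shows "\<exists>v' a'. completes merge_level (v, a) (m * (2 * D) * (88 * (L + 1))) (v', a') \<and>
    v' Half = int (2 * D) \<and> codes_of_blocks width max_quot w c m (Suc j) (a' Codes)"
proof -
  have D_Suc: "2 ^ Suc (Suc j) * width = 2 * D" by (simp add: D_eq)
  have D_pos: "0 < D" using width_pos by (simp add: D_eq)
  let ?v = "v(Offset := 0)" and ?Inv = "merge_progress w c j (a Codes)"
  have start: "completes (Offset ::= N 0) (v, a) 1 (?v, a)"
    by (rule completes_assign) (use sixty_four_le_B in auto)
  have "\<exists>s'. completes (While (V Offset) (V Code_Len) merge_blocks) (?v, a) ((\<Sum>p<m. 2 * D * (83 * (L + 1)) + 1) + 1) s' \<and> ?Inv m s'"
  proof (rule completes_while)
    show "?Inv 0 (?v, a)" by (simp add: merge_progress_def codes_of_blocks_def)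
  next
    fix p s' assume p_less: "p < m" and invariant: "?Inv p s'"
      and unchanged: "unchanged_outside merge_blocks (?v, a) s'"
    obtain v' a' where state: "s' = (v', a')" by (cases s')
    have "parameters (?v, a)" using params by (simp add: parameters_def)
    then have "parameters (v', a')" using parameters_unchanged[OF _ unchanged] unfolding state by simp
    moreover have vals': "v' Half = int D" "v' Code_Len = int (m * (2 * D))" "v' Offset = int (p * (2 * D))"
      using unchanged vals invariant unfolding state merge_progress_def D_Suc unchanged_outside_def by simp_all
    ultimately have "\<exists>s''. completes merge_blocks s' (2 * D * (83 * (L + 1))) s'' \<and> ?Inv (Suc p) s''"
      using completes_merge_step[OF _ D_eq _ fits(1) p_less codes] invariant unfolding state by blast
    moreover have "p * (2 * D) < m * (2 * D)" using p_less D_pos by simp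
    then have "v' Offset < v' Code_Len" unfolding vals' of_nat_less_iff .
    ultimately show "safe (V Offset) s' \<and> safe (V Code_Len) s' \<and> aval (V Offset) s' < aval (V Code_Len) s' \<and>
        (\<exists>s''. completes merge_blocks s' (2 * D * (83 * (L + 1))) s'' \<and> ?Inv (Suc p) s'')" by (simp add: state)
  next
    fix s' assume "?Inv m s'" "unchanged_outside merge_blocks (?v, a) s'"
    then show "safe (V Offset) s' \<and> safe (V Code_Len) s' \<and> \<not> aval (V Offset) s' < aval (V Code_Len) s'"
      using vals unfolding merge_progress_def D_Suc unchanged_outside_def by simp
  qed
  then obtain v' a' where loop: "completes (While (V Offset) (V Code_Len) merge_blocks) (?v, a)
      ((\<Sum>p<m. 2 * D * (83 * (L + 1)) + 1) + 1) (v', a')" and invariant: "?Inv m (v', a')" by (metis surj_pair)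
  have "v' Half = int D" using completes_unchanged_vars[OF loop] vals by simp
  moreover have "2 * D \<le> m * (2 * D)" using fits(2) by simp
  then have "int (2 * D) \<le> B" using fits(1) by (intro le_B_if_le_T) linarith
  ultimately have double: "completes (Half ::= N 2 \<otimes> V Half) (v', a') 1 (v'(Half := int (2 * D)), a')"
    by (intro completes_assign) auto
  have "completes merge_level (v, a) (m * (2 * D) * (88 * (L + 1))) (v'(Half := int (2 * D)), a')"
    unfolding merge_level_def
    by (rule completes_weaken[OF completes_seq[OF start
        completes_seq[OF loop double]] merge_level_time[OF fits(2) D_pos]])
  moreover have "codes_of_blocks width max_quot w c m (Suc j) (a' Codes)" using invariant
    by (simp add: merge_progress_def)
  ultimately show ?thesis by fastforce
qed

lemma completes_merge_all:
  assumes params: "parameters (v, a)" and vals: "v Half = int (2 * width)" "v Code_Len = int (2 ^ Suc h * width)"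
    and fits: "2 ^ Suc h * width \<le> T" and codes: "codes_of_blocks width max_quot w c (2 ^ h) 0 (a Codes)"
  shows "\<exists>v' a'. completes merge_all (v, a) (h * (2 ^ Suc h * width * (89 * (L + 1))) + 1) (v', a') \<and>
    codes_of_blocks width max_quot w c 1 h (a' Codes)"
proof -
  let ?E = "2 ^ Suc h * width"
  define Inv where "Inv = (\<lambda>j s. fst s Half = int (2 ^ Suc j * width) \<and>
    codes_of_blocks width max_quot w c (2 ^ (h - j)) j (snd s Codes))"
  have "\<exists>s'. completes (While (V Half) (V Code_Len) merge_level) (v, a) ((\<Sum>j<h. ?E * (88 * (L + 1)) + 1) + 1) s' \<and>
      Inv h s'"
  proof (rule completes_while)
    show "Inv 0 (v, a)" using vals codes by (simp add: Inv_def)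
  next
    fix j s' assume j_less: "j < h" and invariant: "Inv j s'" and unchanged: "unchanged_outside merge_level (v, a) s'"
    obtain v' a' where state: "s' = (v', a')" by (cases s')
    define D where "D = 2 ^ Suc j * width"
    have "2 ^ (h - Suc j) * (2 * D) = 2 * (2 * 2 ^ j * 2 ^ (h - Suc j)) * width" by (simp add: D_def)
    then have blocks: "2 ^ (h - Suc j) * (2 * D) = ?E" unfolding two_power_split[OF j_less] by simp
    have params': "parameters (v', a')" using parameters_unchanged[OF params unchanged] unfolding state by simp
    have vals': "v' Half = int D" "v' Code_Len = int ?E"
      and codes': "codes_of_blocks width max_quot w c (2 * 2 ^ (h - Suc j)) j (a' Codes)"
      using unchanged vals invariant unfolding state Inv_def unchanged_outside_def two_power_diff[OF j_less] D_def
      by simp_all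
    from completes_merge_level[OF params' D_def vals'(1) _ _ _ codes', unfolded blocks, OF vals'(2) fits]
    obtain v'' a'' where "completes merge_level (v', a') (?E * (88 * (L + 1))) (v'', a'')" "v'' Half = int (2 * D)"
      "codes_of_blocks width max_quot w c (2 ^ (h - Suc j)) (Suc j) (a'' Codes)" by auto
    then have "\<exists>s''. completes merge_level s' (?E * (88 * (L + 1))) s'' \<and> Inv (Suc j) s''"
      unfolding state Inv_def by (intro exI[of _ "(v'', a'')"]) (simp add: D_def)
    moreover have "2 ^ Suc j * width < ?E" using j_less width_pos by simp
    then have "v' Half < v' Code_Len" unfolding vals' D_def of_nat_less_iff .
    ultimately show "safe (V Half) s' \<and> safe (V Code_Len) s' \<and> aval (V Half) s' < aval (V Code_Len) s' \<and>
        (\<exists>s''. completes merge_level s' (?E * (88 * (L + 1))) s'' \<and> Inv (Suc j) s'')" by (simp add: state)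
  next
    fix s' assume "Inv h s'" "unchanged_outside merge_level (v, a) s'"
    then show "safe (V Half) s' \<and> safe (V Code_Len) s' \<and> \<not> aval (V Half) s' < aval (V Code_Len) s'"
      using vals by (simp add: Inv_def unchanged_outside_def)
  qed
  then obtain v' a' where loop: "completes merge_all (v, a) ((\<Sum>j<h. ?E * (88 * (L + 1)) + 1) + 1) (v', a')"
    "Inv h (v', a')"
    unfolding merge_all_def by (metis surj_pair)
  have "?E * (88 * (L + 1)) + 1 \<le> ?E * (89 * (L + 1))" using width_pos by (simp add: algebra_simps Suc_le_eq)
  then have "h * (?E * (88 * (L + 1)) + 1) \<le> h * (?E * (89 * (L + 1)))" by (rule mult_le_mono2)
  then have "(\<Sum>j<h. ?E * (88 * (L + 1)) + 1) + 1 \<le> h * (?E * (89 * (L + 1))) + 1" by simp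
  from completes_weaken[OF loop(1) this] show ?thesis using loop(2) by (auto simp: Inv_def)
qed

end

subsection \<open>Codes of a residue class\<close>

definition filter_class :: com where
  "filter_class = Class_Size ::= N 0 ;; for_upto (V Count)
     (Put Quots (V Class_Size) (Get Input (V Idx) \<oslash> V Modulus) ;;
      Class_Size ::= V Class_Size \<oplus> is_zero (Get Input (V Idx) \<odot> V Modulus \<ominus> V Residue))"

definition leaf_exp :: exp where
  "leaf_exp = is_zero (V Idx \<odot> V Half) \<oplus> at_most (V Idx \<oslash> V Half \<oplus> N 1) (V Class_Size) \<otimes>
     is_zero (V Idx \<odot> V Half \<ominus> V Width \<ominus> Get Quots (V Idx \<oslash> V Half))"

definition compute_leaves :: com where
  "compute_leaves = filter_class ;; next_power Leaves (V Class_Size) ;; Half ::= N 2 \<otimes> V Width ;;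
     Code_Len ::= V Leaves \<otimes> V Half ;; fill Codes (N 0) leaf_exp (V Code_Len)"

definition compute_codes :: com where
  "compute_codes = compute_leaves ;; merge_all"

lemma assigned_class_commands [simp]:
  "assigned_vars filter_class = {Idx, Class_Size}" "assigned_arrs filter_class = {Quots}"
  "assigned_vars compute_leaves = {Idx, Class_Size, Leaves, Half, Code_Len}"
  "assigned_arrs compute_leaves = {Quots, Codes}"
  "assigned_vars compute_codes = {Idx, Class_Size, Leaves, Half, Code_Len, Len, Stride, Offset}"
  "assigned_arrs compute_codes = {Quots, Codes, XRe, XIm, YRe, YIm, BufRe, BufIm}"
  by (auto simp: filter_class_def compute_leaves_def compute_codes_def)

context residue_class_algorithm
begin

definition residue_class :: "nat \<Rightarrow> nat list" where
  "residue_class l = filter (\<lambda>x. x mod b = l) xs"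

definition quotient :: "nat \<Rightarrow> nat \<Rightarrow> nat" where
  "quotient l i = residue_class l ! i div b"

definition code_len :: "nat \<Rightarrow> nat" where
  "code_len l = 2 ^ Suc (ceillog2 (length (residue_class l))) * width"

lemma length_residue_class_le: "length (residue_class l) \<le> length xs"
  by (simp add: residue_class_def)

lemma xs_le_u: "x \<in> set xs \<Longrightarrow> x \<le> u"
  using xs(3) by auto

lemma quotient_le: "i < length (residue_class l) \<Longrightarrow> quotient l i \<le> max_quot"
  using nth_mem[of i "residue_class l"] xs_le_u unfolding quotient_def residue_class_def
  by (intro div_le_mono) simp

lemma code_len_le: "code_len l \<le> 4 * length (residue_class l) * width + 2 * width"
proof (cases "length (residue_class l) = 0")
  case False
  then have "2 ^ Suc (ceillog2 (length (residue_class l))) \<le> 4 * length (residue_class l)"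
    using two_power_ceillog2_gt[of "length (residue_class l)"] by simp
  then have "code_len l \<le> 4 * length (residue_class l) * width" unfolding code_len_def by (rule mult_le_mono1)
  then show ?thesis by simp
qed (simp add: code_len_def)

lemma code_len_le_T: "code_len l \<le> T"
proof -
  have "2 ^ Suc (ceillog2 (length (residue_class l))) \<le> 4 * length xs"
  proof (cases "length (residue_class l) = 0")
    case True
    then show ?thesis using xs(1) by (cases xs) simp_all
  next
    case False
    then show ?thesis using two_power_ceillog2_gt[of "length (residue_class l)"] length_residue_class_le[of l] by simp
  qed
  then have "code_len l \<le> 4 * length xs * width" unfolding code_len_def by (rule mult_le_mono1)
  also have "\<dots> \<le> T" by (rule codes_fit)
  finally show ?thesis .
qed

lemma length_xs_le_T: "4 * length xs \<le> T"
proof -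
  have "4 * length xs * 1 \<le> 4 * length xs * width" using width_pos by (intro mult_le_mono2) simp
  then show ?thesis using codes_fit by linarith
qed

lemma u_le_T: "u \<le> T"
  using two_u_less_sum_len sum_len_le_T by linarith

definition class_prefix :: "nat \<Rightarrow> nat \<Rightarrow> nat list" where
  "class_prefix l k = filter (\<lambda>x. x mod b = l) (take k xs)"

lemma class_prefix_Suc:
  "k < length xs \<Longrightarrow> class_prefix l (Suc k) = class_prefix l k @ (if xs ! k mod b = l then [xs ! k] else [])"
  by (simp add: class_prefix_def take_Suc_conv_app_nth)

lemma length_class_prefix_le_B: "int (length (class_prefix l k)) \<le> B"
proof (rule le_B_if_le_T)
  have "length (class_prefix l k) \<le> length (take k xs)" unfolding class_prefix_def by (rule length_filter_le)
  then show "length (class_prefix l k) \<le> T" using length_xs_le_T by simp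
qed

lemma completes_filter_step:
  assumes params: "parameters (v, a)"
    and loop_vals: "v Residue = int l" "v Idx = int k" "v Class_Size = int (length (class_prefix l k))"
    and k_less: "k < length xs"
  shows "completes (Put Quots (V Class_Size) (Get Input (V Idx) \<oslash> V Modulus) ;;
      Class_Size ::= V Class_Size \<oplus> is_zero (Get Input (V Idx) \<odot> V Modulus \<ominus> V Residue)) (v, a) 2
    (v(Class_Size := int (length (class_prefix l (Suc k)))),
     a(Quots := (a Quots)(length (class_prefix l k) := int (xs ! k div b))))"
proof -
  let ?count = "V Class_Size \<oplus> is_zero (Get Input (V Idx) \<odot> V Modulus \<ominus> V Residue)"
  let ?a' = "a(Quots := (a Quots)(length (class_prefix l k) := int (xs ! k div b)))"
  have vals: "v Modulus = int b" "a Input k = int (xs ! k)" using params k_less by (simp_all add: parameters_def)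
  have "xs ! k div b \<le> xs ! k" "xs ! k \<le> u" using xs_le_u k_less by simp_all
  then have "int (xs ! k div b) \<le> B" using u_le_T by (intro le_B_if_le_T) linarith
  then have put: "completes (Put Quots (V Class_Size) (Get Input (V Idx) \<oslash> V Modulus)) (v, a) 1 (v, ?a')"
    using loop_vals vals by (intro completes_put) (simp_all flip: of_nat_div)
  have "int (xs ! k) mod int b = int l \<longleftrightarrow> xs ! k mod b = l" by (simp flip: of_nat_mod)
  then have "aval ?count (v, ?a') = int (length (class_prefix l (Suc k)))"
    using loop_vals vals by (simp add: class_prefix_Suc[OF k_less])
  then have count: "completes (Class_Size ::= ?count) (v, ?a') 1 (v(Class_Size := int (length (class_prefix l (Suc k)))), ?a')"
    using loop_vals length_class_prefix_le_B[of l "Suc k"] by (intro completes_assign) simp_all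
  show ?thesis by (rule completes_weaken[OF completes_seq[OF put count]]) simp
qed

lemma completes_filter_class:
  assumes params: "parameters (v, a)" and Residue: "v Residue = int l"
  shows "\<exists>v' a'. completes filter_class (v, a) (4 * length xs + 3) (v', a') \<and>
    v' Class_Size = int (length (residue_class l)) \<and> (\<forall>i<length (residue_class l). a' Quots i = int (quotient l i))"
proof -
  let ?body = "Put Quots (V Class_Size) (Get Input (V Idx) \<oslash> V Modulus) ;;
    Class_Size ::= V Class_Size \<oplus> is_zero (Get Input (V Idx) \<odot> V Modulus \<ominus> V Residue)"
  let ?found = "class_prefix l" and ?v = "v(Class_Size := 0)"
  define Inv where "Inv = (\<lambda>k s. fst s Idx = int k \<and> fst s Class_Size = int (length (?found k)) \<and>
     (\<forall>i<length (?found k). snd s Quots i = int (?found k ! i div b)))"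
  have params': "parameters (?v, a)" using params by (simp add: parameters_def)
  have start: "completes (Class_Size ::= N 0) (v, a) 1 (?v, a)"
    by (rule completes_assign) (use sixty_four_le_B in auto)
  have "\<exists>v' a'. completes (for_upto (V Count) ?body) (?v, a) (length xs * (2 + 2) + 2) (v', a') \<and>
      Inv (length xs) (v', a')"
  proof (rule completes_for_upto)
    show "Inv 0 (?v(Idx := 0), a)" by (simp add: Inv_def class_prefix_def)
    show "int (length xs) \<le> B" by (rule le_B_if_le_T) (use length_xs_le_T in linarith)
  next
    fix k v' a' assume "Inv k (v', a')" "unchanged_outside (for_upto (V Count) ?body) (?v, a) (v', a')"
    then show "v' Idx = int k \<and> safe (V Count) (v', a') \<and> aval (V Count) (v', a') = int (length xs)"
      using params by (simp add: Inv_def unchanged_outside_def parameters_def)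
  next
    fix k v' a' assume k_less: "k < length xs" and invariant: "Inv k (v', a')" and Idx: "v' Idx = int k"
      and unchanged: "unchanged_outside (for_upto (V Count) ?body) (?v, a) (v', a')"
    let ?v'' = "v'(Class_Size := int (length (?found (Suc k))))"
    let ?a'' = "a'(Quots := (a' Quots)(length (?found k) := int (xs ! k div b)))"
    have "parameters (v', a')" using parameters_unchanged[OF params' unchanged] by simp
    then have "completes ?body (v', a') 2 (?v'', ?a'')"
      using unchanged Residue Idx invariant k_less
      by (intro completes_filter_step) (simp_all add: unchanged_outside_def Inv_def)
    moreover have "Inv (Suc k) (?v''(Idx := int (Suc k)), ?a'')"
      using invariant by (auto simp: Inv_def class_prefix_Suc[OF k_less] nth_append less_Suc_eq)
    ultimately show "\<exists>v'' a''. completes ?body (v', a') 2 (v'', a'') \<and> v'' Idx = int k \<and>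
        Inv (Suc k) (v''(Idx := int (Suc k)), a'')" using Idx by (intro exI conjI) (assumption, simp_all)
  qed
  then obtain v' a' where loop: "completes (for_upto (V Count) ?body) (?v, a) (length xs * (2 + 2) + 2) (v', a')"
    "Inv (length xs) (v', a')" by blast
  have "completes filter_class (v, a) (4 * length xs + 3) (v', a')"
    unfolding filter_class_def by (rule completes_weaken[OF completes_seq[OF start loop(1)]]) simp
  moreover have "?found (length xs) = residue_class l" by (simp add: class_prefix_def residue_class_def)
  ultimately show ?thesis using loop(2) by (auto simp: Inv_def quotient_def)
qed

lemma codes_of_blocks_0:
  assumes "\<And>i. i < m * (2 * W) \<Longrightarrow> f i = of_bool (i mod (2 * W) = 0 \<or>
      i div (2 * W) < c \<and> i mod (2 * W) = W + w (i div (2 * W)))"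
    and "\<And>p. p < c \<Longrightarrow> w p \<le> q"
  shows "codes_of_blocks W q w c m 0 f"
  unfolding codes_of_blocks_def
proof (intro allI impI)
  fix p assume p_less: "p < m"
  have "f (p * (2 * W) + i) = of_bool (i \<in> coded_sums W q w (index_block c 0 p))" if i_less: "i < 2 * W" for i
  proof -
    have "(p + 1) * (2 * W) \<le> m * (2 * W)" using p_less by (intro mult_le_mono1) simp
    then have "p * (2 * W) + i < m * (2 * W)" using i_less by simp
    moreover have "(p * (2 * W) + i) mod (2 * W) = i" "(p * (2 * W) + i) div (2 * W) = p" using i_less by simp_all
    ultimately have "f (p * (2 * W) + i) = of_bool (i = 0 \<or> p < c \<and> i = W + w p)" using assms(1) by (simp only:)
    then show ?thesis using coded_sums_singleton[of w p q W] assms(2)[of p]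
      by (simp add: index_block_0 coded_sums_empty)
  qed
  then show "represents (2 ^ Suc 0 * W) (\<lambda>i. f (p * (2 ^ Suc 0 * W) + i)) (coded_sums W q w (index_block c 0 p))"
    by (simp add: represents_def)
qed

lemma completes_fill_leaves:
  assumes vals: "v Half = int (2 * width)" "v Width = int width" "v Class_Size = int c"
    "v Code_Len = int (m * (2 * width))"
    and fits: "m * (2 * width) \<le> T" and quotients: "\<forall>p<c. a Quots p = int (w p)" "\<And>p. p < c \<Longrightarrow> w p \<le> max_quot"
  shows "\<exists>v' a'. completes (fill Codes (N 0) leaf_exp (V Code_Len)) (v, a) (3 * (m * (2 * width)) + 2) (v', a') \<and>
    codes_of_blocks width max_quot w c m 0 (a' Codes)"
proof -
  let ?f = "\<lambda>i. of_bool (i mod (2 * width) = 0 \<or> i div (2 * width) < c \<and>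
      i mod (2 * width) = width + w (i div (2 * width)))"
  let ?n = "m * (2 * width)"
  have "completes (fill Codes (N 0) leaf_exp (V Code_Len)) (v, a) (3 * ?n + 2) (v(Idx := int ?n), a(Codes := overwrite 0 ?n ?f (a Codes)))"
  proof (rule completes_fill)
    fix i
    let ?s = "(v(Idx := int i), a(Codes := overwrite 0 i ?f (a Codes)))" and ?p = "i div (2 * width)"
      and ?r = "i mod (2 * width)"
    have div: "aval (V Idx \<oslash> V Half) ?s = int ?p" and mod: "aval (V Idx \<odot> V Half) ?s = int ?r"
      using vals by (simp_all add: zdiv_int zmod_int)
    have "aval (at_most (V Idx \<oslash> V Half \<oplus> N 1) (V Class_Size)) ?s = of_bool (?p + 1 \<le> c)"
      using div vals(3) by (intro aval_at_most) simp_all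
    moreover have "aval (is_zero (V Idx \<odot> V Half \<ominus> V Width \<ominus> Get Quots (V Idx \<oslash> V Half))) ?s =
        of_bool (?r = width + w ?p)" if "?p < c"
    proof -
      have "a Quots ?p = int (w ?p)" using that quotients(1) by simp
      then show ?thesis using div mod vals(2) by (simp add: eq_diff_eq flip: of_nat_add) 
    qed
    moreover have "aval (is_zero (V Idx \<odot> V Half)) ?s = of_bool (?r = 0)" using mod by simp
    moreover have "?r = 0 \<Longrightarrow> ?r \<noteq> width + w ?p" using width_pos by simp
    ultimately have "aval leaf_exp ?s = ?f i" unfolding leaf_exp_def using width_pos by (auto simp del: aval_is_zero)
    then show "safe leaf_exp ?s \<and> aval leaf_exp ?s = ?f i \<and> \<bar>?f i\<bar> \<le> B"
      using div sixty_four_le_B by (simp add: leaf_exp_def)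
  qed (use vals(4) le_B_if_le_T[OF fits] in auto)
  moreover have "codes_of_blocks width max_quot w c m 0 (overwrite 0 ?n ?f (a Codes))"
    using quotients(2) by (intro codes_of_blocks_0) simp_all
  ultimately show ?thesis by fastforce
qed

lemma completes_compute_leaves:
  assumes params: "parameters (v, a)" and Residue: "v Residue = int l"
  defines "h \<equiv> ceillog2 (length (residue_class l))"
  shows "\<exists>v' a'. completes compute_leaves (v, a) (4 * length xs + 2 * h + 3 * code_len l + 9) (v', a') \<and>
    v' Half = int (2 * width) \<and> v' Code_Len = int (code_len l) \<and>
    codes_of_blocks width max_quot (quotient l) (length (residue_class l)) (2 ^ h) 0 (a' Codes)"
proof -
  let ?c = "length (residue_class l)"
  obtain v1 a1 where filtering: "completes filter_class (v, a) (4 * length xs + 3) (v1, a1)" "v1 Class_Size = int ?c"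
    "\<forall>i<?c. a1 Quots i = int (quotient l i)" using completes_filter_class[OF params Residue] by blast
  have "parameters (v1, a1)" using parameters_unchanged[OF params completes_unchanged_outside[OF filtering(1)]]
    by simp
  then have width: "v1 Width = int width" by (simp add: parameters_def)
  have code_len: "code_len l = 2 ^ h * (2 * width)" by (simp add: code_len_def h_def)
  let ?v2 = "v1(Leaves := int (2 ^ h))" let ?v3 = "?v2(Half := int (2 * width))" let ?v4 =
      "?v3(Code_Len := int (code_len l))"
  have "2 * int ?c \<le> B" using length_residue_class_le[of l] length_xs_le_T T_le_B by linarith
  then have leaves: "completes (next_power Leaves (V Class_Size)) (v1, a1) (2 * h + 2) (?v2, a1)"
    using filtering(2) unfolding h_def by (intro completes_next_power) auto
  have "2 * width \<le> code_len l" unfolding code_len by simp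
  then have "int (2 * width) \<le> B" using code_len_le_T[of l] by (intro le_B_if_le_T) linarith
  then have half: "completes (Half ::= N 2 \<otimes> V Width) (?v2, a1) 1 (?v3, a1)" using width
    by (intro completes_assign) auto
  have size: "completes (Code_Len ::= V Leaves \<otimes> V Half) (?v3, a1) 1 (?v4, a1)"
    using le_B_if_le_T[OF code_len_le_T[of l]] by (intro completes_assign) (auto simp: code_len)
  obtain v5 a5 where fill: "completes (fill Codes (N 0) leaf_exp (V Code_Len)) (?v4, a1) (3 * code_len l + 2) (v5, a5)"
    "codes_of_blocks width max_quot (quotient l) ?c (2 ^ h) 0 (a5 Codes)"
    using completes_fill_leaves[of ?v4 ?c "2 ^ h" a1 "quotient l"] filtering(2,3) width code_len_le_T[of l]
        quotient_le
    unfolding code_len by auto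
  have "completes compute_leaves (v, a) (4 * length xs + 2 * h + 3 * code_len l + 9) (v5, a5)"
    unfolding compute_leaves_def
    by (rule completes_weaken[OF completes_seq[OF filtering(1) completes_seq[OF leaves completes_seq[OF half
          completes_seq[OF size fill(1)]]]]]) simp
  then show ?thesis using fill(2) completes_unchanged_vars[OF fill(1)] by fastforce
qed

lemma compute_codes_time:
  assumes "2 ^ Suc h \<le> (d::nat)"
  shows "2 * h + 3 * d + 9 + (h * (d * (89 * (l + 1))) + 1) \<le> d * (97 * (h + 1) * (l + 1))"
proof -
  have "h < 2 ^ h" by (rule less_exp)
  then have "10 + 2 * h + 3 * d \<le> 8 * d" using assms by (cases h) auto
  also have "\<dots> \<le> d * (8 * (h + 1) * (l + 1))" by simp
  finally show ?thesis by (simp add: algebra_simps)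
qed

lemma completes_compute_codes:
  assumes params: "parameters (v, a)" and Residue: "v Residue = int l"
  defines "h \<equiv> ceillog2 (length (residue_class l))"
  shows "\<exists>v' a'. completes compute_codes (v, a) (4 * length xs + code_len l * (97 * (h + 1) * (L + 1))) (v', a') \<and>
    v' Code_Len = int (code_len l) \<and>
    represents (code_len l) (a' Codes) (coded_sums width max_quot (quotient l) {..<length (residue_class l)})"
proof -
  let ?c = "length (residue_class l)"
  obtain v1 a1 where leaves: "completes compute_leaves (v, a) (4 * length xs + 2 * h + 3 * code_len l + 9) (v1, a1)"
    "v1 Half = int (2 * width)" "v1 Code_Len = int (code_len l)"
    "codes_of_blocks width max_quot (quotient l) ?c (2 ^ h) 0 (a1 Codes)"
    using completes_compute_leaves[OF params Residue] unfolding h_def by blast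
  have params1: "parameters (v1, a1)" using parameters_unchanged[OF params completes_unchanged_outside[OF leaves(1)]]
    by simp
  have code_len: "code_len l = 2 ^ Suc h * width" by (simp add: code_len_def h_def)
  obtain v2 a2 where merging: "completes merge_all (v1, a1) (h * (code_len l * (89 * (L + 1))) + 1) (v2, a2)"
    "codes_of_blocks width max_quot (quotient l) ?c 1 h (a2 Codes)"
    using completes_merge_all[OF params1 leaves(2) _ _ leaves(4)] leaves(3) code_len_le_T[of l] unfolding code_len
    by blast
  have "2 ^ Suc h * 1 \<le> code_len l" unfolding code_len using width_pos by (intro mult_le_mono2) simp
  then have "4 * length xs + 2 * h + 3 * code_len l + 9 + (h * (code_len l * (89 * (L + 1))) + 1) \<le>
      4 * length xs + code_len l * (97 * (h + 1) * (L + 1))"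
    using compute_codes_time[of h "code_len l" L] by simp
  note completes = completes_weaken[OF completes_seq[OF leaves(1) merging(1), folded compute_codes_def] this]
  have "v2 Code_Len = int (code_len l)" using completes_unchanged_vars[OF merging(1)] leaves(3) by simp
  moreover have "?c \<le> 2 ^ h" unfolding h_def by (rule le_two_power_ceillog2)
  then have "represents (code_len l) (a2 Codes) (coded_sums width max_quot (quotient l) {..<?c})"
    using merging(2) by (simp add: codes_of_blocks_def index_block_whole code_len)
  ultimately show ?thesis using completes by blast
qed

end

subsection \<open>Adding the sums of a residue class\<close>

definition value_exp :: exp where
  "value_exp = V Idx \<odot> V Width \<otimes> V Modulus \<oplus> V Idx \<oslash> V Width \<otimes> V Residue"

definition relevant_exp :: exp where
  "relevant_exp = Get Codes (V Idx) \<otimes> at_most value_exp (V Bound)"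

text \<open>Codes that are absent or stand for too large a sum write to the unused position \<open>Sum_Len\<close>.\<close>
definition scatter :: com where
  "scatter = for_upto (V Code_Len)
     (Put YRe (relevant_exp \<otimes> value_exp \<oplus> (N 1 \<ominus> relevant_exp) \<otimes> V Sum_Len) (N 1))"

definition add_sums :: com where
  "add_sums = fill XRe (N 0) (Get Acc (V Idx)) (V Sum_Len) ;; Len ::= V Sum_Len ;; convolve ;;
     fill Acc (N 0) (Get XRe (V Idx) \<otimes> at_most (V Idx) (V Bound)) (V Sum_Len)"

definition process_class :: com where
  "process_class = compute_codes ;; fill YRe (N 0) (N 0) (V Sum_Len) ;; scatter ;; add_sums"

lemma assigned_process_class [simp]:
  "assigned_vars scatter = {Idx}" "assigned_arrs scatter = {YRe}"
  "assigned_vars add_sums = {Idx, Len, Stride}" "assigned_arrs add_sums = {XRe, XIm, YRe, YIm, BufRe, BufIm, Acc}"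
  "assigned_vars process_class = {Idx, Class_Size, Leaves, Half, Code_Len, Len, Stride, Offset}"
  "assigned_arrs process_class = {Quots, Codes, XRe, XIm, YRe, YIm, BufRe, BufIm, Acc}"
  by (auto simp: scatter_def add_sums_def process_class_def)

context residue_class_algorithm
begin

lemma completes_scatter:
  assumes params: "parameters (v, a)" and vals: "v Residue = int l" "v Code_Len = int m" and m_le_T: "m \<le> T"
    and Z_represented: "represents m (a Codes) Z" "Z \<subseteq> {..<m}" and empty: "represents sum_len (a YRe) {}"
  shows "\<exists>v' a'. completes scatter (v, a) (3 * m + 2) (v', a') \<and>
    represents sum_len (a' YRe) (decode width b l ` Z \<inter> {..u})"
proof -
  let ?index = "relevant_exp \<otimes> value_exp \<oplus> (N 1 \<ominus> relevant_exp) \<otimes> V Sum_Len"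
  let ?put = "Put YRe ?index (N 1)"
  define Inv where "Inv = (\<lambda>k s. fst s Idx = int k \<and>
      represents sum_len (snd s YRe) (decode width b l ` (Z \<inter> {..<k}) \<inter> {..u}))"
  have "\<exists>v' a'. completes (for_upto (V Code_Len) ?put) (v, a) (m * (1 + 2) + 2) (v', a') \<and> Inv m (v', a')"
  proof (rule completes_for_upto)
    show "Inv 0 (v(Idx := 0), a)" using empty by (simp add: Inv_def)
  next
    fix k v' a' assume "Inv k (v', a')" "unchanged_outside (for_upto (V Code_Len) ?put) (v, a) (v', a')"
    then show "v' Idx = int k \<and> safe (V Code_Len) (v', a') \<and> aval (V Code_Len) (v', a') = int m"
      using vals by (simp add: Inv_def unchanged_outside_def)
  next
    fix k v' a' assume k_less: "k < m" and invariant: "Inv k (v', a')" and Idx: "v' Idx = int k"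
      and unchanged: "unchanged_outside (for_upto (V Code_Len) ?put) (v, a) (v', a')"
    let ?x = "decode width b l k"
    have params': "parameters (v', a')" using parameters_unchanged[OF params unchanged] by simp
    have vals': "v' Residue = int l" "a' Codes k = of_bool (k \<in> Z)"
      using unchanged vals Z_represented(1) k_less by (simp_all add: unchanged_outside_def represents_def)
    have "aval value_exp (v', a') = int ?x"
      using params' vals' Idx by (simp add: value_exp_def decode_def parameters_def zdiv_int zmod_int)
    moreover from this have "aval (at_most value_exp (V Bound)) (v', a') = of_bool (?x \<le> u)"
      using params' by (intro aval_at_most) (simp_all add: parameters_def)
    ultimately have "aval ?index (v', a') = int (if k \<in> Z \<and> ?x \<le> u then ?x else sum_len)"
      using params' vals' Idx by (simp add: relevant_exp_def parameters_def)
    then have put: "completes ?put (v', a') 1 (v', a'(YRe := (a' YRe)((if k \<in> Z \<and>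
        ?x \<le> u then ?x else sum_len) := 1)))"
      using sixty_four_le_B Idx by (intro completes_put) (simp_all add: relevant_exp_def value_exp_def)
    have "Z \<inter> {..<Suc k} = (if k \<in> Z then insert k (Z \<inter> {..<k}) else Z \<inter> {..<k})" by (auto simp: less_Suc_eq)
    then have "represents sum_len ((a' YRe)((if k \<in> Z \<and> ?x \<le> u then ?x else sum_len) := 1))
        (decode width b l ` (Z \<inter> {..<Suc k}) \<inter> {..u})"
      using invariant by (auto simp: Inv_def represents_def)
    then show "\<exists>v'' a''. completes ?put (v', a') 1 (v'', a'') \<and> v'' Idx = int k \<and>
        Inv (Suc k) (v''(Idx := int (Suc k)), a'')"
      using put Idx unfolding Inv_def by (intro exI conjI) (assumption, simp_all)
  qed (use le_B_if_le_T[OF m_le_T] in simp)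
  then obtain v' a' where loop: "completes scatter (v, a) (m * (1 + 2) + 2) (v', a')" "Inv m (v', a')"
    unfolding scatter_def by blast
  have "completes scatter (v, a) (3 * m + 2) (v', a')" by (rule completes_weaken[OF loop(1)]) simp
  moreover have "Z \<inter> {..<m} = Z" using Z_represented(2) by blast
  ultimately show ?thesis using loop(2) by (auto simp: Inv_def)
qed

lemma completes_store_sums:
  assumes params: "parameters (v, a)" and X_represented: "represents sum_len (a XRe) X"
  shows "completes (fill Acc (N 0) (Get XRe (V Idx) \<otimes> at_most (V Idx) (V Bound)) (V Sum_Len)) (v, a) (3 * sum_len + 2)
    (v(Idx := int sum_len), a(Acc := overwrite 0 sum_len (\<lambda>i. of_bool (i \<in> X \<and> i \<le> u)) (a Acc)))"
proof (rule completes_fill)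
  fix i assume i_less: "i < sum_len"
  let ?f = "\<lambda>i. of_bool (i \<in> X \<and> i \<le> u)"
  let ?s = "(v(Idx := int i), a(Acc := overwrite 0 i ?f (a Acc)))"
  have "aval (at_most (V Idx) (V Bound)) ?s = of_bool (i \<le> u)"
    using params by (intro aval_at_most) (simp_all add: parameters_def)
  then show "safe (Get XRe (V Idx) \<otimes> at_most (V Idx) (V Bound)) ?s \<and>
      aval (Get XRe (V Idx) \<otimes> at_most (V Idx) (V Bound)) ?s = ?f i \<and> \<bar>?f i\<bar> \<le> B"
    using i_less X_represented sixty_four_le_B by (auto simp: represents_def)
qed (use params le_B_if_le_T[OF sum_len_le_T] in \<open>auto simp: parameters_def\<close>)

lemma add_sums_time:
  assumes "(2::nat) ^ h \<le> 2 ^ l"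
  shows "3 * 2 ^ h + 2 + (1 + (66 * 2 ^ h * (h + 1) + (3 * 2 ^ h + 2))) \<le> 2 ^ h * (77 * (l + 1))"
proof -
  have "h \<le> l" using assms by simp
  then have "66 * 2 ^ h * (h + 1) \<le> 66 * 2 ^ h * (l + 1)" by (intro mult_le_mono2) simp
  moreover have "11 * 2 ^ h \<le> 11 * 2 ^ h * (l + 1)"
    "2 ^ h * (77 * (l + 1)) = 66 * 2 ^ h * (l + 1) + 11 * 2 ^ h * (l + 1)"
    by (simp_all add: algebra_simps)
  moreover have "(1::nat) \<le> 2 ^ h" by simp
  ultimately show ?thesis by linarith
qed

lemma completes_add_sums:
  assumes params: "parameters (v, a)" and X_represented: "represents sum_len (a Acc) X" "X \<subseteq> {..u}"
    and Y_represented: "represents sum_len (a YRe) Y" "Y \<subseteq> {..u}"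
  shows "\<exists>v' a'. completes add_sums (v, a) (sum_len * (77 * (L + 1))) (v', a') \<and>
    represents sum_len (a' Acc) ((X + Y) \<inter> {..u})"
proof -
  let ?h = "ceillog2 (2 * u + 1)" and ?N = sum_len
  have N_power: "?N = 2 ^ ?h" by (simp add: sum_len_def)
  have N_le_B: "int ?N \<le> B" by (rule le_B_if_le_T[OF sum_len_le_T])
  have vals: "v Sum_Len = int ?N" using params by (simp add: parameters_def)
  let ?a1 = "a(XRe := overwrite 0 ?N (\<lambda>i. of_bool (i \<in> X)) (a XRe))" and ?v1 = "v(Idx := int ?N)"
  let ?v2 = "?v1(Len := int ?N)"
  have load: "completes (fill XRe (N 0) (Get Acc (V Idx)) (V Sum_Len)) (v, a) (3 * ?N + 2) (?v1, ?a1)"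
    using vals X_represented(1) N_le_B sixty_four_le_B by (intro completes_fill) (auto simp: represents_def)
  have set_len: "completes (Len ::= V Sum_Len) (?v1, ?a1) 1 (?v2, ?a1)"
    using vals N_le_B by (intro completes_assign) auto
  have "parameters (?v1, ?a1)" using parameters_unchanged[OF params completes_unchanged_outside[OF load]] by simp
  then have params2: "parameters (?v2, ?a1)" by (simp add: parameters_def)
  have "represents ?N (?a1 XRe) X" "represents ?N (?a1 YRe) Y" using Y_represented(1)
    by (simp_all add: represents_def)
  moreover have "X \<subseteq> {..<?N}" "Y \<subseteq> {..<?N}" "X + Y \<subseteq> {..<?N}"
    using X_represented(2) Y_represented(2) two_u_less_sum_len by (force elim!: set_plus_elim)+
  moreover have "fft_ready ?N ?h (?v2, ?a1)"
    using fft_ready_if_parameters[OF params2, of ?h] sum_len_le_T by (simp add: sum_len_def)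
  ultimately obtain v3 a3 where conv: "completes convolve (?v2, ?a1) (66 * ?N * (?h + 1)) (v3, a3)"
    "represents ?N (a3 XRe) (X + Y)" using completes_convolve[where n = ?N] by blast
  have params3: "parameters (v3, a3)" using parameters_unchanged[OF params2 completes_unchanged_outside[OF conv(1)]]
    by simp
  note store = completes_store_sums[OF params3 conv(2)]
  have time: "3 * ?N + 2 + (1 + (66 * ?N * (?h + 1) + (3 * ?N + 2))) \<le> ?N * (77 * (L + 1))"
    unfolding sum_len_def using sum_len_le_T[unfolded sum_len_def T_def] by (rule add_sums_time)
  have "completes add_sums (v, a) (?N * (77 * (L + 1)))
      (v3(Idx := int ?N), a3(Acc := overwrite 0 ?N (\<lambda>i. of_bool (i \<in> X + Y \<and> i \<le> u)) (a3 Acc)))"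
    unfolding add_sums_def
    by (rule completes_weaken[OF completes_seq[OF load completes_seq[OF set_len
        completes_seq[OF conv(1) store]]] time])
  moreover have "represents ?N (overwrite 0 ?N (\<lambda>i. of_bool (i \<in> X + Y \<and> i \<le> u)) (a3 Acc)) ((X + Y) \<inter> {..u})"
    by (simp add: represents_def)
  ultimately show ?thesis by fastforce
qed

lemma decode_coded_sums_residue_class:
  assumes "l < b"
  shows "decode width b l ` coded_sums width max_quot (quotient l) {..<length (residue_class l)} \<inter> {..u} =
    subset_sums (real u) {x \<in> set xs. x mod b = l}"
proof -
  let ?I = "{..<length (residue_class l)}" and ?f = "(!) (residue_class l)"
  have members: "set (residue_class l) = {x \<in> set xs. x mod b = l}" by (simp add: residue_class_def)
  have "inj_on ?f ?I" using xs(2) by (intro inj_on_nth) (auto simp: residue_class_def)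
  moreover have "?f i mod b = l" if "i \<in> ?I" for i using nth_mem[of i "residue_class l"] that members by auto
  ultimately have "subset_sums (real u) (?f ` ?I) =
      decode width b l ` coded_sums width max_quot (quotient l) ?I \<inter> {..u}"
    unfolding quotient_def by (intro subset_sums_residue_class b_pos max_quot_less_width)
  moreover have "?f ` ?I = {x \<in> set xs. x mod b = l}"
    unfolding members[symmetric] by (auto simp: in_set_conv_nth)
  ultimately show ?thesis by simp
qed

lemma completes_process_class:
  assumes params: "parameters (v, a)" and Residue: "v Residue = int l" "l < b"
    and A_represented: "represents sum_len (a Acc) A" "A \<subseteq> {..u}"
  defines "h \<equiv> ceillog2 (length (residue_class l))"
  shows "\<exists>v' a'. completes process_class (v, a)
      (4 * length xs + code_len l * (102 * (h + 1) * (L + 1)) + sum_len * (82 * (L + 1))) (v', a') \<and>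
    represents sum_len (a' Acc) ((A + subset_sums (real u) {x \<in> set xs. x mod b = l}) \<inter> {..u})"
proof -
  let ?N = sum_len and ?Z = "coded_sums width max_quot (quotient l) {..<length (residue_class l)}"
  obtain v1 a1 where codes: "completes compute_codes (v, a)
      (4 * length xs + code_len l * (97 * (h + 1) * (L + 1))) (v1, a1)" "v1 Code_Len = int (code_len l)"
        "represents (code_len l) (a1 Codes) ?Z"
    using completes_compute_codes[OF params Residue(1)] unfolding h_def by blast
  have params1: "parameters (v1, a1)" using parameters_unchanged[OF params completes_unchanged_outside[OF codes(1)]]
    by simp
  let ?v2 = "v1(Idx := int ?N)" and ?a2 = "a1(YRe := overwrite 0 ?N (\<lambda>_. 0) (a1 YRe))"
  have clear: "completes (fill YRe (N 0) (N 0) (V Sum_Len)) (v1, a1) (3 * ?N + 2) (?v2, ?a2)"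
    using params1 le_B_if_le_T[OF sum_len_le_T] sixty_four_le_B by (intro completes_fill) (auto simp: parameters_def)
  have params2: "parameters (?v2, ?a2)" using parameters_unchanged[OF params1 completes_unchanged_outside[OF clear]]
    by simp
  have "?Z \<subseteq> {..<code_len l}"
    using coded_sums_index_block_subset[OF max_quot_less_width, of "quotient l" "length (residue_class l)" h 0]
    by (simp add: index_block_whole le_two_power_ceillog2 code_len_def h_def)
  moreover have "v1 Residue = int l" using completes_unchanged_vars[OF codes(1)] Residue(1) by simp
  ultimately obtain v3 a3 where scattering: "completes scatter (?v2, ?a2) (3 * code_len l + 2) (v3, a3)"
    "represents ?N (a3 YRe) (subset_sums (real u) {x \<in> set xs. x mod b = l})"
    using completes_scatter[where l = l and m = "code_len l" and Z = ?Z, OF params2 _ _ code_len_le_T] codes(2,3)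
    unfolding decode_coded_sums_residue_class[OF Residue(2), symmetric] by (auto simp: represents_def)
  have params3: "parameters (v3, a3)"
    using parameters_unchanged[OF params2 completes_unchanged_outside[OF scattering(1)]] by simp
  have "represents ?N (a3 Acc) A"
    using A_represented(1) completes_unchanged_arrs[OF codes(1)] completes_unchanged_arrs[OF scattering(1)] by simp
  moreover have "subset_sums (real u) {x \<in> set xs. x mod b = l} \<subseteq> {..u}" by (auto simp: subset_sums_of_nat)
  ultimately obtain v' a' where add: "completes add_sums (v3, a3) (?N * (77 * (L + 1))) (v', a')"
    "represents ?N (a' Acc) ((A + subset_sums (real u) {x \<in> set xs. x mod b = l}) \<inter> {..u})"
    using completes_add_sums[OF params3 _ A_represented(2) scattering(2)] by blast
  have "0 < code_len l" "1 \<le> ?N" using width_pos two_u_less_sum_len by (simp_all add: code_len_def)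
  then have "3 * code_len l + 2 \<le> code_len l * (5 * (h + 1) * (L + 1))" "3 * ?N + 2 \<le> ?N * (5 * (L + 1))"
    by (simp_all add: algebra_simps)
  then have "4 * length xs + code_len l * (97 * (h + 1) * (L + 1)) + (3 * ?N + 2 + (3 * code_len l + 2 + ?N * (77 * (L + 1))))
    \<le> 4 * length xs + (code_len l * (97 * (h + 1) * (L + 1)) + code_len l * (5 * (h + 1) * (L + 1))) +
      (?N * (77 * (L + 1)) + ?N * (5 * (L + 1)))" by linarith
  also have "\<dots> = 4 * length xs + code_len l * (102 * (h + 1) * (L + 1)) + ?N * (82 * (L + 1))"
    by (simp add: algebra_simps)
  finally have "completes process_class (v, a)
      (4 * length xs + code_len l * (102 * (h + 1) * (L + 1)) + ?N * (82 * (L + 1))) (v', a')"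
    unfolding process_class_def
    by (rule completes_weaken[OF completes_seq[OF codes(1) completes_seq[OF clear
        completes_seq[OF scattering(1) add(1)]]]])
  then show ?thesis using add(2) by blast
qed

end

section \<open>All residue classes\<close>

definition process_classes :: com where
  "process_classes = Residue ::= N 0 ;;
     While (V Residue) (V Modulus) (process_class ;; Residue ::= V Residue \<oplus> N 1)"

lemma assigned_process_classes [simp]:
  "assigned_vars process_classes = {Residue, Idx, Class_Size, Leaves, Half, Code_Len, Len, Stride, Offset}"
  "assigned_arrs process_classes = {Quots, Codes, XRe, XIm, YRe, YIm, BufRe, BufIm, Acc}"
  by (auto simp: process_classes_def)

context residue_class_algorithm
begin

abbreviation log_count :: nat where "log_count \<equiv> ceillog2 (length xs + 1)"

lemma sum_length_residue_class: "(\<Sum>l<b. length (residue_class l)) = length xs"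
proof -
  have "(\<Sum>l<b. length (filter (\<lambda>x. x mod b = l) ys)) = length ys" for ys :: "nat list"
  proof (induction ys)
    case (Cons y ys)
    have "(\<Sum>l<b. length (filter (\<lambda>x. x mod b = l) (y # ys))) =
        (\<Sum>l<b. (if y mod b = l then 1 else 0) + length (filter (\<lambda>x. x mod b = l) ys))" by (intro sum.cong) auto
    then show ?case using b_pos by (simp add: sum.distrib Cons)
  qed simp
  then show ?thesis by (simp add: residue_class_def)
qed

lemma ceillog2_length_residue_class_le: "ceillog2 (length (residue_class l)) \<le> log_count"
  using length_residue_class_le[of l] by (intro ceillog2_mono) simp

lemma sum_code_len_le: "(\<Sum>l<b. code_len l) \<le> (4 * length xs + 2 * b) * width"
proof -
  have "(\<Sum>l<b. code_len l) \<le> (\<Sum>l<b. 4 * length (residue_class l) * width + 2 * width)"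
    by (intro sum_mono code_len_le)
  also have "\<dots> = 4 * (\<Sum>l<b. length (residue_class l)) * width + b * (2 * width)"
    by (simp add: sum.distrib flip: sum_distrib_left sum_distrib_right)
  finally show ?thesis by (simp add: sum_length_residue_class algebra_simps)
qed

definition classes_time :: nat where
  "classes_time = b * (4 * length xs + sum_len * (82 * (L + 1)) + 2) +
     (4 * length xs + 2 * b) * width * (102 * (log_count + 1) * (L + 1)) + 2"

lemma sum_class_times_le:
  "(\<Sum>l<b. 4 * length xs + code_len l * (102 * (log_count + 1) * (L + 1)) + sum_len * (82 * (L + 1)) + 2) + 2 \<le>
      classes_time"
proof -
  let ?c = "102 * (log_count + 1) * (L + 1)" and ?k = "4 * length xs + sum_len * (82 * (L + 1)) + 2"
  have sum_affine: "(\<Sum>l<b. k + f l * c) = b * k + (\<Sum>l<b. f l) * c" for k c :: nat and f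
    by (simp add: sum.distrib sum_distrib_right)
  have "(\<Sum>l<b. 4 * length xs + code_len l * ?c + sum_len * (82 * (L + 1)) + 2) = (\<Sum>l<b. ?k + code_len l * ?c)"
    by (intro sum.cong) simp_all
  also have "\<dots> = b * ?k + (\<Sum>l<b. code_len l) * ?c" by (rule sum_affine)
  also have "\<dots> \<le> b * ?k + (4 * length xs + 2 * b) * width * ?c" by (intro add_left_mono mult_le_mono1 sum_code_len_le)
  finally show ?thesis by (simp add: classes_time_def)
qed

lemma completes_next_class:
  assumes params: "parameters (v, a)" and Residue: "v Residue = int l" "l < b"
    and Acc_represented: "represents sum_len (a Acc) (subset_sums (real u) {x \<in> set xs. x mod b < l})"
    and b_le_T: "b \<le> T"
  shows "\<exists>v' a'. completes (process_class ;; Residue ::= V Residue \<oplus> N 1) (v, a)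
      (4 * length xs + code_len l * (102 * (log_count + 1) * (L + 1)) + sum_len * (82 * (L + 1)) + 1) (v', a') \<and>
    v' Residue = int (Suc l) \<and> represents sum_len (a' Acc) (subset_sums (real u) {x \<in> set xs. x mod b < Suc l})"
proof -
  let ?h = "ceillog2 (length (residue_class l))"
  have "subset_sums (real u) {x \<in> set xs. x mod b < l} \<subseteq> {..u}" by (auto simp: subset_sums_of_nat)
  then obtain v' a' where process: "completes process_class (v, a)
      (4 * length xs + code_len l * (102 * (?h + 1) * (L + 1)) + sum_len * (82 * (L + 1))) (v', a')"
    "represents sum_len (a' Acc) ((subset_sums (real u) {x \<in> set xs. x mod b < l} +
       subset_sums (real u) {x \<in> set xs. x mod b = l}) \<inter> {..u})"
    using completes_process_class[OF params Residue Acc_represented] by blast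
  have "{x \<in> set xs. x mod b < Suc l} = {x \<in> set xs. x mod b < l} \<union> {x \<in> set xs. x mod b = l}"
    by (auto simp: less_Suc_eq)
  then have "subset_sums (real u) {x \<in> set xs. x mod b < Suc l} =
      (subset_sums (real u) {x \<in> set xs. x mod b < l} + subset_sums (real u) {x \<in> set xs. x mod b = l}) \<inter> {..u}"
    by (simp only:) (rule subset_sums_Un_disjoint, auto)
  moreover have "v' Residue = int l" using completes_unchanged_vars[OF process(1)] Residue(1) by simp
  then have "completes (Residue ::= V Residue \<oplus> N 1) (v', a') 1 (v'(Residue := int (Suc l)), a')"
    using Residue(2) le_B_if_le_T[OF b_le_T] by (intro completes_assign) auto
  moreover have "code_len l * (102 * (?h + 1) * (L + 1)) \<le> code_len l * (102 * (log_count + 1) * (L + 1))"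
    using ceillog2_length_residue_class_le[of l] by (intro mult_le_mono2 mult_le_mono1) simp
  ultimately show ?thesis using process(2) completes_weaken[OF completes_seq[OF process(1)]]
    by (intro exI[of _ "v'(Residue := int (Suc l))"] exI[of _ a']) simp
qed

lemma completes_process_classes:
  assumes params: "parameters (v, a)" and Acc_represented: "represents sum_len (a Acc) {0}" and b_le_T: "b \<le> T"
  shows "\<exists>v' a'. completes process_classes (v, a) classes_time (v', a') \<and>
    represents sum_len (a' Acc) (subset_sums (real u) (set xs))"
proof -
  let ?body = "process_class ;; Residue ::= V Residue \<oplus> N 1" and ?v = "v(Residue := 0)"
  let ?c = "102 * (log_count + 1) * (L + 1)"
  let ?t = "\<lambda>l. 4 * length xs + code_len l * ?c + sum_len * (82 * (L + 1)) + 1"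
  have params0: "parameters (?v, a)" using params by (simp add: parameters_def)
  have start: "completes (Residue ::= N 0) (v, a) 1 (?v, a)"
    by (rule completes_assign) (use sixty_four_le_B in auto)
  define Inv where "Inv = (\<lambda>l s. fst s Residue = int l \<and>
    represents sum_len (snd s Acc) (subset_sums (real u) {x \<in> set xs. x mod b < l}))"
  have "\<exists>s'. completes (While (V Residue) (V Modulus) ?body) (?v, a) ((\<Sum>l<b. ?t l + 1) + 1) s' \<and> Inv b s'"
  proof (rule completes_while)
    show "Inv 0 (?v, a)" using Acc_represented by (simp add: Inv_def subset_sums_empty)
  next
    fix l s' assume l_less: "l < b" and invariant: "Inv l s'" and unchanged: "unchanged_outside ?body (?v, a) s'"
    obtain v' a' where state: "s' = (v', a')" by (cases s')
    have params': "parameters (v', a')" using parameters_unchanged[OF params0 unchanged] by (simp add: state)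
    then obtain v'' a'' where body: "completes ?body (v', a') (?t l) (v'', a'')" "Inv (Suc l) (v'', a'')"
      using completes_next_class[OF _ _ l_less _ b_le_T, of v' a'] invariant by (auto simp: state Inv_def)
    then show "safe (V Residue) s' \<and> safe (V Modulus) s' \<and> aval (V Residue) s' < aval (V Modulus) s' \<and>
      (\<exists>s''. completes ?body s' (?t l) s'' \<and> Inv (Suc l) s'')"
      using params' invariant l_less unfolding state by (auto simp: Inv_def parameters_def)
  next
    fix s' assume "Inv b s'" "unchanged_outside ?body (?v, a) s'"
    then show "safe (V Residue) s' \<and> safe (V Modulus) s' \<and> \<not> aval (V Residue) s' < aval (V Modulus) s'"
      using parameters_unchanged[OF params0] by (simp add: Inv_def parameters_def)
  qed
  then obtain v' a' where loop: "completes (While (V Residue) (V Modulus) ?body) (?v, a) ((\<Sum>l<b. ?t l + 1) + 1) (v', a')"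
    "Inv b (v', a')" by (metis surj_pair)
  have "1 + ((\<Sum>l<b. ?t l + 1) + 1) \<le> classes_time" using sum_class_times_le by simp
  from completes_weaken[OF completes_seq[OF start loop(1)] this]
  have "completes process_classes (v, a) classes_time (v', a')" unfolding process_classes_def .
  moreover have "{x \<in> set xs. x mod b < b} = set xs" using b_pos by auto
  ultimately show ?thesis using loop(2) by (auto simp: Inv_def)
qed

end

section \<open>The whole program\<close>

text \<open>Memory cell \<open>j\<close> is found at \<open>Saved\<close>, position \<open>j\<close>, if \<open>j < 64\<close> and at \<open>IO\<close>, position \<open>j - 64\<close>, otherwise, except
  that \<open>Saved\<close> has the number of elements at position 0. The factors \<open>nonzero\<close> keep the indices nonnegative.\<close>
definition input_exp :: exp where
  "input_exp = is_zero (V Idx \<oslash> N 62) \<otimes> Get Saved (V Idx \<oplus> N 2) \<oplus>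
     nonzero (V Idx \<oslash> N 62) \<otimes> Get IO (nonzero (V Idx \<oslash> N 62) \<otimes> (V Idx \<ominus> N 62))"

definition read_input :: com where
  "read_input = Count ::= Get Saved (N 0) ;; fill Input (N 0) input_exp (V Count)"

definition compute_sizes :: com where
  "compute_sizes = compute_log ;; compute_modulus ;; Max_Quot ::= V Bound \<oslash> V Modulus ;;
     next_power Width (N 2 \<otimes> V Max_Quot \<oplus> N 1) ;; next_power Sum_Len (N 2 \<otimes> V Bound \<oplus> N 1) ;;
     next_power Tab_Len (N 8 \<otimes> V Count \<otimes> V Width \<oplus> V Sum_Len \<oplus> N 8) ;; compute_scale"

definition setup_state :: com where
  "setup_state = read_input ;; compute_sizes ;; make_table ;; fill Acc (N 0) (is_zero (V Idx)) (V Sum_Len)"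

definition write_output :: com where
  "write_output = fill Saved (N 0) (Get Acc (V Idx \<odot> V Sum_Len)) (N 64) ;;
     fill IO (N 0) (Get Acc (V Idx \<oplus> N 64)) (nonzero (V Bound \<oslash> N 64) \<otimes> (V Bound \<ominus> N 63))"

definition solve :: com where
  "solve = setup_state ;; process_classes ;; write_output"

lemma assigned_solve_parts [simp]:
  "assigned_vars read_input = {Count, Idx}" "assigned_arrs read_input = {Input}"
  "assigned_vars compute_sizes = {Pow_Two, Log, Modulus, Max_Quot, Width, Sum_Len, Tab_Len, Scale}"
  "assigned_arrs compute_sizes = {}"
  by (auto simp: read_input_def compute_sizes_def compute_log_def compute_modulus_def compute_scale_def)

locale nonempty_instance =
  fixes u :: nat and xs :: "nat list"
  assumes u_pos: "0 < u" and nonempty: "xs \<noteq> []" and distinct: "distinct xs" and bounded: "set xs \<subseteq> {..u}"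
begin

definition modulus :: nat where
  "modulus = floor_sqrt (length xs * ceillog2 (length xs + 1))"

abbreviation "count \<equiv> length xs"
abbreviation "lg \<equiv> ceillog2 (count + 1)"

lemma one_le_count: "1 \<le> count"
  using nonempty by (simp add: Suc_le_eq)

lemma count_le: "count \<le> u + 1"
  using card_mono[OF _ bounded] distinct_card[OF distinct] by simp

lemma one_le_lg: "1 \<le> lg"
  using nonempty by (subst ceillog2_ge_iff) simp_all

lemma lg_le_count: "lg \<le> count"
  using less_exp[of count] by (subst ceillog2_le_iff) (simp_all add: Suc_le_eq)

lemma lg_le_modulus: "lg \<le> modulus"
  unfolding modulus_def using lg_le_count by (intro le_floor_sqrtI) (simp add: power2_eq_square)

lemma modulus_le_count: "modulus \<le> count"
proof -
  have "modulus \<le> floor_sqrt (count\<^sup>2)" unfolding modulus_def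
    using lg_le_count by (intro mono_floor_sqrt') (simp add: power2_eq_square)
  then show ?thesis by simp
qed

lemma one_le_modulus: "1 \<le> modulus"
  using one_le_lg lg_le_modulus by linarith

lemma count_lg_le: "count * lg \<le> 4 * (modulus * modulus)"
proof -
  have "count * lg < (Suc modulus)\<^sup>2" unfolding modulus_def by (rule Suc_floor_sqrt_power2_gt)
  also have "\<dots> \<le> (2 * modulus)\<^sup>2" using one_le_modulus by (intro power_mono) simp_all
  finally show ?thesis by (simp add: power2_eq_square)
qed

sublocale subset_sum_instance u modulus xs
  by standard (use one_le_modulus nonempty distinct bounded in auto)

definition tab_exp :: nat where
  "tab_exp = ceillog2 (8 * count * width + sum_len + 8)"

abbreviation "tab_len \<equiv> 2 ^ tab_exp :: nat"

lemma tab_len_ge: "8 * count * width + sum_len + 8 \<le> tab_len"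
  unfolding tab_exp_def by (rule le_two_power_ceillog2)

lemma sum_len_le: "sum_len \<le> 5 * u"
  using two_power_ceillog2_gt[of "2 * u + 1"] u_pos unfolding sum_len_def by simp

lemma modulus_square_width_le: "modulus * modulus * width \<le> 8 * (u * modulus)"
proof -
  have "width \<le> 4 * max_quot + 2"
    using two_power_ceillog2_gt[of "2 * max_quot + 1"] unfolding width_def by simp
  then have "modulus * modulus * width \<le> modulus * modulus * (4 * max_quot + 2)" by (rule mult_le_mono2)
  also have "\<dots> = 4 * (max_quot * modulus * modulus) + 2 * (modulus * modulus)" by (simp add: algebra_simps)
  also have "max_quot * modulus * modulus \<le> u * modulus" by (intro mult_le_mono1) simp
  also have "modulus * modulus \<le> 2 * u * modulus"
    using modulus_le_count count_le u_pos by (intro mult_le_mono1) linarith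
  finally show ?thesis by simp
qed

lemma count_lg_width_le: "count * lg * width \<le> 32 * (u * modulus)"
  using mult_le_mono1[OF count_lg_le, of width] modulus_square_width_le by linarith

lemma u_le_u_modulus: "u \<le> u * modulus"
  using one_le_modulus by simp

lemma tab_len_le: "tab_len \<le> 540 * (u * modulus)"
proof -
  have "count * width * 1 \<le> count * width * lg" using one_le_lg by (rule mult_le_mono2)
  also have "\<dots> = count * lg * width" by simp
  finally have "count * width \<le> 32 * (u * modulus)" using count_lg_width_le by linarith
  moreover have "tab_len < 2 * (8 * count * width + sum_len + 8)"
    unfolding tab_exp_def by (rule two_power_ceillog2_gt) simp
  then have "tab_len \<le> 16 * (count * width) + 2 * sum_len + 16" by simp
  ultimately show ?thesis using sum_len_le u_le_u_modulus u_pos by linarith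
qed

lemma classes_work_le: "(4 * count + 2 * modulus) * width * (lg + 1) \<le> 288 * (u * modulus)"
proof -
  have "modulus * lg * width \<le> modulus * modulus * width"
    using lg_le_modulus by (intro mult_le_mono1 mult_le_mono2)
  then have "modulus * lg * width \<le> 8 * (u * modulus)" using modulus_square_width_le by linarith
  moreover have "(4 * count + 2 * modulus) * width * (lg + 1) \<le> (4 * count + 2 * modulus) * width * (2 * lg)"
    using one_le_lg by (intro mult_le_mono2) simp
  moreover have "(4 * count + 2 * modulus) * width * (2 * lg) = 8 * (count * lg * width) + 4 * (modulus * lg * width)"
    by (simp add: algebra_simps)
  ultimately show ?thesis using count_lg_width_le by linarith
qed

definition word_bound :: int where "word_bound = (int u + 2) ^ 512"

lemma power_le_word_bound: "k \<le> 512 \<Longrightarrow> (int u + 2) ^ k \<le> word_bound"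
  unfolding word_bound_def by (intro power_increasing) auto

lemma tab_len_le_power: "tab_len \<le> (u + 2) ^ 8"
proof -
  have "tab_len \<le> 3 ^ 6 * ((u + 2) * (u + 2))"
  proof -
    have "u * modulus \<le> (u + 2) * (u + 2)" using modulus_le_count count_le by (intro mult_le_mono) linarith+
    then show ?thesis using tab_len_le by simp
  qed
  also have "\<dots> \<le> (u + 2) ^ 6 * ((u + 2) * (u + 2))" using u_pos by (intro mult_le_mono1 power_mono) simp_all
  also have "\<dots> = (u + 2) ^ 8" by (simp only: flip: power2_eq_square power_add) simp
  finally show ?thesis .
qed

lemma linear_le_word_bound: "256 * int u + 1024 \<le> word_bound"
proof -
  have "1280 * int u \<le> 3 ^ 7 * (int u + 2)" by simp
  also have "\<dots> \<le> (int u + 2) ^ 7 * (int u + 2)" using u_pos by (intro mult_right_mono power_mono) auto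
  also have "\<dots> = (int u + 2) ^ 8" by (simp flip: power_Suc2)
  also have "\<dots> \<le> word_bound" by (rule power_le_word_bound) simp
  finally show ?thesis using u_pos by linarith
qed

sublocale transform_precision tab_exp
proof
  have "(2::nat) ^ 3 \<le> tab_len" using tab_len_ge by simp
  then show "3 \<le> tab_exp" by (rule power_le_imp_le_exp[rotated]) simp
qed

sublocale residue_class_algorithm u modulus xs tab_exp word_bound "256 * int u - 64"
proof
  have "int T \<le> int ((u + 2) ^ 8)" unfolding T_def of_nat_le_iff by (rule tab_len_le_power)
  then have "int T ^ 64 \<le> ((int u + 2) ^ 8) ^ 64" by (intro power_mono) (simp_all add: add.commute)
  then show "int T ^ 64 \<le> word_bound" by (simp add: word_bound_def flip: power_mult)
  show "64 \<le> word_bound" using linear_le_word_bound by linarith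
  show "4 * length xs * width \<le> T" "sum_len \<le> T" using tab_len_ge unfolding T_def by linarith+
qed

end

context nonempty_instance
begin

subsection \<open>Input and output\<close>

definition input_state :: "state \<Rightarrow> bool" where
  "input_state s \<longleftrightarrow> fst s Bound = int u \<and> snd s Saved 0 = int count \<and>
     (\<forall>i<count. (if i < 62 then snd s Saved (i + 2) else snd s IO (i - 62)) = int (xs ! i))"

definition output_state :: "state \<Rightarrow> bool" where
  "output_state s \<longleftrightarrow> (\<forall>j\<le>u. (if j < 64 then snd s Saved j else snd s IO (j - 64)) =
     of_bool (j \<in> subset_sums (real u) (set xs)))"

lemma input_exp_correct:
  assumes "input_state s" "snd s' Saved = snd s Saved" "snd s' IO = snd s IO" "fst s' Idx = int i" "i < count"
  shows "safe input_exp s' \<and> aval input_exp s' = int (xs ! i)"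
proof -
  have "int i div 62 = 0 \<longleftrightarrow> i < 62" by (auto simp: div_eq_0_iff)
  moreover have "62 \<le> i \<Longrightarrow> nat (int i - 62) = i - 62" by simp
  moreover have "(if i < 62 then snd s Saved (i + 2) else snd s IO (i - 62)) = int (xs ! i)"
    using assms(1,5) by (simp add: input_state_def)
  moreover have "nat (int i + 2) = i + 2" by simp
  ultimately show ?thesis using assms(2-5) count_le u_pos
    by (cases "i < 62") (simp_all add: input_exp_def valid_index_def)
qed

lemma completes_read_input:
  assumes input: "input_state (v, a)"
  shows "\<exists>v' a'. completes read_input (v, a) (3 * count + 3) (v', a') \<and> v' Count = int count \<and>
    (\<forall>i<count. a' Input i = int (xs ! i))"
proof -
  have count_B: "int count \<le> word_bound" by (rule le_B_if_le_T) (use length_xs_le_T in linarith)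
  let ?v = "v(Count := int count)" and ?a' = "a(Input := overwrite 0 count (\<lambda>i. int (xs ! i)) (a Input))"
  have size: "completes (Count ::= Get Saved (N 0)) (v, a) 1 (?v, a)"
    by (rule completes_assign) (use input count_B in \<open>auto simp: input_state_def valid_index_def\<close>)
  have "completes (fill Input (N 0) input_exp (V Count)) (?v, a) (3 * count + 2) (?v(Idx := int count), ?a')"
  proof (rule completes_fill)
    fix i assume i_less: "i < count"
    let ?s = "(?v(Idx := int i), a(Input := overwrite 0 i (\<lambda>i. int (xs ! i)) (a Input)))"
    have "xs ! i \<le> T" using xs_le_u[of "xs ! i"] i_less u_le_T by simp
    then show "safe input_exp ?s \<and> aval input_exp ?s = int (xs ! i) \<and> \<bar>int (xs ! i)\<bar> \<le> word_bound"
      using input_exp_correct[OF input, of ?s i] i_less le_B_if_le_T by simp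
  qed (use count_B in auto)
  from completes_seq[OF size this] have "completes read_input (v, a) (3 * count + 3) (?v(Idx := int count), ?a')"
    unfolding read_input_def by (rule completes_weaken) simp
  then show ?thesis by fastforce
qed

lemma completes_write_output:
  assumes params: "parameters (v, a)"
    and Acc_represented: "represents sum_len (a Acc) (subset_sums (real u) (set xs))"
  shows "\<exists>v' a'. completes write_output (v, a) (3 * u + 196) (v', a') \<and> output_state (v', a')"
proof -
  let ?S = "subset_sums (real u) (set xs)"
  let ?v1 = "v(Idx := int 64)" and ?a1 = "a(Saved := overwrite 0 64 (\<lambda>i. of_bool (i mod sum_len \<in> ?S)) (a Saved))"
  let ?a2 = "?a1(IO := overwrite 0 (u - 63) (\<lambda>i. of_bool (i + 64 \<in> ?S)) (?a1 IO))"
  have saved: "completes (fill Saved (N 0) (Get Acc (V Idx \<odot> V Sum_Len)) (N 64)) (v, a) (3 * 64 + 2) (?v1, ?a1)"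
  proof (rule completes_fill)
    fix i
    let ?s = "(v(Idx := int i), a(Saved := overwrite 0 i (\<lambda>i. of_bool (i mod sum_len \<in> ?S)) (a Saved)))"
    have "aval (V Idx \<odot> V Sum_Len) ?s = int (i mod sum_len)" using params by (simp add: parameters_def zmod_int)
    moreover have "a Acc (i mod sum_len) = of_bool (i mod sum_len \<in> ?S)"
      using Acc_represented two_u_less_sum_len by (simp add: represents_def)
    ultimately show "safe (Get Acc (V Idx \<odot> V Sum_Len)) ?s \<and>
        aval (Get Acc (V Idx \<odot> V Sum_Len)) ?s = of_bool (i mod sum_len \<in> ?S) \<and>
        \<bar>of_bool (i mod sum_len \<in> ?S)\<bar> \<le> word_bound"
      using sixty_four_le_B by simp
  qed (use sixty_four_le_B in auto)
  have "int u div 64 = 0 \<longleftrightarrow> u < 64" by (auto simp: div_eq_0_iff)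
  then have length: "of_bool (int u div 64 \<noteq> 0) * (int u - 63) = int (u - 63)" by auto
  have "completes (fill IO (N 0) (Get Acc (V Idx \<oplus> N 64)) (nonzero (V Bound \<oslash> N 64) \<otimes> (V Bound \<ominus> N 63))) (?v1, ?a1)
      (3 * (u - 63) + 2) (?v1(Idx := int (u - 63)), ?a2)"
  proof (rule completes_fill)
    show "int (u - 63) \<le> word_bound" by (rule le_B_if_le_T) (use u_le_T in linarith)
    fix i assume "i < u - 63"
    then have "a Acc (i + 64) = of_bool (i + 64 \<in> ?S)" "nat (int i + 64) = i + 64"
      using Acc_represented two_u_less_sum_len by (simp_all add: represents_def)
    then show "safe (Get Acc (V Idx \<oplus> N 64)) (?v1(Idx := int i), ?a1(IO := overwrite 0 i (\<lambda>i. of_bool (i + 64 \<in> ?S)) (?a1 IO))) \<and>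
        aval (Get Acc (V Idx \<oplus> N 64)) (?v1(Idx := int i), ?a1(IO := overwrite 0 i (\<lambda>i. of_bool (i + 64 \<in> ?S)) (?a1 IO))) =
          of_bool (i + 64 \<in> ?S) \<and> \<bar>of_bool (i + 64 \<in> ?S)\<bar> \<le> word_bound"
      using sixty_four_le_B by (simp add: valid_index_def)
  qed (use length params u_pos in \<open>auto simp: parameters_def\<close>)
  from completes_seq[OF saved this]
  have "completes write_output (v, a) (3 * u + 196) (?v1(Idx := int (u - 63)), ?a2)"
    unfolding write_output_def by (rule completes_weaken) simp
  moreover have "output_state (?v1(Idx := int (u - 63)), ?a2)"
    using two_u_less_sum_len by (auto simp: output_state_def)
  ultimately show ?thesis by blast
qed

subsection \<open>Correctness\<close>

lemma exponents_le: "ceillog2 (2 * max_quot + 1) \<le> tab_exp" "ceillog2 (2 * u + 1) \<le> tab_exp"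
proof -
  have "1 * width \<le> 4 * count * width" using one_le_count by (intro mult_le_mono1) simp
  then have "width \<le> T" using codes_fit by linarith
  then have "(2::nat) ^ ceillog2 (2 * max_quot + 1) \<le> 2 ^ tab_exp" "(2::nat) ^ ceillog2 (2 * u + 1) \<le> 2 ^ tab_exp"
    using sum_len_le_T unfolding width_def sum_len_def T_def by auto
  then show "ceillog2 (2 * max_quot + 1) \<le> tab_exp" "ceillog2 (2 * u + 1) \<le> tab_exp" by simp_all
qed

lemma twice_le_word_bound: "m \<le> T \<Longrightarrow> 2 * int m \<le> word_bound"
  using T_power_le_B'[of 2] eight_le_T mult_mono[of 2 "int T" "int m" "int T"] by (simp add: power2_eq_square)

lemma completes_compute_sizes:
  assumes vals: "v Count = int count" "v Bound = int u"
  shows "\<exists>v'. completes compute_sizes (v, a) (5 * modulus + 6 * tab_exp + 17) (v', a) \<and>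
    v' Modulus = int modulus \<and> v' Max_Quot = int max_quot \<and> v' Width = int width \<and> v' Sum_Len = int sum_len \<and>
    v' Tab_Len = int T \<and> v' Scale = int scale"
proof -
  let ?v1 = "v(Pow_Two := int (2 ^ lg), Log := int lg)" let ?v2 = "?v1(Modulus := int modulus)"
  let ?v3 = "?v2(Max_Quot := int max_quot)" let ?v4 = "?v3(Width := int width)" let ?v5 =
      "?v4(Sum_Len := int sum_len)"
  let ?v6 = "?v5(Tab_Len := int T)" let ?v7 = "?v6(Scale := int scale)"
  have T_ge: "8 * count * width + sum_len + 8 \<le> T" using tab_len_ge by (simp add: T_def)
  have "2 * int count + 2 \<le> word_bound" using twice_le_word_bound[of "count + 1"] length_xs_le_T one_le_count by simp
  then have log: "completes compute_log (v, a) (3 * lg + 3) (?v1, a)" by (intro completes_compute_log vals)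
  have "int modulus \<le> word_bound" using modulus_le_count length_xs_le_T by (intro le_B_if_le_T) linarith
  then have mod: "completes compute_modulus (?v1, a) (2 * modulus + 2) (?v2, a)"
    unfolding modulus_def using vals by (intro completes_compute_modulus) simp_all
  have "max_quot \<le> u" by simp
  then have "int max_quot \<le> word_bound" using u_le_T by (intro le_B_if_le_T) linarith
  then have quot: "completes (Max_Quot ::= V Bound \<oslash> V Modulus) (?v2, a) 1 (?v3, a)"
    using vals by (intro completes_assign) (simp_all flip: of_nat_div)
  have fits: "2 * u + 1 \<le> T" using two_u_less_sum_len sum_len_le_T by linarith
  then have "2 * max_quot + 1 \<le> T" using \<open>max_quot \<le> u\<close> by linarith
  then have width: "completes (next_power Width (N 2 \<otimes> V Max_Quot \<oplus> N 1)) (?v3, a) (2 * ceillog2 (2 * max_quot + 1) + 2) (?v4, a)"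
    unfolding width_def by (intro completes_next_power twice_le_word_bound) simp_all
  have sum_len: "completes (next_power Sum_Len (N 2 \<otimes> V Bound \<oplus> N 1)) (?v4, a) (2 * ceillog2 (2 * u + 1) + 2) (?v5, a)"
    unfolding sum_len_def using vals fits by (intro completes_next_power twice_le_word_bound) simp_all
  have "completes (next_power Tab_Len (N 8 \<otimes> V Count \<otimes> V Width \<oplus> V Sum_Len \<oplus> N 8)) (?v5, a)
      (2 * ceillog2 (8 * count * width + sum_len + 8) + 2)
      (?v5(Tab_Len := int (2 ^ ceillog2 (8 * count * width + sum_len + 8))), a)"
    using vals T_ge by (intro completes_next_power twice_le_word_bound) simp_all
  then have tab_len: "completes (next_power Tab_Len (N 8 \<otimes> V Count \<otimes> V Width \<oplus> V Sum_Len \<oplus> N 8)) (?v5, a) (2 * tab_exp + 2) (?v6, a)"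
    unfolding T_def unfolding tab_exp_def .
  have scaling: "completes compute_scale (?v6, a) 5 (?v7, a)" by (rule completes_compute_scale) simp
  have "3 * lg + 3 + (2 * modulus + 2 + (1 + (2 * ceillog2 (2 * max_quot + 1) + 2 + (2 * ceillog2 (2 * u + 1) + 2 +
      (2 * tab_exp + 2 + 5))))) \<le> 5 * modulus + 6 * tab_exp + 17"
    using lg_le_modulus exponents_le by linarith
  then have "completes compute_sizes (v, a) (5 * modulus + 6 * tab_exp + 17) (?v7, a)"
    unfolding compute_sizes_def
    by (rule completes_weaken[OF completes_seq[OF log completes_seq[OF mod completes_seq[OF quot
        completes_seq[OF width
          completes_seq[OF sum_len completes_seq[OF tab_len scaling]]]]]]])
  then show ?thesis by (intro exI[of _ ?v7]) simp
qed

definition setup_time :: nat where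
  "setup_time = 3 * count + 5 * modulus + 6 * tab_exp + 6 * T + tab_exp * (192 * tab_exp + 22) + 3 * sum_len + 28"

lemma completes_setup:
  assumes input: "input_state (v, a)"
  shows "\<exists>v' a'. completes setup_state (v, a) setup_time (v', a') \<and> parameters (v', a') \<and>
      represents sum_len (a' Acc) {0}"
proof -
  obtain v1 a1 where read: "completes read_input (v, a) (3 * count + 3) (v1, a1)" "v1 Count = int count"
    "\<forall>i<count. a1 Input i = int (xs ! i)" using completes_read_input[OF input] by blast
  have "v1 Bound = int u" using completes_unchanged_vars[OF read(1)] input by (simp add: input_state_def)
  then obtain v2 where sizes: "completes compute_sizes (v1, a1) (5 * modulus + 6 * tab_exp + 17) (v2, a1)"
    "v2 Modulus = int modulus" "v2 Max_Quot = int max_quot" "v2 Width = int width" "v2 Sum_Len = int sum_len"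
    "v2 Tab_Len = int T" "v2 Scale = int scale"
    using completes_compute_sizes[of v1] read(2) by blast
  obtain v3 a3 where table: "completes make_table (v2, a1) (6 * T + tab_exp * (192 * tab_exp + 22) + 6) (v3, a3)"
    "twiddle_table (complex_arr a3 TabRe TabIm)" using completes_make_table[OF sizes(7,6)] by blast
  have "v3 Bound = int u" "v3 Count = int count"
    using completes_unchanged_vars[OF table(1)] completes_unchanged_vars[OF sizes(1)] read(2) \<open>v1 Bound = int u\<close>
    by simp_all
  then have params: "parameters (v3, a3)"
    using completes_unchanged_vars[OF table(1)] completes_unchanged_arrs[OF table(1)] sizes table(2) read(3)
    by (simp add: parameters_def)
  let ?v4 = "v3(Idx := int sum_len)" and ?a4 = "a3(Acc := overwrite 0 sum_len (\<lambda>i. of_bool (i = 0)) (a3 Acc))"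
  have clear: "completes (fill Acc (N 0) (is_zero (V Idx)) (V Sum_Len)) (v3, a3) (3 * sum_len + 2) (?v4, ?a4)"
    using params le_B_if_le_T[OF sum_len_le_T] sixty_four_le_B by (intro completes_fill) (auto simp: parameters_def)
  have "completes setup_state (v, a) setup_time (?v4, ?a4)"
    unfolding setup_state_def
    by (rule completes_weaken[OF completes_seq[OF read(1) completes_seq[OF sizes(1)
        completes_seq[OF table(1) clear]]]])
      (simp add: setup_time_def)
  moreover have "parameters (?v4, ?a4)" using parameters_unchanged[OF params completes_unchanged_outside[OF clear]]
    by simp
  moreover have "represents sum_len (?a4 Acc) {0}" by (simp add: represents_def)
  ultimately show ?thesis by blast
qed

definition work :: nat where "work = u * modulus * (tab_exp + 1)"

lemma bounds_by_work:
  shows "count \<le> 2 * work" "modulus \<le> work" "tab_exp \<le> work" "u \<le> work" "1 \<le> work" "T \<le> 540 * work"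
    "tab_exp * tab_exp \<le> 540 * work"
proof -
  have u_modulus: "1 \<le> u * modulus" using u_pos one_le_modulus by simp
  have "u * modulus * 1 \<le> work" unfolding work_def by (intro mult_le_mono2) simp
  moreover have "1 * modulus \<le> u * modulus" using u_pos by (intro mult_le_mono1) simp
  ultimately show u_le: "u \<le> work" and "modulus \<le> work" "1 \<le> work" using u_le_u_modulus u_modulus by linarith+
  show "count \<le> 2 * work" using count_le u_le u_pos by linarith
  have "1 * (tab_exp + 1) \<le> work" unfolding work_def using u_modulus by (intro mult_le_mono1)
  then show "tab_exp \<le> work" by simp
  show "T \<le> 540 * work" using tab_len_le \<open>u * modulus * 1 \<le> work\<close> unfolding T_def by linarith
  have "tab_exp * tab_exp \<le> (tab_exp + 1) * (540 * (u * modulus))"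
    using tab_len_le less_exp[of tab_exp] by (intro mult_le_mono) linarith+
  then show "tab_exp * tab_exp \<le> 540 * work" by (simp add: work_def algebra_simps)
qed

lemma classes_time_le: "classes_time \<le> 30000 * work"
proof -
  have "modulus * (4 * count) \<le> modulus * (4 * (2 * u))"
    using count_le u_pos by (intro mult_le_mono2) linarith
  also have "\<dots> = 8 * (u * modulus * 1)" by simp
  also have "\<dots> \<le> 8 * work" unfolding work_def by (intro mult_le_mono2) simp
  finally have reading: "modulus * (4 * count) \<le> 8 * work" .
  have "modulus * (sum_len * (82 * (tab_exp + 1))) \<le> modulus * (5 * u * (82 * (tab_exp + 1)))"
    by (intro mult_le_mono2 mult_le_mono1 sum_len_le)
  also have "\<dots> = 410 * work" by (simp add: work_def algebra_simps)
  finally have adding: "modulus * (sum_len * (82 * (tab_exp + 1))) \<le> 410 * work" .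
  have "(4 * count + 2 * modulus) * width * (102 * (lg + 1) * (tab_exp + 1)) =
      102 * ((4 * count + 2 * modulus) * width * (lg + 1) * (tab_exp + 1))" by (simp only: mult_ac)
  also have "\<dots> \<le> 102 * (288 * (u * modulus) * (tab_exp + 1))" by (intro mult_le_mono2 mult_le_mono1 classes_work_le)
  also have "\<dots> = 29376 * work" by (simp add: work_def algebra_simps)
  finally have merging: "(4 * count + 2 * modulus) * width * (102 * (lg + 1) * (tab_exp + 1)) \<le> 29376 * work" .
  have "classes_time = modulus * (4 * count) + modulus * (sum_len * (82 * (tab_exp + 1))) + 2 * modulus +
      (4 * count + 2 * modulus) * width * (102 * (lg + 1) * (tab_exp + 1)) + 2"
    by (simp add: classes_time_def distrib_left)
  then show ?thesis using reading adding merging bounds_by_work(2,5) by linarith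
qed

lemma setup_time_le: "setup_time \<le> 108000 * work"
proof -
  have "setup_time = 3 * count + 5 * modulus + 28 * tab_exp + 6 * T + 192 * (tab_exp * tab_exp) + 3 * sum_len + 28"
    by (simp add: setup_time_def algebra_simps)
  then show ?thesis using bounds_by_work sum_len_le by linarith
qed

lemma completes_solve:
  assumes "input_state (v, a)"
  shows "\<exists>v' a'. completes solve (v, a) (140000 * work) (v', a') \<and> output_state (v', a')"
proof -
  obtain v1 a1 where start: "completes setup_state (v, a) setup_time (v1, a1)" "parameters (v1, a1)"
    "represents sum_len (a1 Acc) {0}" using completes_setup[OF assms] by blast
  have "modulus \<le> T" using modulus_le_count length_xs_le_T by linarith
  then obtain v2 a2 where adding: "completes process_classes (v1, a1) classes_time (v2, a2)"
    "represents sum_len (a2 Acc) (subset_sums (real u) (set xs))"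
    using completes_process_classes[OF start(2,3)] by blast
  have "parameters (v2, a2)" using parameters_unchanged[OF start(2) completes_unchanged_outside[OF adding(1)]] by simp
  then obtain v3 a3 where writing: "completes write_output (v2, a2) (3 * u + 196) (v3, a3)" "output_state (v3, a3)"
    using completes_write_output adding(2) by blast
  have "setup_time + (classes_time + (3 * u + 196)) \<le> 140000 * work"
    using setup_time_le classes_time_le bounds_by_work(4,5) by linarith
  from completes_weaken[OF completes_seq[OF start(1) completes_seq[OF adding(1) writing(1)]] this]
  have "completes solve (v, a) (140000 * work) (v3, a3)" unfolding solve_def .
  then show ?thesis using writing(2) by blast
qed

end

subsection \<open>The running time in closed form\<close>

lemma one_le_ln_add_2:
  assumes "1 \<le> k"
  shows "1 \<le> ln (real k + 2)"
proof -
  have "exp 1 \<le> real k + 2" using exp_le assms by simp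
  then show ?thesis by (simp add: ln_ge_iff)
qed

lemma le_ln_if_two_power_le:
  assumes "2 ^ k \<le> (x::real)"
  shows "real k \<le> 2 * ln x"
proof -
  have "1 \<le> ln (2 ^ 2 :: real)" using one_le_ln_add_2[of 2] by simp
  then have "1 / 2 \<le> ln (2::real)" by (subst (asm) ln_realpow) simp_all
  then have "real k * (1 / 2) \<le> real k * ln 2" by (rule mult_left_mono) simp
  also have "\<dots> = ln (2 ^ k)" by (simp add: ln_realpow)
  also have "\<dots> \<le> ln x" using assms by (intro ln_mono) (auto intro: less_le_trans[of 0 "2 ^ k"])
  finally show ?thesis by simp
qed

definition time_bound :: "nat \<Rightarrow> nat \<Rightarrow> real" where
  "time_bound u n = sqrt (real n * ln (real n + 2)) * real u * ln (real u + 2)"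

lemma time_bound_nonneg: "0 \<le> time_bound u n"
proof -
  have "0 \<le> ln (real n + 2)" "0 \<le> ln (real u + 2)" by simp_all
  then show ?thesis unfolding time_bound_def by simp
qed

context nonempty_instance
begin

lemma modulus_le_sqrt: "real modulus \<le> 2 * sqrt (real count * ln (real count + 2))"
proof -
  have ln_ge: "1 \<le> ln (real count + 2)" by (rule one_le_ln_add_2[OF one_le_count])
  have "2 ^ (lg - 1) < count + 1" using one_le_lg by (intro two_power_less_if_less_ceillog2) simp
  then have "real (2 ^ (lg - 1)) \<le> real (count + 2)" by (simp only: of_nat_le_iff)
  then have "real (lg - 1) \<le> 2 * ln (real count + 2)" by (intro le_ln_if_two_power_le) simp
  then have lg_le: "real lg \<le> 3 * ln (real count + 2)" using one_le_lg ln_ge by simp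
  have "modulus\<^sup>2 \<le> count * lg" unfolding modulus_def by (rule floor_sqrt_power2_le)
  then have "(real modulus)\<^sup>2 \<le> real count * real lg" by (simp flip: of_nat_mult of_nat_power)
  also have "\<dots> \<le> real count * (3 * ln (real count + 2))" using lg_le by (rule mult_left_mono) simp
  also have "\<dots> \<le> 2\<^sup>2 * (real count * ln (real count + 2))" using ln_ge by (simp add: mult_nonneg_nonneg)
  finally have "real modulus \<le> sqrt (2\<^sup>2 * (real count * ln (real count + 2)))" by (rule real_le_rsqrt)
  then show ?thesis by (simp add: real_sqrt_mult)
qed

lemma tab_exp_le_ln: "real (tab_exp + 1) \<le> 17 * ln (real u + 2)"
proof -
  have "real (2 ^ tab_exp) \<le> real ((u + 2) ^ 8)" using tab_len_le_power by (simp only: of_nat_le_iff)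
  then have "2 ^ tab_exp \<le> (real u + 2) ^ 8" by (simp add: add.commute)
  then have "real tab_exp \<le> 2 * ln ((real u + 2) ^ 8)" by (rule le_ln_if_two_power_le)
  also have "\<dots> = 16 * ln (real u + 2)" by (simp add: ln_realpow)
  finally show ?thesis using one_le_ln_add_2[of u] u_pos by simp
qed

lemma work_le: "real work \<le> 34 * time_bound u count"
proof -
  have "real work = real u * (real modulus * real (tab_exp + 1))" by (simp add: work_def algebra_simps)
  also have "\<dots> \<le> real u * ((2 * sqrt (real count * ln (real count + 2))) * (17 * ln (real u + 2)))"
    by (intro mult_left_mono mult_mono modulus_le_sqrt tab_exp_le_ln) simp_all
  also have "\<dots> = 34 * time_bound u count" by (simp add: time_bound_def)
  finally show ?thesis .
qed

end

section \<open>The machine program\<close>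

text \<open>The input occupies the registers that the compiled program needs, and at first only registers 0 and 1, which hold
  \<open>u\<close> and the number of elements, may be overwritten. Therefore \<open>256 * u\<close>, an address beyond the input, serves as base
  address: storing the number of elements there frees register 1.\<close>
definition save_inputs :: "nat \<Rightarrow> instr list" where
  "save_inputs k = concat (map (\<lambda>j. [Const 1 (16 * int j), Add 1 1 0, Store j 1]) [2..<k])"

definition prologue :: "instr list" where
  "prologue = replicate 8 (Add 0 0 0) @ [Store 1 0] @ save_inputs 64 @ [Const 2 256, Div 1 0 2]"

definition load_outputs :: "nat \<Rightarrow> instr list" where
  "load_outputs k = concat (map (\<lambda>j. [Const j (16 * int j), Add j j 0, Load j j]) [1..<k])"

definition epilogue :: "instr list" where
  "epilogue = load_outputs 64 @ [Load 0 0]"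

definition solve_code :: "instr list" where
  "solve_code = compile_com (4 + length prologue) solve"

definition subset_sum_prog :: prog where
  "subset_sum_prog =
     [Jz 1 2, Jmp 4, Const 0 1, Jmp (4 + length prologue + length solve_code + length epilogue)] @
     prologue @ solve_code @ epilogue"

lemma straight_line_doubling:
  assumes "words_within M m" "\<bar>2 ^ k * m 0\<bar> \<le> M"
  shows "straight_line M (replicate k (Add 0 0 0)) m (m(0 := 2 ^ k * m 0))"
  using assms
proof (induction k arbitrary: m)
  case (Suc k)
  have "1 * \<bar>2 * m 0\<bar> \<le> 2 ^ k * \<bar>2 * m 0\<bar>" by (intro mult_right_mono) auto
  then have "\<bar>2 * m 0\<bar> \<le> \<bar>2 ^ Suc k * m 0\<bar>" by (simp add: abs_mult)
  then have step: "words_within M (m(0 := 2 * m 0))" using Suc.prems by (intro words_within_upd) linarith+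
  have "straight_line M (replicate k (Add 0 0 0)) (m(0 := 2 * m 0)) (m(0 := 2 * m 0, 0 := 2 ^ k * (m(0 := 2 * m 0)) 0))"
    by (rule Suc.IH[OF step]) (use Suc.prems in \<open>simp add: mult.left_commute\<close>)
  moreover have "m(0 := 2 * m 0, 0 := 2 ^ k * (m(0 := 2 * m 0)) 0) = m(0 := 2 ^ Suc k * m 0)" by (simp add: mult_ac)
  ultimately have "straight_line M (replicate k (Add 0 0 0)) (m(0 := 2 * m 0)) (m(0 := 2 ^ Suc k * m 0))"
    by (simp only:)
  moreover have "effect (Add 0 0 0) m = m(0 := 2 * m 0)" by simp
  ultimately show ?case using step by (simp only: replicate_Suc straight_line.simps is_jump.simps simp_thms)
qed simp

lemma straight_line_save_inputs:
  assumes memory: "words_within M m" "m 0 = int base" and base: "64 \<le> base" "int base + 1024 \<le> M"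
    and k_range: "2 \<le> k" "k \<le> 64"
  shows "\<exists>m'. straight_line M (save_inputs k) m m' \<and> m' 0 = int base \<and> (\<forall>x. 2 \<le> x \<and> x \<le> base \<longrightarrow> m' x = m x) \<and>
    (\<forall>j. 2 \<le> j \<and> j < k \<longrightarrow> m' (base + 16 * j) = m j)"
  using k_range
proof (induction k rule: dec_induct)
  case base
  show ?case using memory by (intro exI[of _ m]) (auto simp: save_inputs_def)
next
  case (step k)
  then obtain m1 where saved: "straight_line M (save_inputs k) m m1" "m1 0 = int base"
    "\<And>x. 2 \<le> x \<Longrightarrow> x \<le> base \<Longrightarrow> m1 x = m x" "\<And>j. 2 \<le> j \<Longrightarrow> j < k \<Longrightarrow> m1 (base + 16 * j) = m j" by auto
  have k_range: "2 \<le> k" "k < 64" using step by auto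
  let ?m2 = "m1(1 := int (base + 16 * k), base + 16 * k := m k)"
  have "words_within M m1" using straight_line_words_within[OF saved(1) memory(1)] .
  moreover have "nat (16 * int k + int base) = base + 16 * k" by simp
  ultimately have "straight_line M [Const 1 (16 * int k), Add 1 1 0, Store k 1] m1 ?m2"
    using k_range base saved(2,3) words_withinD(1)[OF memory(1), of k]
    by (auto simp: add.commute intro!: words_within_upd)
  moreover have "save_inputs (Suc k) = save_inputs k @ [Const 1 (16 * int k), Add 1 1 0, Store k 1]"
    using k_range by (simp add: save_inputs_def)
  ultimately have "straight_line M (save_inputs (Suc k)) m ?m2" using straight_line_append[OF saved(1)] by simp
  moreover have "?m2 (base + 16 * j) = m j" if "2 \<le> j" "j < Suc k" for j
    using that saved(4)[of j] base(1) by (auto simp: less_Suc_eq)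
  moreover have "?m2 0 = int base" "\<forall>x. 2 \<le> x \<and> x \<le> base \<longrightarrow> ?m2 x = m x" using saved(2,3) base(1) k_range by auto
  ultimately show ?case by blast
qed

lemma straight_line_prologue:
  assumes memory: "words_within M m" "m 0 = int u" "m 1 = int n" and u_pos: "0 < u"
    and limit: "256 * int u + 1024 \<le> M"
  shows "\<exists>m'. straight_line M prologue m m' \<and> m' 0 = int (256 * u) \<and> m' 1 = int u \<and>
    (\<forall>x. 3 \<le> x \<and> x < 256 * u \<longrightarrow> m' x = m x) \<and> m' (256 * u) = int n \<and>
    (\<forall>j. 2 \<le> j \<and> j < 64 \<longrightarrow> m' (256 * u + 16 * j) = m j)"
proof -
  let ?m1 = "m(0 := 256 * int u)" let ?m2 = "?m1(256 * u := int n)"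
  have doubling: "straight_line M (replicate 8 (Add 0 0 0)) m ?m1"
    using straight_line_doubling[OF memory(1), of 8] memory(2) limit by simp
  have stored_within: "words_within M ?m2"
    by (rule words_within_upd[OF straight_line_words_within[OF doubling memory(1)]])
      (use words_withinD(1)[OF memory(1), of 1] memory(3) in simp)
  have store: "straight_line M [Store 1 0] ?m1 ?m2" using stored_within memory(3) by (simp add: nat_mult_distrib)
  obtain m3 where saved: "straight_line M (save_inputs 64) ?m2 m3" "m3 0 = int (256 * u)"
    "\<And>x. 2 \<le> x \<Longrightarrow> x \<le> 256 * u \<Longrightarrow> m3 x = ?m2 x" "\<And>j. 2 \<le> j \<Longrightarrow> j < 64 \<Longrightarrow> m3 (256 * u + 16 * j) = ?m2 j"
    using straight_line_save_inputs[OF stored_within, of "256 * u" 64] u_pos limit by auto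
  let ?m4 = "m3(2 := 256, 1 := int u)"
  have "words_within M m3" using straight_line_words_within[OF saved(1) stored_within] .
  then have "straight_line M [Const 2 256, Div 1 0 2] m3 ?m4" using saved(2) limit u_pos
    by (auto intro!: words_within_upd)
  from straight_line_append[OF doubling straight_line_append[OF store straight_line_append[OF saved(1) this]]]
  have "straight_line M prologue m ?m4" unfolding prologue_def .
  moreover have "?m4 x = m x" if "3 \<le> x" "x < 256 * u" for x using that saved(3)[of x] by simp
  moreover have "?m4 (256 * u) = int n" using saved(3)[of "256 * u"] u_pos by simp
  moreover have "?m4 (256 * u + 16 * j) = m j" if "2 \<le> j" "j < 64" for j using saved(4)[of j] that u_pos by simp
  ultimately show ?thesis using saved(2) by (intro exI[of _ ?m4]) auto
qed

lemma straight_line_load_outputs: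
  assumes memory: "words_within M m" "m 0 = int base" and base: "64 \<le> base" "int base + 1024 \<le> M"
    and k_range: "1 \<le> k" "k \<le> 64"
  shows "\<exists>m'. straight_line M (load_outputs k) m m' \<and> m' 0 = int base \<and> (\<forall>x\<ge>64. m' x = m x) \<and>
    (\<forall>j. 1 \<le> j \<and> j < k \<longrightarrow> m' j = m (base + 16 * j))"
  using k_range
proof (induction k rule: dec_induct)
  case base
  show ?case using memory by (intro exI[of _ m]) (auto simp: load_outputs_def)
next
  case (step k)
  then obtain m1 where loaded: "straight_line M (load_outputs k) m m1" "m1 0 = int base" "\<And>x. 64 \<le> x \<Longrightarrow> m1 x = m x"
    "\<And>j. 1 \<le> j \<Longrightarrow> j < k \<Longrightarrow> m1 j = m (base + 16 * j)" by auto
  have k_range: "1 \<le> k" "k < 64" using step by auto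
  let ?m2 = "m1(k := m (base + 16 * k))"
  have "words_within M m1" using straight_line_words_within[OF loaded(1) memory(1)] .
  moreover have "nat (16 * int k + int base) = base + 16 * k" by simp
  ultimately have "straight_line M [Const k (16 * int k), Add k k 0, Load k k] m1 ?m2"
    using k_range base loaded(2) loaded(3)[of "base + 16 * k"] words_withinD(1)[OF memory(1), of "base + 16 * k"]
    by (auto intro!: words_within_upd)
  moreover have "load_outputs (Suc k) = load_outputs k @ [Const k (16 * int k), Add k k 0, Load k k]"
    using k_range by (simp add: load_outputs_def)
  ultimately have "straight_line M (load_outputs (Suc k)) m ?m2" using straight_line_append[OF loaded(1)] by simp
  moreover have "\<forall>j. 1 \<le> j \<and> j < Suc k \<longrightarrow> ?m2 j = m (base + 16 * j)" using loaded(4) by (auto simp: less_Suc_eq)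
  moreover have "?m2 0 = int base" "\<forall>x\<ge>64. ?m2 x = m x" using loaded(2,3) k_range by auto
  ultimately show ?case by blast
qed

lemma straight_line_epilogue:
  assumes memory: "words_within M m" "m 0 = int base" and base: "64 \<le> base" "int base + 1024 \<le> M"
  shows "\<exists>m'. straight_line M epilogue m m' \<and> (\<forall>x\<ge>64. m' x = m x) \<and> (\<forall>j<64. m' j = m (base + 16 * j))"
proof -
  obtain m1 where loaded: "straight_line M (load_outputs 64) m m1" "m1 0 = int base" "\<And>x. 64 \<le> x \<Longrightarrow> m1 x = m x"
    "\<And>j. 1 \<le> j \<Longrightarrow> j < 64 \<Longrightarrow> m1 j = m (base + 16 * j)"
    using straight_line_load_outputs[OF memory base, of 64] by auto
  let ?m2 = "m1(0 := m base)"
  have "words_within M ?m2"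
    using straight_line_words_within[OF loaded(1) memory(1)] words_withinD(1)[OF memory(1)] by (rule words_within_upd)
  then have "straight_line M [Load 0 0] m1 ?m2" using loaded(2) loaded(3)[of base] base(1) by simp
  from straight_line_append[OF loaded(1) this] have "straight_line M epilogue m ?m2" unfolding epilogue_def .
  moreover have "?m2 j = m (base + 16 * j)" if "j < 64" for j using that loaded(4)[of j] by (cases "j = 0") auto
  ultimately show ?thesis using loaded(3) by (intro exI[of _ ?m2]) auto
qed

lemma com_fits_convolve: "com_fits convolve"
  by (simp add: convolve_def transform_inputs_def to_fixed_point_def fft_def ifft_def forward_pass_def
      inverse_pass_def forward_exp_def
    inverse_exp_def round_exp_def update_pair_def complex_times_def complex_get_def complex_plus_def complex_minus_def
    complex_cnj_def complex_if_def Let_def odd_exp_def low_exp_def high_exp_def block_exp_def fill_def for_upto_def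
    nonzero_def is_zero_def)

lemma com_fits_solve: "com_fits solve"
  using com_fits_convolve
  by (simp add: solve_def setup_state_def read_input_def input_exp_def compute_sizes_def compute_log_def
    compute_modulus_def next_power_def compute_scale_def make_table_def double_table_def halve_angle_def isqrt_def
    isqrt_step_def rotated_exp_def complex_times_def complex_get_def process_classes_def process_class_def
    compute_codes_def compute_leaves_def filter_class_def leaf_exp_def merge_all_def merge_level_def merge_blocks_def
        load_block_def
    scatter_def value_exp_def relevant_exp_def add_sums_def write_output_def fill_def for_upto_def nonzero_def
    is_zero_def at_most_def)

lemma subset_sum_prog_layout:
  shows "code_at subset_sum_prog 4 prologue" "code_at subset_sum_prog (4 + length prologue) solve_code"
    "code_at subset_sum_prog (4 + length prologue + length solve_code) epilogue"
    "length subset_sum_prog = 4 + length prologue + length solve_code + length epilogue"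
proof -
  let ?head = "[Jz 1 2, Jmp 4, Const 0 1, Jmp (4 + length prologue + length solve_code + length epilogue)]"
  have "length ?head = 4" by simp
  then have "code_at subset_sum_prog 4 (prologue @ solve_code @ epilogue)"
    using code_at_infix[of ?head "prologue @ solve_code @ epilogue" "[]"]
    by (simp only: subset_sum_prog_def append_Nil2)
  then show "code_at subset_sum_prog 4 prologue" "code_at subset_sum_prog (4 + length prologue) solve_code"
    "code_at subset_sum_prog (4 + length prologue + length solve_code) epilogue"
      by (simp_all add: code_at_append add.assoc)
  show "length subset_sum_prog = 4 + length prologue + length solve_code + length epilogue"
    by (simp add: subset_sum_prog_def)
qed

lemma subset_sum_prog_head:
  "subset_sum_prog ! 0 = Jz 1 2" "subset_sum_prog ! 1 = Jmp 4" "subset_sum_prog ! 2 = Const 0 1"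
  "subset_sum_prog ! 3 = Jmp (length subset_sum_prog)"
  by (simp_all add: subset_sum_prog_def)

lemma run_without_elements:
  assumes u_pos: "0 < u" and limit: "int u \<le> M"
  shows "reaches subset_sum_prog M (init_config u []) 3 (length subset_sum_prog, (init_mem u [])(0 := 1))"
proof -
  let ?P = subset_sum_prog and ?m = "init_mem u []"
  have length: "4 \<le> length ?P" using subset_sum_prog_layout(4) by simp
  have init_within: "words_within M ?m" using limit by (auto simp: words_within_def init_mem_def)
  have result_within: "words_within M (?m(0 := 1))" using init_within limit u_pos by (intro words_within_upd) auto
  have "reaches ?P M (0, ?m) 1 (2, ?m)"
    by (rule reaches_step[OF init_within _ _ init_within])
      (use length in \<open>auto simp: subset_sum_prog_head init_mem_def\<close>)
  moreover have "reaches ?P M (2, ?m) 1 (3, ?m(0 := 1))"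
    by (rule reaches_step[OF init_within _ _ result_within]) (use length in \<open>auto simp: subset_sum_prog_head\<close>)
  moreover have "reaches ?P M (3, ?m(0 := 1)) 1 (length ?P, ?m(0 := 1))"
    by (rule reaches_step[OF result_within _ _ result_within]) (use length in \<open>auto simp: subset_sum_prog_head\<close>)
  ultimately have "reaches ?P M (0, ?m) (1 + 1 + 1) (length ?P, ?m(0 := 1))" by (blast intro: reaches_trans)
  then show ?thesis by (simp add: init_config_def numeral_3_eq_3)
qed

context nonempty_instance
begin

sublocale memory_layout word_bound "256 * int u - 64" "256 * u"
  by standard (use linear_le_word_bound u_pos in auto)

lemma words_within_init_mem: "words_within word_bound (init_mem u xs)"
proof -
  have "int (xs ! i) \<le> word_bound" if "i < count" for i
    using xs_le_u[of "xs ! i"] that u_le_T by (intro le_B_if_le_T) simp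
  moreover have "int count \<le> word_bound" "int u \<le> word_bound"
    using length_xs_le_T u_le_T by (intro le_B_if_le_T; linarith)+
  ultimately show ?thesis using linear_le_word_bound by (auto simp: words_within_def init_mem_def)
qed

lemma straight_line_prologue_encodes:
  "\<exists>m v a. straight_line word_bound prologue (init_mem u xs) m \<and> encodes (v, a) m \<and> within_limits (v, a) \<and>
    input_state (v, a)"
proof -
  have "init_mem u xs 0 = int u" "init_mem u xs 1 = int count" by (simp_all add: init_mem_def)
  from straight_line_prologue[OF words_within_init_mem this u_pos linear_le_word_bound]
  obtain m where prologue: "straight_line word_bound prologue (init_mem u xs) m" "m 0 = int (256 * u)" "m 1 = int u"
    "\<And>x. 3 \<le> x \<Longrightarrow> x < 256 * u \<Longrightarrow> m x = init_mem u xs x" "m (256 * u) = int count"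
    "\<And>j. 2 \<le> j \<Longrightarrow> j < 64 \<Longrightarrow> m (256 * u + 16 * j) = init_mem u xs j"
    by auto
  have elements: "init_mem u xs (i + 2) = int (xs ! i)" if "i < count" for i using that by (simp add: init_mem_def)
  define v where "v x = m (var_reg x)" for x
  define a where "a k i = (if valid_index k (int i) then m (address (256 * u) k i) else 0)" for k i
  have "words_within word_bound m" using straight_line_words_within[OF prologue(1) words_within_init_mem] .
  then have "within_limits (v, a)" using sixty_four_le_B
    by (auto simp: within_limits_def words_within_def v_def a_def)
  have "v Bound = int u" "a Saved 0 = int count"
    using prologue(3,5) by (simp_all add: v_def a_def address_def valid_index_def)
  moreover have "(if i < 62 then a Saved (i + 2) else a IO (i - 62)) = int (xs ! i)" if i_less: "i < count" for i
  proof (cases "i < 62")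
    case True
    then show ?thesis using prologue(6)[of "i + 2"] elements[OF i_less]
      by (simp add: a_def address_def valid_index_def)
  next
    case False
    have "i + 2 < 256 * u" using i_less count_le u_pos by linarith
    then show ?thesis using False prologue(4)[of "i + 2"] elements[OF i_less]
      by (simp add: a_def address_def valid_index_def)
  qed
  ultimately have "input_state (v, a)" unfolding input_state_def fst_conv snd_conv by blast
  moreover have "encodes (v, a) m" using prologue(2) by (simp add: encodes_def v_def a_def)
  ultimately show ?thesis using prologue(1) \<open>within_limits (v, a)\<close> by (intro exI conjI)
qed

lemma straight_line_epilogue_output:
  assumes "encodes (v, a) m" "output_state (v, a)" "words_within M m" "word_bound \<le> M"
  shows "\<exists>m'. straight_line M epilogue m m' \<and> (\<forall>j\<le>u. m' j = of_bool (j \<in> subset_sums (real u) (set xs)))"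
proof -
  have "m 0 = int (256 * u)" using assms(1) by (simp add: encodes_def)
  then obtain m' where epilogue: "straight_line M epilogue m m'" "\<And>x. 64 \<le> x \<Longrightarrow> m' x = m x"
    "\<And>j. j < 64 \<Longrightarrow> m' j = m (256 * u + 16 * j)"
    using straight_line_epilogue[OF assms(3), of "256 * u"] linear_le_word_bound assms(4) u_pos by auto
  have "m' j = of_bool (j \<in> subset_sums (real u) (set xs))" if j_le: "j \<le> u" for j
  proof -
    have address: "m (address (256 * u) k i) = a k i" if "valid_index k (int i)" for k i
      using assms(1) that by (simp add: encodes_def)
    have "m' j = (if j < 64 then a Saved j else a IO (j - 64))"
      using epilogue(2,3)[of j] address[of Saved j] address[of IO "j - 64"] j_le u_pos
      by (auto simp: address_def valid_index_def)
    then show ?thesis using assms(2)[unfolded output_state_def snd_conv, rule_format, OF j_le] by (rule trans)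
  qed
  then show ?thesis using epilogue(1) by blast
qed

lemma run_with_elements:
  assumes limit: "word_bound ^ (com_weight solve + 3) \<le> M"
  shows "\<exists>t m. reaches subset_sum_prog M (init_config u xs) t (length subset_sum_prog, m) \<and>
    t \<le> length solve_code * (140000 * work) + length prologue + length epilogue + 2 \<and>
    (\<forall>j\<le>u. m j = of_bool (j \<in> subset_sums (real u) (set xs)))"
proof -
  let ?P = subset_sum_prog and ?m = "init_mem u xs"
  have "word_bound ^ 1 \<le> M" by (rule B_power_le[OF limit]) simp
  then have B_le_M: "word_bound \<le> M" by simp
  have init_within: "words_within M ?m" using words_within_mono[OF words_within_init_mem B_le_M] .
  have length: "4 \<le> length ?P" using subset_sum_prog_layout(4) by simp
  have "reaches ?P M (0, ?m) 1 (1, ?m)"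
    by (rule reaches_step[OF init_within _ _ init_within])
      (use length nonempty in \<open>auto simp: subset_sum_prog_head init_mem_def\<close>)
  moreover have "reaches ?P M (1, ?m) 1 (4, ?m)"
    by (rule reaches_step[OF init_within _ _ init_within])
      (use length in \<open>auto simp: subset_sum_prog_head(2)[simplified]\<close>)
  ultimately have head: "reaches ?P M (0, ?m) (1 + 1) (4, ?m)" by (rule reaches_trans)
  obtain m1 v a where start: "straight_line word_bound prologue ?m m1" "encodes (v, a) m1" "within_limits (v, a)"
    "input_state (v, a)" using straight_line_prologue_encodes by blast
  note prologue = straight_line_mono[OF start(1) B_le_M]
  obtain t v' a' where solve: "big_step solve (v, a) t (v', a')" "t \<le> 140000 * work" "output_state (v', a')"
    using completes_solve[OF start(4)] by (auto simp: completes_def)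
  have "simulates ?P M (4 + length prologue) (v, a) (length solve_code * t) (4 + length prologue + length solve_code) (v', a')"
    using compile_com_correct[OF solve(1) start(3) com_fits_solve _ limit] subset_sum_prog_layout(2)
    by (simp add: solve_code_def)
  then obtain t2 m2 where middle: "reaches ?P M (4 + length prologue, m1) t2 (4 + length prologue + length solve_code, m2)"
    "t2 \<le> length solve_code * t" "encodes (v', a') m2" "words_within M m2"
    using start(2) straight_line_words_within[OF prologue init_within] unfolding simulates_def by blast
  obtain m3 where finish: "straight_line M epilogue m2 m3" "\<forall>j\<le>u. m3 j = of_bool (j \<in> subset_sums (real u) (set xs))"
    using straight_line_epilogue_output[OF middle(3) solve(3) middle(4) B_le_M] by blast
  have "reaches ?P M (0, ?m) (1 + 1 + (length prologue + (t2 + length epilogue))) (length ?P, m3)"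
    using reaches_trans[OF head reaches_trans[OF straight_line_reaches[OF prologue init_within
        subset_sum_prog_layout(1)]
      reaches_trans[OF middle(1) straight_line_reaches[OF finish(1) middle(4) subset_sum_prog_layout(3)]]]]
    unfolding subset_sum_prog_layout(4) .
  moreover have "t2 \<le> length solve_code * (140000 * work)"
    using middle(2) mult_le_mono2[OF solve(2), of "length solve_code"] by linarith
  ultimately show ?thesis using finish(2) unfolding init_config_def
    by (intro exI[of _ "1 + 1 + (length prologue + (t2 + length epilogue))"] exI[of _ m3]) simp
qed

end

definition word_exponent :: nat where
  "word_exponent = 512 * (com_weight solve + 3)"

definition time_constant :: real where
  "time_constant = 34 * 140000 * real (length solve_code) + real (length prologue + length epilogue + 3)"

lemma subset_sum_prog_correct:
  assumes u_pos: "0 < u" and elements: "distinct xs" "set xs \<subseteq> {..u}"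
  shows "\<exists>t m. reaches subset_sum_prog ((int u + 2) ^ word_exponent) (init_config u xs) t (length subset_sum_prog, m) \<and>
    real t \<le> time_constant * time_bound u (length xs) + time_constant \<and>
    (\<forall>j\<le>u. m j = of_bool (j \<in> subset_sums (real u) (set xs)))"
proof (cases "xs = []")
  case True
  have "int u + 2 \<le> (int u + 2) ^ word_exponent" by (rule self_le_power) (simp_all add: word_exponent_def)
  then have "reaches subset_sum_prog ((int u + 2) ^ word_exponent) (init_config u xs) 3
      (length subset_sum_prog, (init_mem u [])(0 := 1))"
    unfolding True using u_pos by (intro run_without_elements) auto
  moreover have "0 \<le> time_constant * time_bound u (length xs)" "3 \<le> time_constant"
    using time_bound_nonneg by (simp_all add: time_constant_def)
  moreover have "((init_mem u [])(0 := 1)) j = of_bool (j \<in> subset_sums (real u) (set xs))" for j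
    using u_pos by (simp add: True subset_sums_empty init_mem_def)
  ultimately show ?thesis by (intro exI[of _ 3] exI[of _ "(init_mem u [])(0 := 1)"]) simp
next
  case False
  interpret nonempty_instance u xs by standard (use u_pos elements False in auto)
  have "word_bound ^ (com_weight solve + 3) = (int u + 2) ^ word_exponent"
    by (simp only: word_bound_def word_exponent_def power_mult)
  then obtain t m where run: "reaches subset_sum_prog ((int u + 2) ^ word_exponent) (init_config u xs) t (length subset_sum_prog, m)"
    "t \<le> length solve_code * (140000 * work) + length prologue + length epilogue + 2"
    "\<forall>j\<le>u. m j = of_bool (j \<in> subset_sums (real u) (set xs))"
    using run_with_elements[OF eq_refl] by auto
  have "real t \<le> real (length solve_code) * (140000 * real work) + real (length prologue + length epilogue + 2)"
    using run(2) by (simp flip: of_nat_le_iff[where 'a = real])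
  also have "\<dots> \<le> real (length solve_code) * (140000 * (34 * time_bound u count)) + time_constant"
    using work_le by (intro add_mono mult_left_mono) (simp_all add: time_constant_def)
  also have "\<dots> \<le> time_constant * time_bound u count + time_constant"
    using mult_right_mono[OF _ time_bound_nonneg, of "34 * 140000 * real (length solve_code)" time_constant u count]
    by (simp add: time_constant_def algebra_simps)
  finally show ?thesis using run(1,3) by blast
qed

theorem theorem3p4:
  shows "\<exists>(P::prog) (C::real) (K::nat).
    \<forall>(u::nat) (xs::nat list). u > 0 \<longrightarrow> distinct xs \<longrightarrow> set xs \<subseteq> upto_set (real u) \<longrightarrow>
      (let n = length xs in
       \<exists>t::nat.
         halted P (run P t (init_config u xs)) \<and>
         real t \<le> C * (sqrt (real n * ln (real n + 2)) * real u * ln (real u + 2)) + C \<and>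
         (\<forall>t'\<le>t. \<forall>a. \<bar>snd (run P t' (init_config u xs)) a\<bar> \<le> (int u + 2) ^ K) \<and>
         (\<forall>v\<le>u. snd (run P t (init_config u xs)) v =
             (if v \<in> subset_sums (real u) (set xs) then 1 else 0)))"
proof (intro exI allI impI)
  fix u :: nat and xs :: "nat list"
  assume "u > 0" "distinct xs" "set xs \<subseteq> upto_set (real u)"
  then obtain t m where "reaches subset_sum_prog ((int u + 2) ^ word_exponent) (init_config u xs) t (length subset_sum_prog, m)"
    "real t \<le> time_constant * time_bound u (length xs) + time_constant"
    "\<forall>j\<le>u. m j = of_bool (j \<in> subset_sums (real u) (set xs))"
    using subset_sum_prog_correct[of u xs] by (auto simp: upto_set_def atLeast0AtMost)
  then show "let n = length xs in \<exists>t::nat. halted subset_sum_prog (run subset_sum_prog t (init_config u xs)) \<and>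
      real t \<le> time_constant * (sqrt (real n * ln (real n + 2)) * real u * ln (real u + 2)) + time_constant \<and>
      (\<forall>t'\<le>t. \<forall>a. \<bar>snd (run subset_sum_prog t' (init_config u xs)) a\<bar> \<le> (int u + 2) ^ word_exponent) \<and>
      (\<forall>v\<le>u. snd (run subset_sum_prog t (init_config u xs)) v = (if v \<in> subset_sums (real u) (set xs) then 1 else 0))"
    unfolding Let_def by (intro exI[of _ t]) (simp add: reaches_def words_within_def halted_def time_bound_def)
qed

end
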